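(* Let $(A,b)\in\mathcal B$ (setting $\mathcal B$), let $\gamma:=\frac{\mathrm{tr}(A)}{|A|^2+|b|^2}$, $\tilde A:=\gamma A$, $\tilde b:=\gamma b$, and let $B_2:H^1_{\mathrm{per},0}(Y;\mathbb{R}^n)\times H^1_{\mathrm{per},0}(Y;\mathbb{R}^n)\to\mathbb{R}$ be given by $$B_2(v,w):=\int_Y(\nabla\cdot v)(\tilde A:Dw+\tilde b\cdot w)+\frac12\int_Y(Dv-(Dv)^{\mathrm T}):(Dw-(Dw)^{\mathrm T}).$$ Let $\rho\in H^1_{\mathrm{per},0}(Y;\mathbb{R}^n)$ be the unique element with $B_2(\rho,w)=\int_Y(\tilde A:Dw+\tilde b\cdot w)$ for all $w\in H^1_{\mathrm{per},0}(Y;\mathbb{R}^n)$, and let $\tilde r\in L^2_{\mathrm{per}}(Y)$ be the unique solution in $L^2_{\mathrm{per}}(Y)$ to $-D^2:(\tilde A\tilde r)+\nabla\cdot(\tilde b\tilde r)=0$ in $Y$, $\tilde r$ $Y$-periodic, $\int_Y\tilde r=1$. Let $P_h$ be a closed linear subspace of $H^1_{\mathrm{per},0}(Y;\mathbb{R}^n)$. Then there exists a unique $\rho_h\in P_h$ such that $$B_2(\rho_h,w_h)=\int_Y\left(\tilde A:Dw_h+\tilde b\cdot w_h\right)\qquad\forall\,w_h\in P_h,$$ and setting $\tilde r_h:=1-\nabla\cdot\rho_h\in L^2_{\mathrm{per}}(Y)$, there holds $$\|\tilde r-\tilde r_h\|_{L^2(Y)}\le C\inf_{w_h\in P_h}\|D(\rho-w_h)\|_{L^2(Y;\mathbb{R}^{n\times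 n})}$$ for some constant $C=C(\lambda,\Lambda,\delta,n)>0$.
   Context: $Y:=(0,1)^n\subset\mathbb{R}^n$. The subscript "per" denotes spaces of $Y$-periodic functions on $\mathbb{R}^n$ with the indicated (local) regularity; the additional subscript $0$ means that (each component of) the function has mean zero over $Y$. $|A|:=\sqrt{A:A}$ is the Frobenius norm, $|b|$ the Euclidean norm, $M:N=\sum_{ij}M_{ij}N_{ij}$, and $Dw$ is the Jacobian of $w$. Setting $\mathcal B$: $(A,b)\in\mathcal B$ means that $A\in L^\infty_{\mathrm{per}}(Y;\mathbb{R}^{n\times n}_{\mathrm{sym}})$, $b\in L^\infty_{\mathrm{per}}(Y;\mathbb{R}^n)$; $A$ is uniformly elliptic, i.e. there are $\lambda,\Lambda>0$ with $\lambda I_n\le A\le\Lambda I_n$ a.e. in $\mathbb{R}^n$; and the Cordes-type condition holds: there exists $\delta\in\left(\frac{n}{n+\pi^2},1\right]$ such that $\frac{|A|^2+|b|^2}{(\mathrm{tr}(A))^2}\le\frac{1}{n-1+\delta}$ a.e. in $\mathbb{R}^n$. The constants $\lambda,\Lambda,\delta$ in the claim are these. $D^2:(\tilde A u):=\sum_{i,j}\partial^2_{ij}(\tilde a_{ij}u)$. Solutions $\tilde r\in L^2_{\mathrm{per}}(Y)$ are understood in the very weak sense: $\int_Y\tilde r(\tilde A:D^2\varphi+\tilde b\cdot\nabla\varphi)=0$ for all $\varphi\in H^2_{\mathrm{per}}(Y)$. Existence and uniqueness of $\rho$ and $\tilde r$ are established in the paper. *)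

theory Defs
  imports "HOL-Analysis.Analysis"
begin

text \<open>
  Elements of \<open>L\<^sup>2\<close>, \<open>L\<^sup>\<infinity>\<close> and Sobolev spaces are represented by Lebesgue measurable functions
  on all of \<open>real ^ 'n\<close>, not by equivalence classes.  All spaces below are closed under
  modification on null sets, and uniqueness of an element means uniqueness almost everywhere.

  The library norm on \<open>real ^ 'n ^ 'n\<close> is the Frobenius norm and its inner product is
  \<open>M : N\<close>; the norm on \<open>real ^ 'n\<close> is the Euclidean norm.
\<close>

lemma inner_matrix_eq: "(M :: real ^ 'n ^ 'm) \<bullet> N = (\<Sum>i\<in>UNIV. \<Sum>j\<in>UNIV. M $ i $ j * N $ i $ j)"
  by (simp add: inner_vec_def)

definition unit_cell :: "(real ^ 'n) set" where
  "unit_cell = {x. \<forall>i. 0 < x $ i \<and> x $ i < 1}"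

definition ae_periodic :: "(real ^ 'n \<Rightarrow> 'b) \<Rightarrow> bool" where
  "ae_periodic u \<longleftrightarrow> (\<forall>i. AE x in lebesgue. u (x + axis i 1) = u x)"

definition Linf_per :: "(real ^ 'n \<Rightarrow> 'b::euclidean_space) set" where
  "Linf_per = {u. u \<in> borel_measurable lebesgue \<and> ae_periodic u \<and>
     (\<exists>M. AE x in lebesgue. norm (u x) \<le> M)}"

definition L2_per :: "(real ^ 'n \<Rightarrow> 'b::euclidean_space) set" where
  "L2_per = {u. u \<in> borel_measurable lebesgue \<and> ae_periodic u \<and>
     integrable (lebesgue_on unit_cell) (\<lambda>x. (norm (u x))\<^sup>2)}"

definition L2_norm :: "(real ^ 'n \<Rightarrow> 'b::euclidean_space) \<Rightarrow> real" where
  "L2_norm u = sqrt (\<integral>x. (norm (u x))\<^sup>2 \<partial>lebesgue_on unit_cell)"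


subsection \<open>Weak derivatives\<close>

definition partial_deriv :: "'n \<Rightarrow> (real ^ 'n \<Rightarrow> real) \<Rightarrow> real ^ 'n \<Rightarrow> real" where
  "partial_deriv i f x = frechet_derivative f (at x) (axis i 1)"

text \<open>All iterated partial derivatives are totally differentiable everywhere, i.e. \<open>f\<close> is
  \<open>C\<^sup>\<infinity>\<close> on the whole space.\<close>

definition smooth :: "(real ^ 'n \<Rightarrow> real) \<Rightarrow> bool" where
  "smooth f \<longleftrightarrow> (\<forall>is x. foldr partial_deriv is f differentiable (at x))"

definition test_function :: "(real ^ 'n \<Rightarrow> real) \<Rightarrow> bool" where
  "test_function \<phi> \<longleftrightarrow> smooth \<phi> \<and> compact (closure {x. \<phi> x \<noteq> 0})"

definition loc_integrable :: "(real ^ 'n \<Rightarrow> real) \<Rightarrow> bool" where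
  "loc_integrable u \<longleftrightarrow> (\<forall>K. compact K \<longrightarrow> u absolutely_integrable_on K)"

definition has_weak_partial :: "'n \<Rightarrow> (real ^ 'n \<Rightarrow> real) \<Rightarrow> (real ^ 'n \<Rightarrow> real) \<Rightarrow> bool" where
  "has_weak_partial i u g \<longleftrightarrow> loc_integrable u \<and> loc_integrable g \<and>
     (\<forall>\<phi>. test_function \<phi> \<longrightarrow>
        (\<integral>x. u x * partial_deriv i \<phi> x \<partial>lebesgue) = - (\<integral>x. g x * \<phi> x \<partial>lebesgue))"

text \<open>A weak derivative is determined only up to null sets; \<open>weak_partial\<close> selects a
  representative and is meaningful only where a weak derivative exists.\<close>

definition weak_partial :: "'n \<Rightarrow> (real ^ 'n \<Rightarrow> real) \<Rightarrow> real ^ 'n \<Rightarrow> real" where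
  "weak_partial i u = (SOME g. has_weak_partial i u g)"

definition weak_grad :: "(real ^ 'n \<Rightarrow> real) \<Rightarrow> real ^ 'n \<Rightarrow> real ^ 'n" where
  "weak_grad u x = (\<chi> i. weak_partial i u x)"

definition weak_jacobian :: "(real ^ 'n \<Rightarrow> real ^ 'n) \<Rightarrow> real ^ 'n \<Rightarrow> real ^ 'n ^ 'n" where
  "weak_jacobian w x = (\<chi> i j. weak_partial j (\<lambda>y. w y $ i) x)"

definition weak_div :: "(real ^ 'n \<Rightarrow> real ^ 'n) \<Rightarrow> real ^ 'n \<Rightarrow> real" where
  "weak_div w x = (\<Sum>i\<in>UNIV. weak_partial i (\<lambda>y. w y $ i) x)"

definition weak_hessian :: "(real ^ 'n \<Rightarrow> real) \<Rightarrow> real ^ 'n \<Rightarrow> real ^ 'n ^ 'n" where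
  "weak_hessian u x = (\<chi> i j. weak_partial i (weak_partial j u) x)"


subsection \<open>Periodic Sobolev spaces\<close>

definition H1_per :: "(real ^ 'n \<Rightarrow> real) set" where
  "H1_per = {u \<in> L2_per. \<forall>i. \<exists>g\<in>L2_per. has_weak_partial i u g}"

definition H2_per :: "(real ^ 'n \<Rightarrow> real) set" where
  "H2_per = {u \<in> H1_per. \<forall>i. weak_partial i u \<in> H1_per}"

definition H1_per0 :: "(real ^ 'n \<Rightarrow> real ^ 'n) set" where
  "H1_per0 = {w. \<forall>i. (\<lambda>x. w x $ i) \<in> H1_per \<and> (\<integral>x. w x $ i \<partial>lebesgue_on unit_cell) = 0}"

definition H1_norm :: "(real ^ 'n \<Rightarrow> real ^ 'n) \<Rightarrow> real" where
  "H1_norm w = sqrt ((L2_norm w)\<^sup>2 + (L2_norm (weak_jacobian w))\<^sup>2)"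

text \<open>Closedness is sequential closedness for the \<open>H\<^sup>1\<close> norm.  Applied to constant sequences it
  forces \<open>P\<close> to contain every representative of each of its elements.\<close>

definition closed_subspace_H1_per0 :: "(real ^ 'n \<Rightarrow> real ^ 'n) set \<Rightarrow> bool" where
  "closed_subspace_H1_per0 P \<longleftrightarrow>
     P \<subseteq> H1_per0 \<and> (\<lambda>x. 0) \<in> P \<and>
     (\<forall>v\<in>P. \<forall>w\<in>P. (\<lambda>x. v x + w x) \<in> P) \<and>
     (\<forall>c. \<forall>v\<in>P. (\<lambda>x. c *\<^sub>R v x) \<in> P) \<and>
     (\<forall>vs v. (\<forall>k::nat. vs k \<in> P) \<and> v \<in> H1_per0 \<and>
        (\<lambda>k. H1_norm (\<lambda>x. vs k x - v x)) \<longlonglongrightarrow> 0 \<longrightarrow> v \<in> P)"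


subsection \<open>Coefficients, bilinear form and the very weak problem\<close>

definition setting_B ::
  "real \<Rightarrow> real \<Rightarrow> real \<Rightarrow> (real ^ 'n \<Rightarrow> real ^ 'n ^ 'n) \<Rightarrow> (real ^ 'n \<Rightarrow> real ^ 'n) \<Rightarrow> bool" where
  "setting_B lam Lam \<delta> A b \<longleftrightarrow>
     0 < lam \<and> 0 < Lam \<and>
     A \<in> Linf_per \<and> (AE x in lebesgue. transpose (A x) = A x) \<and> b \<in> Linf_per \<and>
     (AE x in lebesgue. \<forall>\<xi>. lam * (\<xi> \<bullet> \<xi>) \<le> \<xi> \<bullet> (A x *v \<xi>) \<and> \<xi> \<bullet> (A x *v \<xi>) \<le> Lam * (\<xi> \<bullet> \<xi>)) \<and>
     real CARD('n) / (real CARD('n) + pi\<^sup>2) < \<delta> \<and> \<delta> \<le> 1 \<and>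
     (AE x in lebesgue.
        ((norm (A x))\<^sup>2 + (norm (b x))\<^sup>2) / (trace (A x))\<^sup>2 \<le> 1 / (real CARD('n) - 1 + \<delta>))"

definition renorm ::
  "(real ^ 'n \<Rightarrow> real ^ 'n ^ 'n) \<Rightarrow> (real ^ 'n \<Rightarrow> real ^ 'n) \<Rightarrow> real ^ 'n \<Rightarrow> real" where
  "renorm A b x = trace (A x) / ((norm (A x))\<^sup>2 + (norm (b x))\<^sup>2)"

definition A_tilde ::
  "(real ^ 'n \<Rightarrow> real ^ 'n ^ 'n) \<Rightarrow> (real ^ 'n \<Rightarrow> real ^ 'n) \<Rightarrow> real ^ 'n \<Rightarrow> real ^ 'n ^ 'n" where
  "A_tilde A b x = renorm A b x *\<^sub>R A x"

definition b_tilde ::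
  "(real ^ 'n \<Rightarrow> real ^ 'n ^ 'n) \<Rightarrow> (real ^ 'n \<Rightarrow> real ^ 'n) \<Rightarrow> real ^ 'n \<Rightarrow> real ^ 'n" where
  "b_tilde A b x = renorm A b x *\<^sub>R b x"

definition B2 ::
  "(real ^ 'n \<Rightarrow> real ^ 'n ^ 'n) \<Rightarrow> (real ^ 'n \<Rightarrow> real ^ 'n) \<Rightarrow>
   (real ^ 'n \<Rightarrow> real ^ 'n) \<Rightarrow> (real ^ 'n \<Rightarrow> real ^ 'n) \<Rightarrow> real" where
  "B2 A b v w =
     (\<integral>x. weak_div v x * (A_tilde A b x \<bullet> weak_jacobian w x + b_tilde A b x \<bullet> w x)
        \<partial>lebesgue_on unit_cell) +
     1 / 2 * (\<integral>x. (weak_jacobian v x - transpose (weak_jacobian v x)) \<bullet>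
                 (weak_jacobian w x - transpose (weak_jacobian w x)) \<partial>lebesgue_on unit_cell)"

definition rhs ::
  "(real ^ 'n \<Rightarrow> real ^ 'n ^ 'n) \<Rightarrow> (real ^ 'n \<Rightarrow> real ^ 'n) \<Rightarrow> (real ^ 'n \<Rightarrow> real ^ 'n) \<Rightarrow> real" where
  "rhs A b w = (\<integral>x. A_tilde A b x \<bullet> weak_jacobian w x + b_tilde A b x \<bullet> w x \<partial>lebesgue_on unit_cell)"

text \<open>Very weak solutions of \<open>- D\<^sup>2 : (A_tilde r) + div (b_tilde r) = 0\<close>, \<open>r\<close> periodic with mean one.\<close>

definition normalized_very_weak_solution ::
  "(real ^ 'n \<Rightarrow> real ^ 'n ^ 'n) \<Rightarrow> (real ^ 'n \<Rightarrow> real ^ 'n) \<Rightarrow> (real ^ 'n \<Rightarrow> real) \<Rightarrow> bool" where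
  "normalized_very_weak_solution A b r \<longleftrightarrow>
     r \<in> L2_per \<and>
     (\<forall>\<phi>\<in>H2_per.
        (\<integral>x. r x * (A_tilde A b x \<bullet> weak_hessian \<phi> x + b_tilde A b x \<bullet> weak_grad \<phi> x)
           \<partial>lebesgue_on unit_cell) = 0) \<and>
     (\<integral>x. r x \<partial>lebesgue_on unit_cell) = 1"

end

(*
  Write At, bt for the renormalized coefficients, Dw for the Jacobian and (v, w) for the L2 inner product of Dv and Dw, a norm on
  mean-free periodic fields by the Poincare inequality. Parseval gives
  int d_i u d_j v = int d_j u d_i v for periodic weak derivatives, hence
  (v, w) = int div v div w + 1/2 int curl v : curl w, and so
  B2(v, w) = (v, w) + int (div v) E(w) with E(w) = At : Dw + bt . w - div w.
  The Cordes condition says |At - I|^2 + |bt|^2 <= 1 - delta pointwise, so with the Poincare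
  constant 1/(2 pi)^2 we get ||E(w)|| <= q ||Dw|| for some q < 1 depending only on delta. Thus B2
  is a contractive perturbation of an inner product: Lax-Milgram gives the discrete solution, and
  Cea's argument gives quasi-optimality with C = (1 + q) / (1 - q).
  The given very weak solution r equals 1 - div rho: the difference s is mean-free and
  orthogonal to At : D^2 phi + bt . grad phi = Laplace phi + E(grad phi); choosing phi with
  Laplace phi equal to the Fourier partial sums of s gives ||s||^2 <= q ||s||^2.
*)
theory Submission
  imports Defs
begin

section \<open>Square integrable functions\<close>

text \<open>Functions live on the whole space, and equality, periodicity and weak derivatives hold
  only almost everywhere. Weak derivatives are tested with compactly supported functions, whereas
  Fourier analysis takes place on the cell. The bridge is periodization: the integral of a periodic
  function times a test function is the cell integral against the sum of integer translates, and a
  partition of unity realises every smooth periodic function as such a sum. Two sharp constants make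
  the contraction work: the div-curl identity bounds div w by Dw in L2 with constant 1, where the
  pointwise trace bound has sqrt n; and the periodic Poincare inequality absorbs the lower-order
  term, so that q^2 = (1 - delta) (1 + 1/(2 pi)^2). The perturbation is not symmetric, so the
  discrete problem is solved by a fixed-point iteration over Riesz representatives, in a space of
  functions on which the form is only a semi-inner product. To compare r with 1 - div rho one needs
  potentials admissible in both problems. Trigonometric polynomials are, and since their gradients
  are curl-free, the curl part of B2 drops out.\<close>

definition sqint :: "'a measure \<Rightarrow> ('a \<Rightarrow> 'b::euclidean_space) \<Rightarrow> bool" where
  "sqint M f \<longleftrightarrow> f \<in> borel_measurable M \<and> integrable M (\<lambda>x. (norm (f x))\<^sup>2)"

definition l2ip :: "'a measure \<Rightarrow> ('a \<Rightarrow> 'b::euclidean_space) \<Rightarrow> ('a \<Rightarrow> 'b) \<Rightarrow> real" where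
  "l2ip M f g = (\<integral>x. f x \<bullet> g x \<partial>M)"

definition l2n :: "'a measure \<Rightarrow> ('a \<Rightarrow> 'b::euclidean_space) \<Rightarrow> real" where
  "l2n M f = sqrt (\<integral>x. (norm (f x))\<^sup>2 \<partial>M)"

lemma sqint_meas: "sqint M f \<Longrightarrow> f \<in> borel_measurable M"
  by (simp add: sqint_def)

lemma norm_mult_le_sum_squares: "norm a * norm b \<le> (norm a)\<^sup>2 + (norm b)\<^sup>2"
proof -
  have "2 * (norm a * norm b) \<le> (norm a)\<^sup>2 + (norm b)\<^sup>2" "0 \<le> norm a * norm b"
    using sum_squares_bound[of "norm a" "norm b"] by auto
  then show ?thesis by linarith
qed

lemma sqint_norm_mult_integrable:
  assumes "sqint M f" "sqint M g"
  shows "integrable M (\<lambda>x. norm (f x) * norm (g x))"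
proof (rule Bochner_Integration.integrable_bound)
  show "integrable M (\<lambda>x. (norm (f x))\<^sup>2 + (norm (g x))\<^sup>2)"
    using assms by (simp add: sqint_def)
  show "(\<lambda>x. norm (f x) * norm (g x)) \<in> borel_measurable M"
    using assms by (auto simp: sqint_def)
  show "AE x in M. norm (norm (f x) * norm (g x)) \<le> norm ((norm (f x))\<^sup>2 + (norm (g x))\<^sup>2)"
    using norm_mult_le_sum_squares by (auto simp: abs_mult)
qed

lemma sqint_inner_integrable:
  assumes "sqint M f" "sqint M g"
  shows "integrable M (\<lambda>x. f x \<bullet> g x)"
proof (rule Bochner_Integration.integrable_bound[OF sqint_norm_mult_integrable[OF assms]])
  show "(\<lambda>x. f x \<bullet> g x) \<in> borel_measurable M"
    using assms by (auto simp: sqint_def)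
  show "AE x in M. norm (f x \<bullet> g x) \<le> norm (norm (f x) * norm (g x))"
    using Cauchy_Schwarz_ineq2 by (auto simp: abs_mult)
qed

lemma sqint_mult_integrable:
  fixes f g :: "'a \<Rightarrow> real"
  assumes "sqint M f" "sqint M g"
  shows "integrable M (\<lambda>x. f x * g x)"
  using sqint_inner_integrable[OF assms] by simp

lemma sqint_scaleR: "sqint M f \<Longrightarrow> sqint M (\<lambda>x. c *\<^sub>R f x)"
  by (auto simp: sqint_def power_mult_distrib)

lemma sqint_cmult: fixes f :: "'a \<Rightarrow> real" shows "sqint M f \<Longrightarrow> sqint M (\<lambda>x. c * f x)"
  using sqint_scaleR[of M f c] by simp

lemma sqint_add:
  assumes "sqint M f" "sqint M g" shows "sqint M (\<lambda>x. f x + g x)"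
proof -
  have "(norm (f x + g x))\<^sup>2 = (norm (f x))\<^sup>2 + 2 * (f x \<bullet> g x) + (norm (g x))\<^sup>2" for x
    by (simp add: power2_norm_eq_inner inner_add_left inner_add_right inner_commute)
  then show ?thesis
    using assms sqint_inner_integrable[OF assms] by (auto simp: sqint_def)
qed

lemma sqint_zero: "sqint M (\<lambda>x. 0)"
  by (simp add: sqint_def)

lemma sqint_diff:
  assumes "sqint M f" "sqint M g" shows "sqint M (\<lambda>x. f x - g x)"
  using sqint_add[OF assms(1) sqint_scaleR[OF assms(2), of "-1"]] by simp

lemma sqint_uminus:
  assumes "sqint M f" shows "sqint M (\<lambda>x. - f x)"
  using sqint_scaleR[OF assms, of "-1"] by simp

lemma sqint_sum: "(\<And>i. i \<in> I \<Longrightarrow> sqint M (f i)) \<Longrightarrow> sqint M (\<lambda>x. \<Sum>i\<in>I. f i x)"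
  by (induct I rule: infinite_finite_induct) (auto intro: sqint_zero sqint_add)

lemma sqint_bounded:
  assumes "finite_measure M" "f \<in> borel_measurable M" "\<And>x. norm (f x) \<le> K"
  shows "sqint M f"
  unfolding sqint_def
proof
  interpret finite_measure M by fact
  show "integrable M (\<lambda>x. (norm (f x))\<^sup>2)"
    by (rule integrable_const_bound[where B="K\<^sup>2"]) (use assms in \<open>auto intro!: power_mono\<close>)
qed fact

lemma sqint_cong_AE:
  assumes "sqint M f" "g \<in> borel_measurable M" "AE x in M. f x = g x"
  shows "sqint M g"
proof -
  have "integrable M (\<lambda>x. (norm (g x))\<^sup>2) \<longleftrightarrow> integrable M (\<lambda>x. (norm (f x))\<^sup>2)"
    by (rule integrable_cong_AE) (use assms in \<open>auto simp: sqint_def\<close>)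
  then show ?thesis using assms by (auto simp: sqint_def)
qed

lemma sqint_bound:
  assumes "sqint M f" "g \<in> borel_measurable M" "AE x in M. norm (g x) \<le> c * norm (f x)"
  shows "sqint M g"
  unfolding sqint_def
proof
  show "integrable M (\<lambda>x. (norm (g x))\<^sup>2)"
  proof (rule Bochner_Integration.integrable_bound)
    show "integrable M (\<lambda>x. c\<^sup>2 * (norm (f x))\<^sup>2)" using assms by (simp add: sqint_def)
    show "AE x in M. norm ((norm (g x))\<^sup>2) \<le> norm (c\<^sup>2 * (norm (f x))\<^sup>2)"
      using assms(3)
    proof eventually_elim
      case (elim x)
      then have "(norm (g x))\<^sup>2 \<le> (c * norm (f x))\<^sup>2" by (intro power_mono) auto
      then show ?case by (simp add: power_mult_distrib)
    qed
  qed (use assms in auto)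
qed fact

lemma l2ip_commute: "l2ip M f g = l2ip M g f"
  by (simp add: l2ip_def inner_commute)

lemma l2ip_add_left:
  assumes "sqint M f" "sqint M g" "sqint M h"
  shows "l2ip M (\<lambda>x. f x + g x) h = l2ip M f h + l2ip M g h"
  using assms by (simp add: l2ip_def inner_add_left sqint_inner_integrable)

lemma l2ip_diff_left:
  assumes "sqint M f" "sqint M g" "sqint M h"
  shows "l2ip M (\<lambda>x. f x - g x) h = l2ip M f h - l2ip M g h"
  using assms by (simp add: l2ip_def inner_diff_left sqint_inner_integrable)

lemma l2ip_scaleR_left: "l2ip M (\<lambda>x. c *\<^sub>R f x) h = c * l2ip M f h"
  by (simp add: l2ip_def)

lemma l2ip_self: "l2ip M f f = (l2n M f)\<^sup>2"
  by (simp add: l2ip_def l2n_def power2_norm_eq_inner)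

lemma l2n_nonneg [simp]: "0 \<le> l2n M f"
  by (simp add: l2n_def)

lemma l2ip_cong_AE:
  assumes "AE x in M. f x = f' x" "AE x in M. g x = g' x"
    "sqint M f" "sqint M g" "f' \<in> borel_measurable M" "g' \<in> borel_measurable M"
  shows "l2ip M f g = l2ip M f' g'"
  unfolding l2ip_def by (rule integral_cong_AE) (use assms in \<open>auto simp: sqint_def\<close>)

lemma l2n_cong_AE:
  assumes "AE x in M. f x = f' x" "f \<in> borel_measurable M" "f' \<in> borel_measurable M"
  shows "l2n M f = l2n M f'"
proof -
  have "(\<integral>x. (norm (f x))\<^sup>2 \<partial>M) = (\<integral>x. (norm (f' x))\<^sup>2 \<partial>M)"
    by (rule integral_cong_AE) (use assms in auto)
  then show ?thesis by (simp add: l2n_def)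
qed

lemma l2n_mono:
  assumes "sqint M f" "sqint M g" "AE x in M. norm (f x) \<le> norm (g x)"
  shows "l2n M f \<le> l2n M g"
  unfolding l2n_def
  by (intro real_sqrt_le_mono integral_mono_AE) (use assms in \<open>auto simp: sqint_def intro!: power_mono\<close>)

lemma l2n_scaleR: "l2n M (\<lambda>x. c *\<^sub>R f x) = \<bar>c\<bar> * l2n M f"
  by (simp add: l2n_def power_mult_distrib real_sqrt_mult)

lemma l2n_uminus: "l2n M (\<lambda>x. - f x) = l2n M f"
  by (simp add: l2n_def)

lemma l2n_minus_commute: "l2n M (\<lambda>x. f x - g x) = l2n M (\<lambda>x. g x - f x)"
  by (simp add: l2n_def norm_minus_commute)

section \<open>Cauchy-Schwarz, triangle inequality and continuity of the inner product\<close>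

lemma l2n_add_square:
  assumes "sqint M f" "sqint M g"
  shows "(l2n M (\<lambda>x. f x + g x))\<^sup>2 = (l2n M f)\<^sup>2 + 2 * l2ip M f g + (l2n M g)\<^sup>2"
proof -
  have "l2ip M (\<lambda>x. f x + g x) (\<lambda>x. f x + g x) = l2ip M f (\<lambda>x. f x + g x) + l2ip M g (\<lambda>x. f x + g x)"
    using assms by (intro l2ip_add_left sqint_add)
  also have "\<dots> = l2ip M (\<lambda>x. f x + g x) f + l2ip M (\<lambda>x. f x + g x) g"
    by (simp add: l2ip_commute)
  also have "\<dots> = l2ip M f f + l2ip M g f + (l2ip M f g + l2ip M g g)"
    using assms by (simp add: l2ip_add_left)
  finally show ?thesis by (simp add: l2ip_self l2ip_commute[of M g f])
qed

text \<open>A quadratic polynomial in \<open>t\<close> without sign change has nonpositive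
  discriminant. It is stated for bare reals because it serves the \<open>L2\<close> product, the
  abstract semi-inner product and, with \<open>a = 0\<close>, the derivation of an Euler equation
  from minimality.\<close>

lemma discriminant_CS:
  fixes a b c :: real
  assumes "\<And>t. 0 \<le> a + 2 * t * b + t\<^sup>2 * c" "0 \<le> a" "0 \<le> c"
  shows "\<bar>b\<bar> \<le> sqrt a * sqrt c"
proof -
  have "b\<^sup>2 \<le> a * c"
  proof (cases "c = 0")
    case True
    have "b = 0"
    proof (rule ccontr)
      assume "b \<noteq> 0"
      \<comment> \<open>At this \<open>t\<close> the polynomial, which is affine since
        \<open>c = 0\<close>, takes the value -1.\<close>
      with assms(1)[of "- (a + 1) / (2 * b)"] True show False by (simp add: field_simps)
    qed
    then show ?thesis using True by simp
  next
    case False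
    then have c: "c > 0" using assms by simp
    have "0 \<le> (a + 2 * (- b / c) * b + (- b / c)\<^sup>2 * c) * c"
      using assms(1)[of "- b / c"] c by (intro mult_nonneg_nonneg) auto
    also have "\<dots> = a * c - b\<^sup>2" using c by (simp add: field_simps power2_eq_square)
    finally show ?thesis by simp
  qed
  then have "sqrt (b\<^sup>2) \<le> sqrt (a * c)" by (rule real_sqrt_le_mono)
  then show ?thesis by (simp add: real_sqrt_mult)
qed

lemma l2_Cauchy_Schwarz:
  assumes "sqint M f" "sqint M g"
  shows "\<bar>l2ip M f g\<bar> \<le> l2n M f * l2n M g"
proof -
  have "0 \<le> (l2n M f)\<^sup>2 + 2 * t * l2ip M f g + t\<^sup>2 * (l2n M g)\<^sup>2" for t
  proof -
    have "(l2n M (\<lambda>x. f x + t *\<^sub>R g x))\<^sup>2 = (l2n M f)\<^sup>2 + 2 * l2ip M f (\<lambda>x. t *\<^sub>R g x) + (l2n M (\<lambda>x. t *\<^sub>R g x))\<^sup>2"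
      using assms by (intro l2n_add_square sqint_scaleR)
    also have "\<dots> = (l2n M f)\<^sup>2 + 2 * t * l2ip M f g + t\<^sup>2 * (l2n M g)\<^sup>2"
      by (simp add: l2n_scaleR l2ip_commute[of M f] l2ip_scaleR_left power_mult_distrib)
    finally show ?thesis by (metis zero_le_power2)
  qed
  from discriminant_CS[OF this] show ?thesis by simp
qed

lemma l2n_triangle:
  assumes "sqint M f" "sqint M g"
  shows "l2n M (\<lambda>x. f x + g x) \<le> l2n M f + l2n M g"
proof (rule power2_le_imp_le)
  show "(l2n M (\<lambda>x. f x + g x))\<^sup>2 \<le> (l2n M f + l2n M g)\<^sup>2"
    using l2_Cauchy_Schwarz[OF assms] by (simp add: l2n_add_square[OF assms] power2_sum)
qed simp

lemma l2n_eq_0_AE: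
  assumes "sqint M f" "l2n M f = 0"
  shows "AE x in M. f x = 0"
proof -
  have "(\<integral>x. (norm (f x))\<^sup>2 \<partial>M) = 0" using assms(2) by (simp add: l2n_def)
  then have "AE x in M. (norm (f x))\<^sup>2 = 0"
    using assms(1) by (subst (asm) integral_nonneg_eq_0_iff_AE) (auto simp: sqint_def)
  then show ?thesis by simp
qed

text \<open>The difference splits into the pairing of \<open>f n - f'\<close> with
  \<open>g n\<close> and that of \<open>f'\<close> with \<open>g n - g'\<close>; the norm of
  \<open>g n\<close> is controlled through its distance to \<open>g'\<close>.\<close>

lemma l2ip_tendsto:
  assumes "\<And>n. sqint M (f n)" "sqint M f'" "\<And>n. sqint M (g n)" "sqint M g'"
    "(\<lambda>n. l2n M (\<lambda>x. f n x - f' x)) \<longlonglongrightarrow> 0" "(\<lambda>n. l2n M (\<lambda>x. g n x - g' x)) \<longlonglongrightarrow> 0"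
  shows "(\<lambda>n. l2ip M (f n) (g n)) \<longlonglongrightarrow> l2ip M f' g'"
proof -
  have "(\<lambda>n. l2ip M (f n) (g n) - l2ip M f' g') \<longlonglongrightarrow> 0"
  proof (rule Lim_null_comparison[OF always_eventually])
    let ?u = "\<lambda>n. l2n M (\<lambda>x. f n x - f' x)" and ?v = "\<lambda>n. l2n M (\<lambda>x. g n x - g' x)"
    have "(\<lambda>n. ?u n * (?v n + l2n M g') + l2n M f' * ?v n) \<longlonglongrightarrow> 0 * (0 + l2n M g') + l2n M f' * 0"
      by (intro tendsto_intros assms)
    then show "(\<lambda>n. ?u n * (?v n + l2n M g') + l2n M f' * ?v n) \<longlonglongrightarrow> 0" by simp
    show "\<forall>n. norm (l2ip M (f n) (g n) - l2ip M f' g') \<le> ?u n * (?v n + l2n M g') + l2n M f' * ?v n"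
    proof
      fix n
      have "l2ip M (f n) (g n) - l2ip M f' g' = l2ip M (\<lambda>x. f n x - f' x) (g n) + l2ip M f' (\<lambda>x. g n x - g' x)"
        using assms(1-4) by (simp add: l2ip_diff_left l2ip_commute[of M f'] )
      moreover have "\<bar>l2ip M (\<lambda>x. f n x - f' x) (g n)\<bar> \<le> ?u n * l2n M (g n)"
        by (intro l2_Cauchy_Schwarz sqint_diff assms)
      moreover have "\<bar>l2ip M f' (\<lambda>x. g n x - g' x)\<bar> \<le> l2n M f' * ?v n"
        by (intro l2_Cauchy_Schwarz sqint_diff assms)
      moreover have "l2n M (g n) \<le> ?v n + l2n M g'"
        using l2n_triangle[OF sqint_diff[OF assms(3,4)] assms(4)] by simp
      then have "?u n * l2n M (g n) \<le> ?u n * (?v n + l2n M g')"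
        by (intro mult_left_mono) auto
      ultimately show "norm (l2ip M (f n) (g n) - l2ip M f' g') \<le> ?u n * (?v n + l2n M g') + l2n M f' * ?v n"
        unfolding real_norm_def by linarith
    qed
  qed
  then show ?thesis by (simp add: LIM_zero_iff)
qed

section \<open>The Riesz-Fischer theorem on a finite measure space\<close>

lemma integral_norm_le_l2n:
  assumes "finite_measure M" "sqint M f"
  shows "integrable M (\<lambda>x. norm (f x))" "(\<integral>x. norm (f x) \<partial>M) \<le> sqrt (measure M (space M)) * l2n M f"
proof -
  interpret finite_measure M by fact
  have 1: "sqint M (\<lambda>x. 1::real)" by (simp add: sqint_def)
  have 2: "sqint M (\<lambda>x. norm (f x))" using assms by (auto simp: sqint_def)
  show "integrable M (\<lambda>x. norm (f x))" using sqint_mult_integrable[OF 1 2] by simp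
  have "\<bar>l2ip M (\<lambda>x. 1::real) (\<lambda>x. norm (f x))\<bar> \<le> l2n M (\<lambda>x. 1::real) * l2n M (\<lambda>x. norm (f x))"
    by (rule l2_Cauchy_Schwarz[OF 1 2])
  then show "(\<integral>x. norm (f x) \<partial>M) \<le> sqrt (measure M (space M)) * l2n M f"
    by (simp add: l2ip_def l2n_def)
qed

text \<open>A rapidly Cauchy subsequence converges almost everywhere, and Fatou's lemma upgrades
  this to norm convergence. The limit is exposed as the pointwise \<open>lim\<close> of a
  subsequence so that measurability and periodicity on the whole space, which the measure
  \<open>M\<close> does not see, can later be transferred to it.\<close>

lemma L2_complete:
  fixes f :: "nat \<Rightarrow> 'a \<Rightarrow> 'b::euclidean_space"
  assumes fin: "finite_measure M" and f: "\<And>n. sqint M (f n)"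
    and cau: "\<And>e. e > 0 \<Longrightarrow> \<exists>N. \<forall>m\<ge>N. \<forall>n\<ge>N. l2n M (\<lambda>x. f m x - f n x) < e"
  obtains r :: "nat \<Rightarrow> nat" where "sqint M (\<lambda>x. lim (\<lambda>k. f (r k) x))"
    "(\<lambda>n. l2n M (\<lambda>x. f n x - lim (\<lambda>k. f (r k) x))) \<longlonglongrightarrow> 0"
proof -
  interpret finite_measure M by fact
  have meas[measurable]: "f n \<in> borel_measurable M" for n using f by (simp add: sqint_def)
  obtain N where N: "\<And>k m n. m \<ge> N k \<Longrightarrow> n \<ge> N k \<Longrightarrow> l2n M (\<lambda>x. f m x - f n x) < (1/2)^k"
    using cau[of "(1/2)^k" for k] by (metis zero_less_divide_1_iff zero_less_numeral zero_less_power)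
  \<comment> \<open>This sum gives \<open>r k \<ge> N k\<close>, \<open>r k \<ge> k\<close> and
    monotonicity at once.\<close>
  define r where "r k = k + (\<Sum>j\<le>k. N j)" for k
  have rN: "r k \<ge> N k" for k unfolding r_def by (simp add: trans_le_add2 member_le_sum)
  have rmono: "r k \<le> r (Suc k)" for k by (simp add: r_def)
  have rid: "r k \<ge> k" for k by (simp add: r_def)
  define d where "d k x = norm (f (r (Suc k)) x - f (r k) x)" for k x
  have dint: "integrable M (d k)" "(\<integral>x. d k x \<partial>M) \<le> sqrt (measure M (space M)) * (1/2)^k" for k
  proof -
    have s: "sqint M (\<lambda>x. f (r (Suc k)) x - f (r k) x)" by (intro sqint_diff f)
    show "integrable M (d k)" unfolding d_def using integral_norm_le_l2n(1)[OF fin s] .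
    have "(\<integral>x. d k x \<partial>M) \<le> sqrt (measure M (space M)) * l2n M (\<lambda>x. f (r (Suc k)) x - f (r k) x)"
      unfolding d_def using integral_norm_le_l2n(2)[OF fin s] .
    also have "\<dots> \<le> sqrt (measure M (space M)) * (1/2)^k"
      using N[of k "r (Suc k)" "r k"] rN[of k] rmono[of k] by (intro mult_left_mono) auto
    finally show "(\<integral>x. d k x \<partial>M) \<le> sqrt (measure M (space M)) * (1/2)^k" .
  qed
  \<comment> \<open>The norms of the increments have summable integrals, so their sum is finite
    almost everywhere and the telescoping series converges absolutely there.\<close>
  have "(\<integral>\<^sup>+x. (\<Sum>k. ennreal (d k x)) \<partial>M) = (\<Sum>k. \<integral>\<^sup>+x. ennreal (d k x) \<partial>M)"
    by (rule nn_integral_suminf) (simp add: d_def)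
  also have "\<dots> \<le> (\<Sum>k. ennreal (sqrt (measure M (space M)) * (1/2)^k))"
  proof (rule suminf_le)
    fix k
    have "(\<integral>\<^sup>+x. ennreal (d k x) \<partial>M) = ennreal (\<integral>x. d k x \<partial>M)"
      by (rule nn_integral_eq_integral[OF dint(1)]) (simp add: d_def)
    then show "(\<integral>\<^sup>+x. ennreal (d k x) \<partial>M) \<le> ennreal (sqrt (measure M (space M)) * (1/2)^k)"
      using dint(2)[of k] by (simp add: ennreal_leI)
  qed auto
  also have "\<dots> = ennreal (\<Sum>k. sqrt (measure M (space M)) * (1/2)^k)"
    by (rule suminf_ennreal2) (auto intro!: summable_mult summable_geometric)
  also have "\<dots> < \<infinity>" by simp
  finally have "AE x in M. (\<Sum>k. ennreal (d k x)) \<noteq> \<infinity>"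
    by (intro nn_integral_PInf_AE) (auto simp: d_def)
  then have ae: "AE x in M. convergent (\<lambda>k. f (r k) x)"
  proof eventually_elim
    case (elim x)
    then have "summable (\<lambda>k. d k x)"
      by (intro summable_suminf_not_top) (auto simp: d_def)
    then have "summable (\<lambda>k. f (r (Suc k)) x - f (r k) x)"
      unfolding d_def by (rule summable_norm_cancel)
    then have "convergent (\<lambda>n. \<Sum>k<n. f (r (Suc k)) x - f (r k) x)"
      by (simp add: summable_iff_convergent)
    then have "convergent (\<lambda>n. f (r n) x - f (r 0) x)"
      by (simp add: sum_lessThan_telescope[of "\<lambda>k. f (r k) x"])
    then have "convergent (\<lambda>n. (f (r n) x - f (r 0) x) + f (r 0) x)"
      by (intro convergent_add convergent_const)
    then show ?case by simp
  qed
  define g where "g x = lim (\<lambda>k. f (r k) x)" for x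
  have [measurable]: "g \<in> borel_measurable M"
    unfolding g_def[abs_def] by (rule borel_measurable_lim_metric) simp
  have aeg: "AE x in M. (\<lambda>k. f (r k) x) \<longlonglongrightarrow> g x"
    using ae by eventually_elim (simp add: g_def convergent_LIMSEQ_iff)
  \<comment> \<open>Fatou's lemma along the subsequence: the Cauchy bound for
    \<open>f m - f (r j)\<close> survives as \<open>j\<close> tends to infinity.\<close>
  have key: "(\<integral>\<^sup>+x. ennreal ((norm (f m x - g x))\<^sup>2) \<partial>M) \<le> ennreal (((1/2)^k)\<^sup>2)" if "m \<ge> N k" for m k
  proof -
    have "(\<integral>\<^sup>+x. ennreal ((norm (f m x - g x))\<^sup>2) \<partial>M) = (\<integral>\<^sup>+x. liminf (\<lambda>j. ennreal ((norm (f m x - f (r j) x))\<^sup>2)) \<partial>M)"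
    proof (rule nn_integral_cong_AE)
      show "AE x in M. ennreal ((norm (f m x - g x))\<^sup>2) = liminf (\<lambda>j. ennreal ((norm (f m x - f (r j) x))\<^sup>2))"
        using aeg
      proof eventually_elim
        case (elim x)
        have "(\<lambda>j. ennreal ((norm (f m x - f (r j) x))\<^sup>2)) \<longlonglongrightarrow> ennreal ((norm (f m x - g x))\<^sup>2)"
          by (intro tendsto_intros elim)
        then show ?case by (rule lim_imp_Liminf[OF sequentially_bot, symmetric])
      qed
    qed
    also have "\<dots> \<le> liminf (\<lambda>j. \<integral>\<^sup>+x. ennreal ((norm (f m x - f (r j) x))\<^sup>2) \<partial>M)"
      by (rule nn_integral_liminf) simp
    also have "\<dots> \<le> limsup (\<lambda>j. \<integral>\<^sup>+x. ennreal ((norm (f m x - f (r j) x))\<^sup>2) \<partial>M)"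
      by (rule Liminf_le_Limsup) simp
    also have "\<dots> \<le> ennreal (((1/2)^k)\<^sup>2)"
    proof (rule Limsup_bounded, rule eventually_sequentiallyI)
      fix j assume "N k \<le> j"
      then have "r j \<ge> N k" using rid[of j] by simp
      then have l: "l2n M (\<lambda>x. f m x - f (r j) x) < (1/2)^k" using N that by blast
      have "(\<integral>\<^sup>+x. ennreal ((norm (f m x - f (r j) x))\<^sup>2) \<partial>M) = ennreal (\<integral>x. (norm (f m x - f (r j) x))\<^sup>2 \<partial>M)"
        using sqint_diff[OF f[of m] f[of "r j"]] by (intro nn_integral_eq_integral) (auto simp: sqint_def)
      also have "\<dots> = ennreal ((l2n M (\<lambda>x. f m x - f (r j) x))\<^sup>2)" by (simp add: l2n_def)
      also have "\<dots> \<le> ennreal (((1/2)^k)\<^sup>2)"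
        using l by (intro ennreal_leI power_mono) auto
      finally show "(\<integral>\<^sup>+x. ennreal ((norm (f m x - f (r j) x))\<^sup>2) \<partial>M) \<le> ennreal (((1/2)^k)\<^sup>2)"
        by (simp add: ennreal_power)
    qed
    finally show ?thesis .
  qed
  have sd: "sqint M (\<lambda>x. f m x - g x)" and ld: "l2n M (\<lambda>x. f m x - g x) \<le> (1/2)^k" if "m \<ge> N k" for m k
  proof -
    have i: "integrable M (\<lambda>x. (norm (f m x - g x))\<^sup>2)"
      by (rule integrableI_bounded) (use key[OF that] in \<open>auto simp: ennreal_power intro: le_less_trans\<close>)
    then show "sqint M (\<lambda>x. f m x - g x)" by (simp add: sqint_def)
    have "ennreal (\<integral>x. (norm (f m x - g x))\<^sup>2 \<partial>M) \<le> ennreal (((1/2)^k)\<^sup>2)"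
      using key[OF that] nn_integral_eq_integral[OF i] by (simp add: ennreal_power)
    then have "(\<integral>x. (norm (f m x - g x))\<^sup>2 \<partial>M) \<le> ((1/2)^k)\<^sup>2" by (subst (asm) ennreal_le_iff) auto
    then have "sqrt (\<integral>x. (norm (f m x - g x))\<^sup>2 \<partial>M) \<le> sqrt (((1/2)^k)\<^sup>2)" by (rule real_sqrt_le_mono)
    then show "l2n M (\<lambda>x. f m x - g x) \<le> (1/2)^k" by (simp add: l2n_def)
  qed
  have "sqint M g"
    using sqint_diff[OF f[of "N 0"] sd[of 0 "N 0"]] by simp
  moreover have "(\<lambda>n. l2n M (\<lambda>x. f n x - g x)) \<longlonglongrightarrow> 0"
  proof (rule LIMSEQ_I)
    fix e :: real assume "e > 0"
    then obtain k where k: "(1/2)^k < e" using real_arch_pow_inv[of e "1/2"] by auto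
    show "\<exists>no. \<forall>n\<ge>no. norm (l2n M (\<lambda>x. f n x - g x) - 0) < e"
    proof (intro exI allI impI)
      fix n assume "n \<ge> N k"
      from ld[OF this] k show "norm (l2n M (\<lambda>x. f n x - g x) - 0) < e" by simp
    qed
  qed
  ultimately show ?thesis unfolding g_def[abs_def] by (rule that)
qed

section \<open>Translations and boxes\<close>

lemma lebesgue_translate:
  fixes a :: "'a::euclidean_space"
  shows translate_measurable: "(\<lambda>x. x + a) \<in> lebesgue \<rightarrow>\<^sub>M lebesgue"
    and translate_distr: "distr lebesgue lebesgue (\<lambda>x. x + a) = lebesgue"
proof -
  have eq: "(\<lambda>x. a + (\<Sum>j\<in>Basis. ((1::real) * (x \<bullet> j)) *\<^sub>R j)) = (\<lambda>x. x + a)"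
    by (simp add: euclidean_representation add.commute)
  show m: "(\<lambda>x. x + a) \<in> lebesgue \<rightarrow>\<^sub>M lebesgue"
    using lebesgue_affine_measurable[of "\<lambda>_. 1" a] unfolding eq by simp
  have "lebesgue = density (distr lebesgue lebesgue (\<lambda>x. x + a)) (\<lambda>_. 1)"
    using lebesgue_affine_euclidean[of "\<lambda>_. 1" a] unfolding eq by simp
  then show "distr lebesgue lebesgue (\<lambda>x. x + a) = lebesgue"
    by (simp add: density_1)
qed

lemma borel_measurable_translate:
  assumes "f \<in> borel_measurable lebesgue"
  shows "(\<lambda>x. f (x + a)) \<in> borel_measurable lebesgue"
  using measurable_compose[OF translate_measurable assms] .

lemma integral_translate:
  fixes f :: "'a::euclidean_space \<Rightarrow> 'b::euclidean_space"
  assumes "f \<in> borel_measurable lebesgue"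
  shows "(\<integral>x. f (x + a) \<partial>lebesgue) = (\<integral>x. f x \<partial>lebesgue)"
  using integral_distr[OF translate_measurable assms, of a] by (simp add: translate_distr)

lemma integrable_translate:
  fixes f :: "'a::euclidean_space \<Rightarrow> 'b::euclidean_space"
  assumes "f \<in> borel_measurable lebesgue"
  shows "integrable lebesgue (\<lambda>x. f (x + a)) \<longleftrightarrow> integrable lebesgue f"
  using integrable_distr_eq[OF translate_measurable assms, of a] by (simp add: translate_distr)

lemma AE_translate:
  fixes a :: "'a::euclidean_space"
  assumes "AE x in lebesgue. P x"
  shows "AE x in lebesgue. P (x + a)"
  using AE_distrD[OF translate_measurable[of a], unfolded translate_distr, of P] assms by blast

text \<open>The positive and negative parts of \<open>h\<close> are densities of two measures that
  agree on boxes. Boxes are stable under intersection and generate the Borel sets, so the measures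
  coincide, and with them their densities almost everywhere.\<close>

lemma AE_zero_of_boxes:
  fixes h :: "real ^ 'n \<Rightarrow> real"
  assumes h: "integrable lebesgue h" and zero: "\<And>x. x \<notin> box p q \<Longrightarrow> h x = 0"
    and box: "\<And>l u. box l u \<subseteq> box p q \<Longrightarrow> (\<integral>x. indicator (box l u) x * h x \<partial>lebesgue) = 0"
  shows "AE x in lebesgue. h x = 0"
proof -
  have hm: "h \<in> borel_measurable lebesgue" using h by simp
  \<comment> \<open>The generator argument lives on Borel sets, so \<open>h\<close> is replaced by a
    Borel function equal to it almost everywhere.\<close>
  then obtain g where g[measurable]: "g \<in> borel_measurable lborel" and gh: "AE x in lborel. h x = g x"
    using completion_ex_borel_measurable_real by blast
  have ghl: "AE x in lebesgue. h x = g x" using gh by (rule AE_completion)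
  have gl[measurable]: "g \<in> borel_measurable lebesgue" using g by (simp add: measurable_completion)
  have gi: "integrable lebesgue g"
    using h integrable_cong_AE[OF hm gl ghl] by simp
  then have gi: "integrable lborel g" using g by (simp add: integrable_completion)
  have gbox: "(\<integral>x. indicator (box l u) x * g x \<partial>lborel) = 0" for l u :: "real^'n"
  proof -
    \<comment> \<open>As \<open>h\<close> vanishes off \<open>box p q\<close>, an arbitrary box can
      be cut down to a subbox, to which the assumption on boxes applies.\<close>
    obtain l' u' where lu: "box l u \<inter> box p q = box l' u'" using box_Int_box[of l u p q] by (rule that)
    have "(\<integral>x. indicator (box l u) x * g x \<partial>lborel) = (\<integral>x. indicator (box l u) x * g x \<partial>lebesgue)"
      by (rule integral_completion[symmetric]) simp
    also have "\<dots> = (\<integral>x. indicator (box l u) x * h x \<partial>lebesgue)"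
    proof (rule integral_cong_AE)
      have "indicator (box l u) \<in> borel_measurable (lebesgue :: (real^'n) measure)"
        by (intro borel_measurable_indicator fmeasurableD lmeasurable_box)
      then show "(\<lambda>x. indicator (box l u) x * g x) \<in> borel_measurable lebesgue"
        "(\<lambda>x. indicator (box l u) x * h x) \<in> borel_measurable lebesgue"
        using gl hm by (auto intro!: borel_measurable_times)
    qed (use ghl in auto)
    also have "\<dots> = (\<integral>x. indicator (box l' u') x * h x \<partial>lebesgue)"
      using zero lu by (intro Bochner_Integration.integral_cong) (auto simp: indicator_def)
    also have "\<dots> = 0" using lu by (intro box) auto
    finally show ?thesis .
  qed
  have "density lborel (\<lambda>x. ennreal (max 0 (g x))) = density lborel (\<lambda>x. ennreal (max 0 (- g x)))"
  proof (rule measure_eqI_generator_eq)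
    let ?E = "range (\<lambda>(a, b). box a b::(real^'n) set)"
    let ?A = "\<lambda>n::nat. box (- (real n *\<^sub>R One)) (real n *\<^sub>R One) :: (real^'n) set"
    have em: "emeasure (density lborel (\<lambda>x. ennreal (max 0 (f x)))) (box l u) = ennreal (\<integral>x. indicator (box l u) x * max 0 (f x) \<partial>lborel)"
      if f: "integrable lborel f" for f :: "real^'n \<Rightarrow> real" and l u
    proof -
      have "emeasure (density lborel (\<lambda>x. ennreal (max 0 (f x)))) (box l u) = (\<integral>\<^sup>+x. ennreal (max 0 (f x)) * indicator (box l u) x \<partial>lborel)"
        using f by (intro emeasure_density) auto
      also have "\<dots> = (\<integral>\<^sup>+x. ennreal (indicator (box l u) x * max 0 (f x)) \<partial>lborel)"
        by (intro nn_integral_cong) (auto simp: indicator_def)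
      also have "\<dots> = ennreal (\<integral>x. indicator (box l u) x * max 0 (f x) \<partial>lborel)"
        using f by (intro nn_integral_eq_integral) (auto intro!: integrable_real_mult_indicator simp: mult.commute)
      finally show ?thesis .
    qed
    show "Int_stable ?E" by (auto simp: Int_stable_def box_Int_box)
    show "?E \<subseteq> Pow UNIV" by simp
    show "range ?A \<subseteq> ?E" "(\<Union>i. ?A i) = UNIV" unfolding UN_box_eq_UNIV by auto
    show "sets (density lborel (\<lambda>x. ennreal (max 0 (g x)))) = sigma_sets UNIV ?E"
      "sets (density lborel (\<lambda>x. ennreal (max 0 (- g x)))) = sigma_sets UNIV ?E"
      by (simp_all add: borel_eq_box)
    show "emeasure (density lborel (\<lambda>x. ennreal (max 0 (g x)))) (?A i) \<noteq> \<infinity>" for i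
      by (simp add: em[OF gi])
    fix X assume "X \<in> ?E"
    then obtain l u where X: "X = box l u" by auto
    have i: "integrable lborel (\<lambda>x. indicator (box l u) x * max 0 (g x))" "integrable lborel (\<lambda>x. indicator (box l u) x * max 0 (- g x))"
      using integrable_mult_indicator[of "box l u" lborel "\<lambda>x. max 0 (g x)"]
        integrable_mult_indicator[of "box l u" lborel "\<lambda>x. max 0 (- g x)"] gi
      by (simp_all add: integrable_max)
    have "(\<integral>x. indicator (box l u) x * max 0 (g x) \<partial>lborel) - (\<integral>x. indicator (box l u) x * max 0 (- g x) \<partial>lborel)
        = (\<integral>x. indicator (box l u) x * max 0 (g x) - indicator (box l u) x * max 0 (- g x) \<partial>lborel)"
      using i by simp
    also have "\<dots> = (\<integral>x. indicator (box l u) x * g x \<partial>lborel)"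
      by (intro Bochner_Integration.integral_cong) (auto simp: indicator_def max_def)
    finally have "(\<integral>x. indicator (box l u) x * max 0 (g x) \<partial>lborel) = (\<integral>x. indicator (box l u) x * max 0 (- g x) \<partial>lborel)"
      using gbox by simp
    then show "emeasure (density lborel (\<lambda>x. ennreal (max 0 (g x)))) X = emeasure (density lborel (\<lambda>x. ennreal (max 0 (- g x)))) X"
      unfolding X using em[OF gi] em[of "\<lambda>x. - g x"] gi by simp
  qed
  then have "AE x in lborel. ennreal (max 0 (g x)) = ennreal (max 0 (- g x))"
    using gi by (subst (asm) sigma_finite_measure.density_unique_iff[OF sigma_finite_lborel]) auto
  then have "AE x in lborel. g x = 0"
  proof eventually_elim
    case (elim x)
    then have "max 0 (g x) = max 0 (- g x)" by (subst (asm) ennreal_inj) auto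
    then show ?case by (auto simp: max_def split: if_splits)
  qed
  then have "AE x in lebesgue. g x = 0" by (rule AE_completion)
  with ghl show ?thesis by eventually_elim simp
qed

section \<open>The unit cell and periodic functions\<close>

text \<open>Half-open, so that its integer translates tile the space without overlap; it differs
  from \<open>unit_cell\<close> by a null set.\<close>

definition cell_half :: "(real ^ 'n) set" where
  "cell_half = {x. \<forall>i. 0 \<le> x $ i \<and> x $ i < 1}"

definition shift :: "('n::finite \<Rightarrow> int) \<Rightarrow> real ^ 'n" where
  "shift k = (\<chi> i. of_int (k i))"

definition cube :: "nat \<Rightarrow> (real ^ 'n) set" where
  "cube N = {x. \<forall>i. - real N \<le> x $ i \<and> x $ i < real N}"

text \<open>The integer vectors whose translates of \<open>cell_half\<close> make up exactly
  \<open>cube N\<close>.\<close>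

definition cube_shifts :: "nat \<Rightarrow> ('n::finite \<Rightarrow> int) set" where
  "cube_shifts N = PiE UNIV (\<lambda>_. {- int N..<int N})"

abbreviation cellM :: "(real ^ 'n) measure" where
  "cellM \<equiv> lebesgue_on unit_cell"

lemma unit_cell_box: "unit_cell = (box 0 (\<chi> i. 1) :: (real ^ 'n) set)"
  by (auto simp: unit_cell_def mem_box_cart)

lemma unit_cell_sets [measurable, simp]: "(unit_cell :: (real ^ 'n) set) \<in> sets lebesgue"
  by (simp add: unit_cell_box)

lemma cell_half_cbox: "(cell_half :: (real ^ 'n) set) = cbox 0 (\<chi> i. 1) - (\<Union>i. {x. x $ i = 1})"
  by (auto simp: cell_half_def mem_box_cart less_le)

lemma hyperplane_null: "{x :: real ^ 'n. x $ i = c} \<in> null_sets lebesgue"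
proof -
  have "{x :: real ^ 'n. x \<bullet> axis i 1 = c} \<in> null_sets lebesgue"
    using negligible_standard_hyperplane[of "axis i 1 :: real ^ 'n" c]
    by (simp add: negligible_iff_null_sets axis_in_Basis_iff)
  then show ?thesis by (simp add: inner_axis)
qed

lemma cell_half_sets [measurable, simp]: "(cell_half :: (real ^ 'n) set) \<in> sets lebesgue"
  unfolding cell_half_cbox
  by (intro sets.Diff sets.finite_UN) (auto intro: null_setsD2 hyperplane_null)

lemma AE_cell_half: "AE x in lebesgue. x \<in> (cell_half :: (real ^ 'n) set) \<longleftrightarrow> x \<in> unit_cell"
proof -
  have "AE x in lebesgue. \<forall>i\<in>UNIV. (x :: real ^ 'n) $ i \<noteq> 0"
    using AE_not_in[OF hyperplane_null[of _ 0]] by (intro AE_finite_allI) auto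
  then show ?thesis
    by eventually_elim (auto simp: cell_half_def unit_cell_def less_le)
qed

lemma finite_cellM: "finite_measure (cellM :: (real ^ 'n) measure)"
  unfolding unit_cell_box by (intro finite_measure_lebesgue_on) simp

lemma measure_cellM [simp]: "measure (cellM :: (real ^ 'n) measure) unit_cell = 1"
proof -
  have "measure (cellM :: (real ^ 'n) measure) unit_cell = measure lebesgue (unit_cell :: (real ^ 'n) set)"
    by (subst measure_restrict_space) auto
  also have "\<dots> = 1"
    unfolding unit_cell_box by (subst measure_completion) (auto simp: measure_lborel_box_eq Basis_vec_def inner_axis axis_eq_axis prod.neutral)
  finally show ?thesis .
qed

lemma cellM_measurable:
  "f \<in> borel_measurable lebesgue \<Longrightarrow> f \<in> borel_measurable (cellM :: (real ^ 'n) measure)"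
  by (rule measurable_restrict_space1)

lemma cellM_AE: "(AE x in lebesgue. P x) \<Longrightarrow> AE x in (cellM :: (real ^ 'n) measure). P x"
  by (subst AE_restrict_space_iff) auto

lemma integral_cellM_eq:
  fixes f :: "real ^ 'n \<Rightarrow> real"
  shows "(\<integral>x. f x \<partial>cellM) = (\<integral>x. indicator unit_cell x * f x \<partial>lebesgue)"
  by (subst integral_restrict_space) auto

lemma integrable_cellM_eq:
  fixes f :: "real ^ 'n \<Rightarrow> real"
  shows "integrable cellM f \<longleftrightarrow> integrable lebesgue (\<lambda>x. indicator unit_cell x * f x)"
  by (subst integrable_restrict_space) auto

section \<open>Tiling by integer translates and unfolding of integrals\<close>

lemma shift_nth [simp]: "shift k $ i = of_int (k i)"
  by (simp add: shift_def)

lemma finite_cube_shifts [simp]: "finite (cube_shifts N :: ('n::finite \<Rightarrow> int) set)"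
  by (simp add: cube_shifts_def finite_PiE)

text \<open>The only \<open>k\<close> with \<open>x - shift k\<close> in the half-open cell is the
  vector of floors of the coordinates of \<open>x\<close>, and it is among the listed shifts
  precisely when \<open>x\<close> lies in the cube.\<close>

lemma sum_cell_indicators:
  fixes x :: "real ^ 'n"
  shows "(\<Sum>k\<in>cube_shifts N. indicator cell_half (x - shift k)) = (indicator (cube N) x :: real)"
proof -
  define f where "f i = \<lfloor>x $ i\<rfloor>" for i
  have fl: "(of_int m \<le> y \<and> y - of_int m < 1) \<longleftrightarrow> m = \<lfloor>y\<rfloor>" for y :: real and m
    by linarith
  have in_iff: "x - shift k \<in> cell_half \<longleftrightarrow> k = f" for k
    by (simp add: cell_half_def f_def fun_eq_iff fl)
  have "(\<Sum>k\<in>cube_shifts N. indicator cell_half (x - shift k)) = (\<Sum>k\<in>cube_shifts N. if k = f then (1::real) else 0)"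
    by (intro sum.cong refl) (simp add: indicator_def in_iff)
  also have "\<dots> = (if f \<in> cube_shifts N then 1 else 0)" by simp
  also have "f \<in> cube_shifts N \<longleftrightarrow> x \<in> cube N"
    unfolding cube_shifts_def cube_def f_def PiE_UNIV_domain
    by (auto simp: le_floor_iff floor_less_iff)
  finally show ?thesis by (simp add: indicator_def)
qed

text \<open>The indicators of the tiles split the integrand into finitely many pieces, and
  translation invariance brings each of them back to the cell.\<close>

lemma integral_cube_unfold:
  fixes f :: "real ^ 'n \<Rightarrow> real"
  assumes f: "f \<in> borel_measurable lebesgue" and z: "\<And>x. x \<notin> cube N \<Longrightarrow> f x = 0"
    and i: "\<And>k. k \<in> cube_shifts N \<Longrightarrow> integrable cellM (\<lambda>x. f (x + shift k))"
  shows "integrable lebesgue f"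
    and "(\<integral>x. f x \<partial>lebesgue) = (\<Sum>k\<in>cube_shifts N. \<integral>x. f (x + shift k) \<partial>cellM)"
proof -
  have fm: "(\<lambda>x. f (x + a)) \<in> borel_measurable lebesgue" for a
    by (rule borel_measurable_translate[OF f])
  have feq: "f x = (\<Sum>k\<in>cube_shifts N. indicator cell_half (x - shift k) * f x)" for x
    using z[of x] by (simp only: sum_distrib_right[symmetric] sum_cell_indicators) (auto simp: indicator_def)
  let ?g = "\<lambda>k x. indicator cell_half x * f (x + shift k)"
  have gm: "?g k \<in> borel_measurable lebesgue" for k
    using fm by (intro borel_measurable_times) auto
  have ae: "AE x in lebesgue. ?g k x = indicator unit_cell x * f (x + shift k)" for k
    using AE_cell_half by eventually_elim (simp add: indicator_def)
  have um: "(\<lambda>x. indicator unit_cell x * f (x + shift k)) \<in> borel_measurable lebesgue" for k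
    using fm by (intro borel_measurable_times) auto
  have gi: "integrable lebesgue (?g k)" if "k \<in> cube_shifts N" for k
    using i[OF that] integrable_cong_AE[OF gm um ae] by (simp add: integrable_cellM_eq)
  have gint: "(\<integral>x. ?g k x \<partial>lebesgue) = (\<integral>x. f (x + shift k) \<partial>cellM)" for k
    unfolding integral_cellM_eq by (rule integral_cong_AE[OF gm um ae])
  have si: "integrable lebesgue (\<lambda>x. indicator cell_half (x - shift k) * f x)"
    and sint: "(\<integral>x. indicator cell_half (x - shift k) * f x \<partial>lebesgue) = (\<integral>x. f (x + shift k) \<partial>cellM)" if "k \<in> cube_shifts N" for k
  proof -
    have "(\<lambda>x. indicator cell_half (x - shift k) * f x) = (\<lambda>x. ?g k (x + (- shift k)))" by simp
    then show "integrable lebesgue (\<lambda>x. indicator cell_half (x - shift k) * f x)"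
      "(\<integral>x. indicator cell_half (x - shift k) * f x \<partial>lebesgue) = (\<integral>x. f (x + shift k) \<partial>cellM)"
      using integrable_translate[OF gm[of k], of "- shift k"] integral_translate[OF gm[of k], of "- shift k"] gi[OF that] gint[of k]
      by simp_all
  qed
  show "integrable lebesgue f"
    by (subst feq[abs_def]) (intro Bochner_Integration.integrable_sum si)
  have "(\<integral>x. f x \<partial>lebesgue) = (\<integral>x. (\<Sum>k\<in>cube_shifts N. indicator cell_half (x - shift k) * f x) \<partial>lebesgue)"
    using feq by (intro Bochner_Integration.integral_cong) auto
  also have "\<dots> = (\<Sum>k\<in>cube_shifts N. \<integral>x. f (x + shift k) \<partial>cellM)"
    by (subst Bochner_Integration.integral_sum) (auto simp: si sint)
  finally show "(\<integral>x. f x \<partial>lebesgue) = (\<Sum>k\<in>cube_shifts N. \<integral>x. f (x + shift k) \<partial>cellM)" .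
qed

text \<open>The vectors \<open>a\<close> with \<open>u (x + a) = u x\<close> almost everywhere form
  a group, because translations preserve null sets; it contains the unit vectors.\<close>

lemma ae_periodic_shift:
  assumes "ae_periodic u"
  shows "AE x in lebesgue. u (x + shift k) = u x"
proof -
  let ?P = "\<lambda>a. AE x in lebesgue. u (x + a) = u x"
  have add: "?P (a + b)" if "?P a" "?P b" for a b
    using AE_translate[OF that(2), of a] that(1)
    by eventually_elim (simp add: add.assoc)
  have neg: "?P (- a)" if "?P a" for a
    using AE_translate[OF that, of "- a"] by eventually_elim simp
  have nat: "?P (real m *\<^sub>R axis i 1)" for m i
  proof (induct m)
    case (Suc m)
    have "?P (real m *\<^sub>R axis i 1 + axis i 1)"
      using Suc assms by (intro add) (auto simp: ae_periodic_def)
    then show ?case by (simp add: scaleR_add_left add.commute)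
  qed simp
  have int: "?P (real_of_int m *\<^sub>R axis i 1)" for m i
    by (cases m rule: int_cases2) (use nat neg[OF nat] in auto)
  have "?P (\<Sum>i\<in>I. real_of_int (k i) *\<^sub>R axis i 1)" for I
  proof (induct I rule: infinite_finite_induct)
    case (insert i I)
    then show ?case using add[OF int[of "k i" i] insert(3)] by (subst sum.insert) auto
  qed simp_all
  moreover have "(\<Sum>i\<in>UNIV. real_of_int (k i) *\<^sub>R axis i 1) = shift k"
    by (simp add: vec_eq_iff axis_def if_distrib sum.delta cong: if_cong)
  ultimately show ?thesis by metis
qed

text \<open>Only countably many shifts are involved, so off one null set every point can be moved
  into the half-open cell by the floors of its coordinates without changing the value of
  \<open>u\<close>.\<close>

lemma periodic_AE_cell:
  fixes u :: "real ^ 'n \<Rightarrow> 'b::zero"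
  assumes "ae_periodic u" "AE x in cellM. u x = 0"
  shows "AE x in lebesgue. u x = 0"
proof -
  have "AE x in lebesgue. x \<in> unit_cell \<longrightarrow> u x = 0"
    using assms(2) by (subst (asm) AE_restrict_space_iff) auto
  with AE_cell_half have c: "AE x in lebesgue. x \<in> cell_half \<longrightarrow> u x = 0"
    by eventually_elim simp
  have "AE x in lebesgue. \<forall>k. x + shift k \<in> cell_half \<longrightarrow> u (x + shift k) = 0"
    by (subst AE_all_countable) (intro allI AE_translate[OF c])
  moreover have "AE x in lebesgue. \<forall>k. u (x + shift k) = u x"
    by (subst AE_all_countable) (intro allI ae_periodic_shift assms)
  ultimately show ?thesis
  proof eventually_elim
    case (elim x)
    have "x + shift (\<lambda>i. - \<lfloor>x $ i\<rfloor>) \<in> cell_half"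
      by (auto simp: cell_half_def) linarith
    with elim show ?case by metis
  qed
qed

lemma periodic_AE_cell_eq:
  fixes u v :: "real ^ 'n \<Rightarrow> 'b::real_vector"
  assumes "ae_periodic u" "ae_periodic v" "AE x in cellM. u x = v x"
  shows "AE x in lebesgue. u x = v x"
proof -
  have "ae_periodic (\<lambda>x. u x - v x)"
    unfolding ae_periodic_def
  proof
    fix i
    from assms(1,2) have "AE x in lebesgue. u (x + axis i 1) = u x" "AE x in lebesgue. v (x + axis i 1) = v x"
      by (auto simp: ae_periodic_def)
    then show "AE x in lebesgue. u (x + axis i 1) - v (x + axis i 1) = u x - v x" by eventually_elim simp
  qed
  from periodic_AE_cell[OF this] assms(3) show ?thesis by simp
qed

text \<open>The passage between the two settings: after unfolding, periodicity replaces
  \<open>h (x + shift k)\<close> by \<open>h x\<close>, which leaves \<open>h\<close> paired on the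
  cell with the periodization of \<open>\<phi>\<close>.\<close>

lemma periodic_test_unfold:
  fixes h \<phi> :: "real ^ 'n \<Rightarrow> real"
  assumes h: "h \<in> borel_measurable lebesgue" "ae_periodic h" "integrable cellM h"
    and p: "\<phi> \<in> borel_measurable lebesgue" "\<And>x. \<bar>\<phi> x\<bar> \<le> K" "\<And>x. x \<notin> cube N \<Longrightarrow> \<phi> x = 0"
  shows "integrable lebesgue (\<lambda>x. h x * \<phi> x)"
    and "(\<integral>x. h x * \<phi> x \<partial>lebesgue) = (\<integral>x. h x * (\<Sum>k\<in>cube_shifts N. \<phi> (x + shift k)) \<partial>cellM)"
proof -
  have m: "(\<lambda>x. h x * \<phi> x) \<in> borel_measurable lebesgue" using h p by simp
  have pm: "(\<lambda>x. \<phi> (x + a)) \<in> borel_measurable cellM" for a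
    by (intro cellM_measurable borel_measurable_translate p)
  have hm: "(\<lambda>x. h (x + a)) \<in> borel_measurable cellM" for a
    by (intro cellM_measurable borel_measurable_translate h)
  have i1: "integrable cellM (\<lambda>x. h x * \<phi> (x + a))" for a
  proof (rule Bochner_Integration.integrable_bound)
    show "integrable cellM (\<lambda>x. K * h x)" using h by simp
    have "\<bar>h x\<bar> * \<bar>\<phi> (x + a)\<bar> \<le> \<bar>K\<bar> * \<bar>h x\<bar>" for x
      using mult_left_mono[OF p(2)[of "x + a"], of "\<bar>h x\<bar>"] p(2)[of "x+a"] by (simp add: mult.commute)
    then show "AE x in cellM. norm (h x * \<phi> (x + a)) \<le> norm (K * h x)"
      by (auto simp: abs_mult)
  qed (use h pm cellM_measurable in auto)
  have ae: "AE x in cellM. h (x + shift k) * \<phi> (x + shift k) = h x * \<phi> (x + shift k)" for k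
    using cellM_AE[OF ae_periodic_shift[OF h(2), of k]] by eventually_elim simp
  have mm: "(\<lambda>x. h (x + shift k) * \<phi> (x + shift k)) \<in> borel_measurable cellM" "(\<lambda>x. h x * \<phi> (x + shift k)) \<in> borel_measurable cellM" for k
    using hm hm[of 0] pm by auto
  have i2: "integrable cellM (\<lambda>x. h (x + shift k) * \<phi> (x + shift k))" for k
    using i1[of "shift k"] integrable_cong_AE[OF mm ae] by simp
  have i3: "(\<integral>x. h (x + shift k) * \<phi> (x + shift k) \<partial>cellM) = (\<integral>x. h x * \<phi> (x + shift k) \<partial>cellM)" for k
    by (rule integral_cong_AE[OF mm ae])
  show "integrable lebesgue (\<lambda>x. h x * \<phi> x)"
    by (rule integral_cube_unfold(1)[OF m _ i2]) (use p in auto)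
  have "(\<integral>x. h x * \<phi> x \<partial>lebesgue) = (\<Sum>k\<in>cube_shifts N. \<integral>x. h (x + shift k) * \<phi> (x + shift k) \<partial>cellM)"
    by (rule integral_cube_unfold(2)[OF m _ i2]) (use p in auto)
  also have "\<dots> = (\<Sum>k\<in>cube_shifts N. \<integral>x. h x * \<phi> (x + shift k) \<partial>cellM)"
    by (simp add: i3)
  also have "\<dots> = (\<integral>x. h x * (\<Sum>k\<in>cube_shifts N. \<phi> (x + shift k)) \<partial>cellM)"
    by (simp add: sum_distrib_left i1)
  finally show "(\<integral>x. h x * \<phi> x \<partial>lebesgue) = (\<integral>x. h x * (\<Sum>k\<in>cube_shifts N. \<phi> (x + shift k)) \<partial>cellM)" .
qed

lemma bounded_subset_cube:
  assumes "bounded (K :: (real ^ 'n) set)"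
  obtains N where "K \<subseteq> cube N"
proof -
  from assms obtain B where B: "\<And>x. x \<in> K \<Longrightarrow> norm x \<le> B" by (auto simp: bounded_iff)
  obtain N where N: "B < real N" using reals_Archimedean2 by blast
  have "K \<subseteq> cube N"
  proof
    fix x assume "x \<in> K"
    have "\<bar>x $ i\<bar> < real N" for i
      using component_le_norm_cart[of x i] B[OF \<open>x \<in> K\<close>] N by linarith
    then have "- real N \<le> x $ i \<and> x $ i < real N" for i
      by (smt (verit) abs_less_iff)
    then show "x \<in> cube N" by (simp add: cube_def)
  qed
  then show ?thesis by (rule that)
qed

section \<open>Smooth functions\<close>

text \<open>The whole family in \<open>m\<close> is introduced, not only
  \<open>exp (- 1 / t)\<close>, because derivatives of a member are linear combinations of other
  members. Smoothness can then be proved by closure of a class under partial derivatives.\<close>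

definition flat_exp :: "nat \<Rightarrow> real \<Rightarrow> real" where
  "flat_exp m t = (if t > 0 then (1 / t) ^ m * exp (- 1 / t) else 0)"

lemma power_le_fact_exp: "0 \<le> x \<Longrightarrow> x ^ n \<le> fact n * exp (x::real)"
proof -
  assume x: "0 \<le> x"
  have "(\<Sum>i\<in>{n}. x ^ i /\<^sub>R fact i) \<le> (\<Sum>i. x ^ i /\<^sub>R fact i)"
    using x by (intro sum_le_suminf summable_exp_generic) auto
  then have "x ^ n / fact n \<le> exp x" by (simp add: exp_def divide_inverse mult.commute)
  then show ?thesis by (simp add: field_simps)
qed

lemma flat_exp_nonneg: "0 \<le> flat_exp m t"
  by (simp add: flat_exp_def)

text \<open>One term of the exponential series shows that \<open>exp (1 / t)\<close> dominates the
  power \<open>m + 2\<close> of \<open>1 / t\<close>. The two surplus powers leave the factor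
  \<open>t^2\<close>, which makes the difference quotient at the origin tend to zero.\<close>

lemma flat_exp_bound: "flat_exp m t \<le> fact (m + 2) * t\<^sup>2"
proof (cases "t > 0")
  case True
  have "(1 / t) ^ (m + 2) \<le> fact (m + 2) * exp (1 / t)"
    using True by (intro power_le_fact_exp) auto
  then have "(1 / t) ^ (m + 2) * t\<^sup>2 * exp (- 1 / t) \<le> fact (m + 2) * exp (1 / t) * t\<^sup>2 * exp (- 1 / t)"
    by (intro mult_right_mono) auto
  moreover have "(1 / t) ^ (m + 2) * t\<^sup>2 = (1 / t) ^ m"
    using True by (simp add: power_add power2_eq_square)
  moreover have "exp (1 / t) * exp (- 1 / t) = 1" by (simp flip: exp_add)
  then have "fact (m + 2) * exp (1 / t) * t\<^sup>2 * exp (- 1 / t) = fact (m + 2) * t\<^sup>2"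
    by (metis (no_types, lifting) mult.assoc mult.commute mult.right_neutral)
  ultimately have "(1 / t) ^ m * exp (- 1 / t) \<le> fact (m + 2) * t\<^sup>2" by metis
  then show ?thesis using True by (simp only: flat_exp_def if_True)
qed (simp add: flat_exp_def)

lemma flat_exp_deriv:
  "(flat_exp m has_real_derivative flat_exp (m + 2) t - real m * flat_exp (m + 1) t) (at t)"
proof (cases t "0 :: real" rule: linorder_cases)
  case less
  have "((\<lambda>t. 0) has_real_derivative 0) (at t)" by simp
  then have "(flat_exp m has_real_derivative 0) (at t)"
    by (rule DERIV_cong_ev[THEN iffD1, rotated -1])
       (use less eventually_nhds_in_open[of "{..<0}" t] in \<open>auto elim!: eventually_mono simp: flat_exp_def\<close>)
  then show ?thesis using less by (simp add: flat_exp_def)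
next
  case equal
  have "((\<lambda>h. (flat_exp m (0 + h) - flat_exp m 0) / h) \<longlongrightarrow> 0) (at 0)"
  proof (rule Lim_null_comparison)
    show "\<forall>\<^sub>F h in at 0. norm ((flat_exp m (0 + h) - flat_exp m 0) / h) \<le> fact (m + 2) * \<bar>h\<bar>"
    proof (rule always_eventually, rule allI)
      fix h :: real
      show "norm ((flat_exp m (0 + h) - flat_exp m 0) / h) \<le> fact (m + 2) * \<bar>h\<bar>"
      proof (cases "h = 0")
        case False
        have "\<bar>flat_exp m h\<bar> \<le> fact (m + 2) * (\<bar>h\<bar> * \<bar>h\<bar>)"
          using flat_exp_bound[of m h] flat_exp_nonneg[of m h] by (simp add: power2_eq_square)
        then show ?thesis using False by (simp add: flat_exp_def[of m 0] abs_divide divide_le_eq mult.assoc)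
      qed simp
    qed
    have "((\<lambda>h::real. fact (m + 2) * \<bar>h\<bar>) \<longlongrightarrow> fact (m + 2) * \<bar>0\<bar>) (at 0)"
      by (intro tendsto_intros)
    then show "((\<lambda>h::real. fact (m + 2) * \<bar>h\<bar>) \<longlongrightarrow> 0) (at 0)" by simp
  qed
  then show ?thesis using equal by (simp add: DERIV_def flat_exp_def[of "m + 2" 0] flat_exp_def[of "Suc m" 0] flat_exp_def[of "Suc (Suc m)" 0])
next
  case greater
  have "((\<lambda>t. (1 / t) ^ m * exp (- 1 / t)) has_real_derivative
      (1 / t) ^ (m + 2) * exp (- 1 / t) - real m * ((1 / t) ^ (m + 1) * exp (- 1 / t))) (at t)"
  proof (cases m)
    case 0
    then show ?thesis using greater
      by (auto intro!: derivative_eq_intros simp: field_simps power2_eq_square)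
  next
    case (Suc k)
    have u: "((\<lambda>t. 1 / t) has_real_derivative - 1 / t\<^sup>2) (at t)"
      "((\<lambda>t. - 1 / t) has_real_derivative 1 / t\<^sup>2) (at t)"
      using greater by (auto intro!: derivative_eq_intros simp: power2_eq_square)
    have "((\<lambda>t. (1 / t) ^ Suc k * exp (- 1 / t)) has_real_derivative
        real (Suc k) * (- 1 / t\<^sup>2 * (1 / t) ^ (Suc k - Suc 0)) * exp (- 1 / t) + exp (- 1 / t) * (1 / t\<^sup>2) * (1 / t) ^ Suc k) (at t)"
      by (intro DERIV_mult DERIV_power DERIV_fun_exp u)
    then show ?thesis unfolding Suc
      by (rule DERIV_cong) (use greater in \<open>simp add: field_simps power2_eq_square\<close>)
  qed
  then have "(flat_exp m has_real_derivative
      (1 / t) ^ (m + 2) * exp (- 1 / t) - real m * ((1 / t) ^ (m + 1) * exp (- 1 / t))) (at t)"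
    by (rule DERIV_cong_ev[THEN iffD1, rotated -1])
       (use greater eventually_nhds_in_open[of "{0<..}" t] in \<open>auto elim!: eventually_mono simp: flat_exp_def\<close>)
  then show ?thesis using greater by (simp add: flat_exp_def)
qed

text \<open>The class is closed under partial derivatives, and therefore consists of smooth functions.\<close>

inductive_set elem_smooth :: "(real ^ 'n \<Rightarrow> real) set" where
  const: "(\<lambda>x. c) \<in> elem_smooth"
| cos: "(\<lambda>x. cos (a \<bullet> x + c)) \<in> elem_smooth"
| flat: "(\<lambda>x. flat_exp m (a \<bullet> x + c)) \<in> elem_smooth"
| add: "f \<in> elem_smooth \<Longrightarrow> g \<in> elem_smooth \<Longrightarrow> (\<lambda>x. f x + g x) \<in> elem_smooth"
| mult: "f \<in> elem_smooth \<Longrightarrow> g \<in> elem_smooth \<Longrightarrow> (\<lambda>x. f x * g x) \<in> elem_smooth"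
| inverse: "f \<in> elem_smooth \<Longrightarrow> (\<And>x. f x \<noteq> 0) \<Longrightarrow> (\<lambda>x. inverse (f x)) \<in> elem_smooth"

section \<open>Differentiation inside the class of elementary smooth functions\<close>

lemma partial_deriv_eq: "(f has_derivative D) (at x) \<Longrightarrow> partial_deriv i f x = D (axis i 1)"
  unfolding partial_deriv_def by (simp add: frechet_derivative_at[symmetric])

lemma elem_smooth_cmult: "f \<in> elem_smooth \<Longrightarrow> (\<lambda>x. c * f x) \<in> elem_smooth"
  by (intro elem_smooth.mult elem_smooth.const)

lemma elem_smooth_uminus: "f \<in> elem_smooth \<Longrightarrow> (\<lambda>x. - f x) \<in> elem_smooth"
  using elem_smooth_cmult[of f "-1"] by simp

lemma elem_smooth_diff: "f \<in> elem_smooth \<Longrightarrow> g \<in> elem_smooth \<Longrightarrow> (\<lambda>x. f x - g x) \<in> elem_smooth"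
  using elem_smooth.add[OF _ elem_smooth_uminus, of f g] by simp

lemma elem_smooth_prod: "(\<And>i. i \<in> I \<Longrightarrow> f i \<in> elem_smooth) \<Longrightarrow> (\<lambda>x. \<Prod>i\<in>I. f i x) \<in> elem_smooth"
  by (induct I rule: infinite_finite_induct) (auto intro: elem_smooth.intros)

lemma elem_smooth_has_derivative:
  assumes "f \<in> elem_smooth"
  shows "\<exists>D. (\<forall>x. (f has_derivative D x) (at x)) \<and> (\<forall>i. (\<lambda>x. D x (axis i 1)) \<in> elem_smooth)"
  using assms
proof induct
  case (const c)
  show ?case by (intro exI[of _ "\<lambda>x h. 0"]) (auto intro: elem_smooth.const)
next
  case (cos a c)
  \<comment> \<open>Since \<open>- sin y = cos (y + pi / 2)\<close>, cosines with arbitrary phase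
    already contain the sines.\<close>
  have s: "(\<lambda>x. - sin (a \<bullet> x + c) * (a \<bullet> axis i 1)) \<in> elem_smooth" for i
    using elem_smooth_cmult[OF elem_smooth.cos[of a "c + pi / 2"], of "a \<bullet> axis i 1"]
    by (simp add: cos_add sin_add mult.commute flip: add.assoc)
  show ?case
    by (rule exI[of _ "\<lambda>x h. - sin (a \<bullet> x + c) * (a \<bullet> h)"])
       (use s in \<open>auto intro!: derivative_eq_intros\<close>)
next
  case (flat m a c)
  let ?d = "\<lambda>t. flat_exp (m + 2) t - real m * flat_exp (m + 1) t"
  have d: "((\<lambda>x. flat_exp m (a \<bullet> x + c)) has_derivative (\<lambda>h. (a \<bullet> h) * ?d (a \<bullet> x + c))) (at x)" for x
  proof (rule has_derivative_compose[where f="\<lambda>x. a \<bullet> x + c" and f'="\<lambda>h. a \<bullet> h", THEN has_derivative_eq_rhs])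
    show "((\<lambda>x. a \<bullet> x + c) has_derivative (\<lambda>h. a \<bullet> h)) (at x)"
      by (auto intro!: derivative_eq_intros)
    show "(flat_exp m has_derivative (\<lambda>h. h * ?d (a \<bullet> x + c))) (at (a \<bullet> x + c))"
      using flat_exp_deriv[of m "a \<bullet> x + c"] unfolding has_field_derivative_def
      by (rule has_derivative_eq_rhs) (simp add: fun_eq_iff)
  qed simp
  have "(\<lambda>x. (a \<bullet> axis i 1) * ?d (a \<bullet> x + c)) \<in> elem_smooth" for i
    by (intro elem_smooth_cmult elem_smooth_diff elem_smooth.flat)
  with d show ?case by (intro exI[of _ "\<lambda>x h. (a \<bullet> h) * ?d (a \<bullet> x + c)"]) auto
next
  case (add f g)
  then obtain D E where "\<forall>x. (f has_derivative D x) (at x)" "\<forall>i. (\<lambda>x. D x (axis i 1)) \<in> elem_smooth"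
    "\<forall>x. (g has_derivative E x) (at x)" "\<forall>i. (\<lambda>x. E x (axis i 1)) \<in> elem_smooth" by blast
  then show ?case
    by (intro exI[of _ "\<lambda>x h. D x h + E x h"]) (auto intro!: has_derivative_add elem_smooth.add)
next
  case (mult f g)
  then obtain D E where "\<forall>x. (f has_derivative D x) (at x)" "\<forall>i. (\<lambda>x. D x (axis i 1)) \<in> elem_smooth"
    "\<forall>x. (g has_derivative E x) (at x)" "\<forall>i. (\<lambda>x. E x (axis i 1)) \<in> elem_smooth" by blast
  then show ?case using mult
    by (intro exI[of _ "\<lambda>x h. f x * E x h + D x h * g x"]) (auto intro!: has_derivative_mult elem_smooth.add elem_smooth.mult)
next
  case (inverse f)
  then obtain D where "\<forall>x. (f has_derivative D x) (at x)" "\<forall>i. (\<lambda>x. D x (axis i 1)) \<in> elem_smooth" by blast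
  then show ?case using inverse
    by (intro exI[of _ "\<lambda>x h. - (inverse (f x) * D x h * inverse (f x))"])
       (auto intro!: Deriv.has_derivative_inverse elem_smooth.mult elem_smooth.inverse elem_smooth_uminus)
qed

lemma elem_smooth_partial:
  assumes "f \<in> elem_smooth" shows "partial_deriv i f \<in> elem_smooth" "f differentiable (at x)"
proof -
  from elem_smooth_has_derivative[OF assms] obtain D where
    D: "\<And>x. (f has_derivative D x) (at x)" "\<And>i. (\<lambda>x. D x (axis i 1)) \<in> elem_smooth" by blast
  have "partial_deriv i f = (\<lambda>x. D x (axis i 1))" by (rule ext) (rule partial_deriv_eq[OF D(1)])
  then show "partial_deriv i f \<in> elem_smooth" using D(2) by simp
  show "f differentiable (at x)" using D(1) by (auto simp: differentiable_def)
qed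

lemma elem_smooth_smooth:
  assumes "f \<in> elem_smooth" shows "smooth f"
proof -
  have "foldr partial_deriv is f \<in> elem_smooth" for "is"
    by (induct "is") (use assms elem_smooth_partial(1) in auto)
  then show ?thesis unfolding smooth_def using elem_smooth_partial(2) by blast
qed

section \<open>Rules for partial derivatives; functions of bounded support\<close>

lemma smooth_continuous: "smooth f \<Longrightarrow> continuous_on UNIV f"
  unfolding smooth_def
  by (metis foldr_Nil id_apply continuous_at_imp_continuous_on differentiable_imp_continuous_within)

lemma smooth_differentiable: "smooth f \<Longrightarrow> f differentiable (at x)"
  unfolding smooth_def by (metis foldr_Nil id_apply)

lemma smooth_partial: "smooth f \<Longrightarrow> smooth (partial_deriv i f)"
  unfolding smooth_def
proof (intro allI)
  fix "is" x
  assume "\<forall>is x. foldr partial_deriv is f differentiable (at x)"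
  then have "foldr partial_deriv (is @ [i]) f differentiable (at x)" by blast
  then show "foldr partial_deriv is (partial_deriv i f) differentiable (at x)" by simp
qed

lemma smooth_measurable: "smooth f \<Longrightarrow> f \<in> borel_measurable lebesgue"
  by (auto dest!: smooth_continuous intro!: measurable_completion borel_measurable_continuous_onI)

lemma partial_deriv_mult:
  assumes "f differentiable (at x)" "g differentiable (at x)"
  shows "partial_deriv i (\<lambda>x. f x * g x) x = f x * partial_deriv i g x + partial_deriv i f x * g x"
proof -
  from assms obtain D E where "(f has_derivative D) (at x)" "(g has_derivative E) (at x)"
    by (auto simp: differentiable_def)
  then show ?thesis
    using partial_deriv_eq[OF has_derivative_mult, of f D x g E i] by (simp add: partial_deriv_eq)
qed

lemma partial_deriv_add:
  assumes "f differentiable (at x)" "g differentiable (at x)"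
  shows "partial_deriv i (\<lambda>x. f x + g x) x = partial_deriv i f x + partial_deriv i g x"
proof -
  from assms obtain D E where "(f has_derivative D) (at x)" "(g has_derivative E) (at x)"
    by (auto simp: differentiable_def)
  then show ?thesis
    using partial_deriv_eq[OF has_derivative_add, of f D x g E i] by (simp add: partial_deriv_eq)
qed

lemma partial_deriv_const: "partial_deriv i (\<lambda>x. c) x = 0"
  by (subst partial_deriv_eq[OF has_derivative_const]) simp

lemma partial_deriv_cmult:
  assumes "f differentiable (at x)"
  shows "partial_deriv i (\<lambda>x. c * f x) x = c * partial_deriv i f x"
  using partial_deriv_mult[of "\<lambda>x. c" x f i] assms by (simp add: partial_deriv_const)

lemma partial_deriv_sum:
  assumes "\<And>k. k \<in> I \<Longrightarrow> f k differentiable (at x)"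
  shows "partial_deriv i (\<lambda>x. \<Sum>k\<in>I. f k x) x = (\<Sum>k\<in>I. partial_deriv i (f k) x)"
proof -
  have "(f k has_derivative frechet_derivative (f k) (at x)) (at x)" if "k \<in> I" for k
    using assms[OF that] frechet_derivative_works by blast
  from partial_deriv_eq[OF has_derivative_sum[OF this]] show ?thesis
    by (simp add: partial_deriv_def)
qed

lemma partial_deriv_translate:
  assumes "f differentiable (at (x + a))"
  shows "partial_deriv i (\<lambda>x. f (x + a)) x = partial_deriv i f (x + a)"
    and "(\<lambda>x. f (x + a)) differentiable (at x)"
proof -
  from assms obtain D where D: "(f has_derivative D) (at (x + a))"
    by (auto simp: differentiable_def)
  have "((\<lambda>x. x + a) has_derivative (\<lambda>h. h)) (at x)" by (auto intro!: derivative_eq_intros)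
  from has_derivative_compose[OF this D]
  have E: "((\<lambda>x. f (x + a)) has_derivative D) (at x)" by simp
  show "partial_deriv i (\<lambda>x. f (x + a)) x = partial_deriv i f (x + a)"
    using partial_deriv_eq[OF D] partial_deriv_eq[OF E] by simp
  show "(\<lambda>x. f (x + a)) differentiable (at x)" using E by (auto simp: differentiable_def)
qed

lemma partial_deriv_cong_open:
  assumes "open S" "x \<in> S" "\<And>y. y \<in> S \<Longrightarrow> f y = g y" "g differentiable (at x)"
  shows "partial_deriv i f x = partial_deriv i g x"
proof -
  from assms(4) obtain D where D: "(g has_derivative D) (at x)" by (auto simp: differentiable_def)
  have "(f has_derivative D) (at x)"
    using has_derivative_transform_within_open[OF D assms(1,2)] assms(3) by metis
  then show ?thesis using D by (simp add: partial_deriv_eq)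
qed

lemma continuous_compact_support:
  fixes f :: "real ^ 'n \<Rightarrow> real"
  assumes c: "continuous_on UNIV f" and z: "\<And>x. norm x > B \<Longrightarrow> f x = 0"
  shows "f \<in> borel_measurable lebesgue" "\<exists>K\<ge>0. \<forall>x. \<bar>f x\<bar> \<le> K" "integrable lebesgue f"
proof -
  show m: "f \<in> borel_measurable lebesgue"
    using c by (auto intro!: measurable_completion borel_measurable_continuous_onI)
  have "compact (f ` cball 0 B)"
    by (intro compact_continuous_image continuous_on_subset[OF c]) auto
  then have "bounded (f ` cball 0 B)" by (rule compact_imp_bounded)
  then obtain K where K: "\<And>x. x \<in> cball 0 B \<Longrightarrow> \<bar>f x\<bar> \<le> K" unfolding bounded_iff by force
  have K': "\<bar>f x\<bar> \<le> \<bar>K\<bar>" for x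
    using K[of x] z[of x] by (cases "norm x > B") (auto simp: )
  then show "\<exists>K\<ge>0. \<forall>x. \<bar>f x\<bar> \<le> K" by (intro exI[of _ "\<bar>K\<bar>"]) auto
  show "integrable lebesgue f"
  proof (rule Bochner_Integration.integrable_bound[OF _ m])
    have "integrable lebesgue (indicator (cball 0 B) :: real ^ 'n \<Rightarrow> real)"
      by (rule integrable_real_indicator) (use emeasure_lborel_cball_finite in \<open>auto simp: less_top\<close>)
    then show "integrable lebesgue (\<lambda>x::real ^ 'n. \<bar>K\<bar> * indicator (cball 0 B) x :: real)" by simp
    show "AE x in lebesgue. norm (f x) \<le> norm (\<bar>K\<bar> * indicator (cball 0 B) x)"
      using K' z by (intro always_eventually) (auto simp: indicator_def not_le)
  qed
qed

lemma partial_deriv_zero_outside: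
  assumes "\<And>x. norm x > B \<Longrightarrow> f x = 0" "norm x > B"
  shows "partial_deriv i f x = 0"
proof -
  have o: "open {x :: real ^ 'n. norm x > B}"
    by (rule open_Collect_less) (auto intro!: continuous_intros)
  have "partial_deriv i f x = partial_deriv i (\<lambda>x. 0) x"
    by (rule partial_deriv_cong_open[OF o]) (use assms in auto)
  then show ?thesis by (simp add: partial_deriv_const)
qed

text \<open>Difference quotients of \<open>f\<close> integrate to zero by translation invariance.
  They converge to the partial derivative, with a dominating function supplied by the mean value
  theorem.\<close>

lemma integral_partial_deriv_zero:
  fixes f :: "real ^ 'n \<Rightarrow> real"
  assumes d: "\<And>x. f differentiable (at x)" and c: "continuous_on UNIV (partial_deriv i f)"
    and z: "\<And>x. norm x > B \<Longrightarrow> f x = 0"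
  shows "(\<integral>x. partial_deriv i f x \<partial>lebesgue) = 0"
proof -
  let ?g = "partial_deriv i f"
  have fc: "continuous_on UNIV f"
    using d by (intro continuous_at_imp_continuous_on) (auto intro: differentiable_imp_continuous_within)
  note f = continuous_compact_support[OF fc z]
  note g = continuous_compact_support[OF c partial_deriv_zero_outside[of B f, OF z]]
  obtain K where K: "K \<ge> 0" "\<And>x. \<bar>?g x\<bar> \<le> K" using g(2) by auto
  \<comment> \<open>Increments of length at most 1 keep every quotient supported in the ball of
    radius \<open>B + 1\<close>, on which the dominating function lives.\<close>
  define h where "h n = 1 / real (Suc n)" for n
  have h: "0 < h n" "h n \<le> 1" for n by (auto simp: h_def)
  define q where "q n x = (f (x + axis i (h n)) - f x) / h n" for n x
  have line: "((\<lambda>t. f (x + axis i t)) has_real_derivative ?g (x + axis i t)) (at t)" for x t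
  proof -
    have fd: "(f has_derivative frechet_derivative f (at (x + axis i t))) (at (x + axis i t))"
      using d frechet_derivative_works by blast
    have ax: "(\<lambda>t. x + axis i t) = (\<lambda>t. x + t *\<^sub>R axis i (1::real))"
      by (auto simp: fun_eq_iff vec_eq_iff axis_def)
    have "((\<lambda>t. x + axis i t) has_derivative (\<lambda>s. s *\<^sub>R axis i 1)) (at t)"
      unfolding ax by (auto intro!: derivative_eq_intros)
    from has_derivative_compose[OF this fd]
    have fl: "((\<lambda>t. f (x + axis i t)) has_derivative (\<lambda>s. frechet_derivative f (at (x + axis i t)) (s *\<^sub>R axis i 1))) (at t)" .
    have "linear (frechet_derivative f (at (x + axis i t)))"
      using d linear_frechet_derivative by blast
    with fl show ?thesis
      unfolding has_field_derivative_def
      by (elim has_derivative_eq_rhs) (simp add: fun_eq_iff partial_deriv_def linear_cmul)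
  qed
  have "(\<lambda>n. \<integral>x. q n x \<partial>lebesgue) \<longlonglongrightarrow> (\<integral>x. ?g x \<partial>lebesgue)"
  proof (rule integral_dominated_convergence)
    show "?g \<in> borel_measurable lebesgue" by (rule g)
    show "q n \<in> borel_measurable lebesgue" for n
      unfolding q_def using f(1) borel_measurable_translate[OF f(1)] by auto
    have "integrable lebesgue (indicator (cball 0 (B + 1)) :: real ^ 'n \<Rightarrow> real)"
      by (rule integrable_real_indicator) (use emeasure_lborel_cball_finite in \<open>auto simp: less_top\<close>)
    then show "integrable lebesgue (\<lambda>x::real ^ 'n. K * indicator (cball 0 (B + 1)) x :: real)" by simp
    show "AE x in lebesgue. (\<lambda>n. q n x) \<longlonglongrightarrow> ?g x"
    proof (rule always_eventually, rule allI)
      fix x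
      have "((\<lambda>s. (f (x + axis i (0 + s)) - f (x + axis i 0)) / s) \<longlongrightarrow> ?g (x + axis i 0)) (at 0)"
        using line[of x 0] by (simp add: DERIV_def)
      moreover have a0: "axis i (0::real) = 0" by (simp add: axis_def vec_eq_iff)
      ultimately have l: "((\<lambda>s. (f (x + axis i s) - f x) / s) \<longlongrightarrow> ?g x) (at 0)" by simp
      have "h \<longlonglongrightarrow> 0" unfolding h_def[abs_def] using LIMSEQ_inverse_real_of_nat by (simp add: inverse_eq_divide)
      then have "filterlim h (at 0) sequentially"
        using h(1) by (auto simp: filterlim_at intro!: always_eventually) (metis less_irrefl)
      from filterlim_compose[OF l this] show "(\<lambda>n. q n x) \<longlonglongrightarrow> ?g x" by (simp add: q_def)
    qed
    show "AE x in lebesgue. norm (q n x) \<le> K * indicator (cball 0 (B + 1)) x" for n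
    proof (rule always_eventually, rule allI)
      fix x
      show "norm (q n x) \<le> K * indicator (cball 0 (B + 1)) x"
      proof (cases "x \<in> cball 0 (B + 1)")
        case True
        have "\<exists>z>0. z < h n \<and> f (x + axis i (h n)) - f (x + axis i 0) = (h n - 0) * ?g (x + axis i z)"
          by (rule MVT2) (use line h in auto)
        then obtain z where "f (x + axis i (h n)) - f (x + axis i 0) = h n * ?g (x + axis i z)" by auto
        moreover have a0: "axis i (0::real) = 0" by (simp add: axis_def vec_eq_iff)
        ultimately have "q n x = ?g (x + axis i z)" using h(1)[of n] by (simp add: q_def)
        then show ?thesis using K True by simp
      next
        case False
        have "norm (axis i (h n) :: real ^ 'n) = h n" using h(1)[of n]
          by (simp add: norm_vec_def L2_set_def axis_def if_distrib[of abs] if_distrib[of "\<lambda>x. x\<^sup>2"] cong: if_cong)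
        then have "norm x - h n \<le> norm (x + axis i (h n))"
          using norm_triangle_ineq4[of "x + axis i (h n)" "axis i (h n)"] by simp
        then have "f (x + axis i (h n)) = 0" "f x = 0" using False h(2)[of n] by (auto intro!: z)
        then show ?thesis using K by (simp add: q_def)
      qed
    qed
  qed
  moreover have "(\<integral>x. q n x \<partial>lebesgue) = 0" for n
  proof -
    have "integrable lebesgue (\<lambda>x. f (x + axis i (h n)))" using f integrable_translate by blast
    then show ?thesis unfolding q_def using f integral_translate[OF f(1)] by simp
  qed
  ultimately show ?thesis by (simp add: LIMSEQ_const_iff)
qed

section \<open>Weak derivatives\<close>

text \<open>The standard smooth transition from 0 on \<open>t \<le> 0\<close> to 1 on
  \<open>t \<ge> 1\<close>. The denominator is positive because \<open>t\<close> and
  \<open>1 - t\<close> are never both nonpositive.\<close>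

definition step :: "real \<Rightarrow> real" where
  "step t = flat_exp 0 t * inverse (flat_exp 0 t + flat_exp 0 (1 - t))"

lemma flat_exp_sum_pos: "0 < flat_exp 0 t + flat_exp 0 (1 - t)"
  by (cases "t > 0") (auto simp: flat_exp_def add_pos_nonneg)

lemma step_0: "t \<le> 0 \<Longrightarrow> step t = 0"
  by (simp add: step_def flat_exp_def)

lemma step_1: "t \<ge> 1 \<Longrightarrow> step t = 1"
  using flat_exp_sum_pos[of t] by (simp add: step_def flat_exp_def)

lemma step_nonneg: "0 \<le> step t"
  unfolding step_def using flat_exp_sum_pos[of t] flat_exp_nonneg by simp

lemma step_le_1: "step t \<le> 1"
  using flat_exp_sum_pos[of t] flat_exp_nonneg[of 0 "1 - t"] by (simp add: step_def field_simps)

lemma step_elem_smooth: "(\<lambda>x. step (a \<bullet> x + c)) \<in> elem_smooth"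
proof -
  have "(\<lambda>x. flat_exp 0 ((- a) \<bullet> x + (1 - c))) \<in> elem_smooth" by (rule elem_smooth.flat)
  then have "(\<lambda>x. flat_exp 0 (1 - (a \<bullet> x + c))) \<in> elem_smooth" by (simp add: algebra_simps)
  then have "(\<lambda>x. inverse (flat_exp 0 (a \<bullet> x + c) + flat_exp 0 (1 - (a \<bullet> x + c)))) \<in> elem_smooth"
    using flat_exp_sum_pos by (intro elem_smooth.inverse elem_smooth.add elem_smooth.flat) (auto simp: less_imp_neq[symmetric])
  then show ?thesis unfolding step_def by (intro elem_smooth.mult elem_smooth.flat)
qed

lemma step_coord_elem_smooth: "(\<lambda>x. step (a * x $ i + c)) \<in> elem_smooth"
  using step_elem_smooth[of "axis i a" c] by (simp add: inner_axis' )

section \<open>Test functions and integration by parts\<close>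

lemma test_function_support:
  fixes \<phi> :: "real ^ 'n \<Rightarrow> real"
  assumes "test_function \<phi>"
  obtains B N where "\<And>x. norm x > B \<Longrightarrow> \<phi> x = 0" "cball 0 B \<subseteq> (cube N :: (real ^ 'n) set)"
proof -
  have "bounded (closure {x. \<phi> x \<noteq> 0})"
    using assms compact_imp_bounded by (auto simp: test_function_def)
  then obtain B where B: "\<And>x. x \<in> closure {x. \<phi> x \<noteq> 0} \<Longrightarrow> norm x \<le> B" unfolding bounded_iff by blast
  have B': "norm x > B \<Longrightarrow> \<phi> x = 0" for x
    using B[of x] closure_subset[of "{x. \<phi> x \<noteq> 0}"] by force
  obtain N where N: "cball 0 B \<subseteq> (cube N :: (real^'n) set)" using bounded_subset_cube[OF bounded_cball] by blast
  show ?thesis using that[of B N] B' N by blast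
qed

lemma test_function_smooth: "test_function \<phi> \<Longrightarrow> smooth \<phi>"
  by (simp add: test_function_def)

lemma test_functionI:
  assumes "\<phi> \<in> elem_smooth" "\<And>x. x \<notin> cbox l u \<Longrightarrow> \<phi> x = 0"
  shows "test_function \<phi>"
  unfolding test_function_def
proof
  show "smooth \<phi>" by (rule elem_smooth_smooth) fact
  have "{x. \<phi> x \<noteq> 0} \<subseteq> cbox l u" using assms(2) by auto
  then have "bounded {x. \<phi> x \<noteq> 0}" using bounded_cbox bounded_subset by blast
  then show "compact (closure {x. \<phi> x \<noteq> 0})" by (simp add: compact_closure)
qed

lemma test_function_bounded:
  fixes \<phi> :: "real ^ 'n \<Rightarrow> real"
  assumes "test_function \<phi>"
  shows "\<exists>K\<ge>0. \<forall>x. \<bar>\<phi> x\<bar> \<le> K" "\<phi> \<in> borel_measurable lebesgue"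
    "\<exists>K\<ge>0. \<forall>x. \<bar>partial_deriv i \<phi> x\<bar> \<le> K" "partial_deriv i \<phi> \<in> borel_measurable lebesgue"
    "\<exists>N. \<forall>x. x \<notin> cube N \<longrightarrow> \<phi> x = 0 \<and> partial_deriv i \<phi> x = 0"
proof -
  obtain B N where B: "\<And>x. norm x > B \<Longrightarrow> \<phi> x = 0" and N: "cball 0 B \<subseteq> (cube N :: (real^'n) set)"
    using test_function_support[OF assms] by metis
  have c: "continuous_on UNIV \<phi>" "continuous_on UNIV (partial_deriv i \<phi>)"
    using assms by (auto intro: smooth_continuous smooth_partial test_function_smooth)
  have B': "\<And>x. norm x > B \<Longrightarrow> partial_deriv i \<phi> x = 0"
    using partial_deriv_zero_outside[of B \<phi>, OF B] by blast
  show "\<exists>K\<ge>0. \<forall>x. \<bar>\<phi> x\<bar> \<le> K" "\<phi> \<in> borel_measurable lebesgue"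
    "\<exists>K\<ge>0. \<forall>x. \<bar>partial_deriv i \<phi> x\<bar> \<le> K" "partial_deriv i \<phi> \<in> borel_measurable lebesgue"
    using continuous_compact_support[OF c(1) B] continuous_compact_support[OF c(2) B'] by blast+
  have "x \<notin> cube N \<Longrightarrow> norm x > B" for x :: "real ^ 'n" using N by (auto simp: subset_iff not_le[symmetric])
  then show "\<exists>N. \<forall>x. x \<notin> cube N \<longrightarrow> \<phi> x = 0 \<and> partial_deriv i \<phi> x = 0" using B B' by blast
qed

lemma smooth_integration_by_parts:
  fixes u \<phi> :: "real ^ 'n \<Rightarrow> real"
  assumes u: "smooth u" and t: "test_function \<phi>"
  shows "(\<integral>x. u x * partial_deriv i \<phi> x \<partial>lebesgue) = - (\<integral>x. partial_deriv i u x * \<phi> x \<partial>lebesgue)"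
proof -
  obtain B where B: "\<And>x. norm x > B \<Longrightarrow> \<phi> x = 0"
    using test_function_support[OF t] by metis
  note s = test_function_smooth[OF t]
  have B': "\<And>x. norm x > B \<Longrightarrow> partial_deriv i \<phi> x = 0"
    using partial_deriv_zero_outside[of B \<phi>, OF B] by blast
  have c: "continuous_on UNIV (\<lambda>x. u x * partial_deriv i \<phi> x)" "continuous_on UNIV (\<lambda>x. partial_deriv i u x * \<phi> x)"
    using u s by (auto intro!: continuous_on_mult intro: smooth_continuous smooth_partial)
  have i: "integrable lebesgue (\<lambda>x. u x * partial_deriv i \<phi> x)" "integrable lebesgue (\<lambda>x. partial_deriv i u x * \<phi> x)"
    by (rule continuous_compact_support(3)[OF c(1), of B], use B' in simp)
       (rule continuous_compact_support(3)[OF c(2), of B], use B in simp)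
  have pd: "partial_deriv i (\<lambda>x. u x * \<phi> x) = (\<lambda>x. u x * partial_deriv i \<phi> x + partial_deriv i u x * \<phi> x)"
    using u s by (intro ext partial_deriv_mult) (auto intro: smooth_differentiable)
  have "(\<integral>x. partial_deriv i (\<lambda>x. u x * \<phi> x) x \<partial>lebesgue) = 0"
  proof (rule integral_partial_deriv_zero[of _ _ B])
    show "(\<lambda>x. u x * \<phi> x) differentiable (at x)" for x
      using u s by (intro differentiable_mult) (auto intro: smooth_differentiable)
    show "continuous_on UNIV (partial_deriv i (\<lambda>x. u x * \<phi> x))"
      unfolding pd by (intro continuous_on_add c)
  qed (use B in auto)
  then show ?thesis unfolding pd using i by simp
qed

section \<open>The fundamental lemma of the calculus of variations\<close>

lemma loc_integrable_cbox:
  assumes "loc_integrable h"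
  shows "integrable lebesgue (\<lambda>x. indicator (cbox l u) x * h x)"
proof -
  have "h absolutely_integrable_on cbox l u" using assms by (simp add: loc_integrable_def)
  then show ?thesis by (simp add: set_integrable_def)
qed

lemma loc_integrable_measurable:
  assumes "loc_integrable (h :: real ^ 'n \<Rightarrow> real)"
  shows "h \<in> borel_measurable lebesgue"
proof (rule borel_measurable_LIMSEQ_real)
  fix N :: nat
  show "(\<lambda>x. indicator (cbox (\<chi> i. - real N) (\<chi> i. real N)) x * h x) \<in> borel_measurable lebesgue"
    using loc_integrable_cbox[OF assms] by blast
next
  fix x :: "real ^ 'n"
  obtain M where M: "norm x < real M" using reals_Archimedean2 by blast
  have "x \<in> cbox (\<chi> i. - real N) (\<chi> i. real N)" if "N \<ge> M" for N
  proof -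
    have "\<bar>x $ i\<bar> \<le> real N" for i using component_le_norm_cart[of x i] M that by linarith
    then show ?thesis by (auto simp: mem_box_cart abs_le_iff minus_le_iff)
  qed
  then show "(\<lambda>N. indicator (cbox (\<chi> i. - real N) (\<chi> i. real N)) x * h x) \<longlonglongrightarrow> h x"
    by (intro tendsto_eventually eventually_sequentiallyI[of M]) auto
qed

lemma step_tendsto_indicator:
  "(\<lambda>m. step (real m * t)) \<longlonglongrightarrow> (if t > 0 then 1 else 0)"
proof (rule tendsto_eventually, cases "t > 0")
  case True
  obtain M where M: "1 / t < real M" using reals_Archimedean2 by blast
  show "\<forall>\<^sub>F m in sequentially. step (real m * t) = (if t > 0 then 1 else 0)"
  proof (rule eventually_sequentiallyI[of M])
    fix m assume "M \<le> m"
    then have "1 / t \<le> real m" using M by simp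
    then show "step (real m * t) = (if t > 0 then 1 else 0)"
      using True by (simp add: step_1 field_simps)
  qed
next
  case False
  then show "\<forall>\<^sub>F m in sequentially. step (real m * t) = (if t > 0 then 1 else 0)"
    by (intro always_eventually) (simp add: step_0 mult_nonneg_nonpos)
qed

text \<open>Products of steep steps in the distances to the faces of a box are test functions that
  converge boundedly to the indicator of the box, so \<open>h\<close> integrates to zero over every
  box.\<close>

lemma fundamental_lemma:
  fixes h :: "real ^ 'n \<Rightarrow> real"
  assumes h: "loc_integrable h" and z: "\<And>\<phi>. test_function \<phi> \<Longrightarrow> (\<integral>x. h x * \<phi> x \<partial>lebesgue) = 0"
  shows "AE x in lebesgue. h x = 0"
proof -
  note hm = loc_integrable_measurable[OF h]
  have boxz: "(\<integral>x. indicator (box l u) x * h x \<partial>lebesgue) = 0" for l u :: "real ^ 'n"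
  proof -
    define \<phi> where "\<phi> m x = (\<Prod>i\<in>UNIV. step (real m * (x $ i - l $ i)) * step (real m * (u $ i - x $ i)))" for m and x :: "real ^ 'n"
    have es: "\<phi> m \<in> elem_smooth" for m
    proof -
      have "(\<lambda>x. step (real m * x $ i + (- real m * l $ i)) * step ((- real m) * x $ i + real m * u $ i)) \<in> elem_smooth" for i
        by (intro elem_smooth.mult step_coord_elem_smooth)
      then have "(\<lambda>x. step (real m * (x $ i - l $ i)) * step (real m * (u $ i - x $ i))) \<in> elem_smooth" for i
        by (simp add: algebra_simps)
      then show ?thesis unfolding \<phi>_def[abs_def] by (intro elem_smooth_prod)
    qed
    have sup: "\<phi> m x = 0" if "x \<notin> cbox l u" for m x
    proof -
      from that obtain i where "x $ i < l $ i \<or> u $ i < x $ i" by (auto simp: mem_box_cart not_le)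
      then have "step (real m * (x $ i - l $ i)) * step (real m * (u $ i - x $ i)) = 0"
        by (auto intro!: step_0 mult_nonneg_nonpos)
      then show ?thesis unfolding \<phi>_def by (intro prod_zero) auto
    qed
    have tf: "test_function (\<phi> m)" for m by (rule test_functionI[OF es sup])
    have b: "0 \<le> \<phi> m x" "\<phi> m x \<le> 1" for m x
      unfolding \<phi>_def by (auto intro!: prod_nonneg prod_le_1 mult_nonneg_nonneg mult_le_one step_nonneg step_le_1)
    have lim: "(\<lambda>m. \<phi> m x) \<longlonglongrightarrow> indicator (box l u) x" for x
    proof -
      have "(\<lambda>m. \<phi> m x) \<longlonglongrightarrow> (\<Prod>i\<in>UNIV. (if x $ i - l $ i > 0 then 1 else 0) * (if u $ i - x $ i > 0 then 1 else 0))"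
        unfolding \<phi>_def by (intro tendsto_prod tendsto_mult step_tendsto_indicator)
      also have "(\<Prod>i\<in>UNIV. (if x $ i - l $ i > 0 then 1 else 0) * (if u $ i - x $ i > 0 then 1 else 0)) = (indicator (box l u) x :: real)"
      proof (cases "x \<in> box l u")
        case True
        then show ?thesis by (auto simp: mem_box_cart intro!: prod.neutral)
      next
        case False
        then obtain i where "\<not> (x $ i - l $ i > 0) \<or> \<not> (u $ i - x $ i > 0)" by (auto simp: mem_box_cart)
        then have "(if x $ i - l $ i > 0 then 1 else 0) * (if u $ i - x $ i > 0 then 1 else 0) = (0 :: real)" by auto
        then have ex: "\<exists>i\<in>UNIV. (if x $ i - l $ i > 0 then 1 else 0) * (if u $ i - x $ i > 0 then 1 else 0) = (0 :: real)" by blast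
        have "(\<Prod>i\<in>UNIV. (if x $ i - l $ i > 0 then 1 else 0) * (if u $ i - x $ i > 0 then 1 else 0)) = (0 :: real)"
          by (rule prod_zero[OF _ ex]) simp
        then show ?thesis using False by simp
      qed
      finally show ?thesis .
    qed
    have "(\<lambda>m. \<integral>x. h x * \<phi> m x \<partial>lebesgue) \<longlonglongrightarrow> (\<integral>x. h x * indicator (box l u) x \<partial>lebesgue)"
    proof (rule integral_dominated_convergence)
      have "indicator (box l u) \<in> borel_measurable (lebesgue :: (real^'n) measure)"
        by (intro borel_measurable_indicator fmeasurableD lmeasurable_box)
      then show "(\<lambda>x. h x * indicator (box l u) x) \<in> borel_measurable lebesgue"
        using hm by (intro borel_measurable_times)
      show "(\<lambda>x. h x * \<phi> m x) \<in> borel_measurable lebesgue" for m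
        using hm test_function_bounded(2)[OF tf] by (intro borel_measurable_times)
      show "integrable lebesgue (\<lambda>x. \<bar>indicator (cbox l u) x * h x\<bar>)"
        by (intro integrable_abs loc_integrable_cbox h)
      show "AE x in lebesgue. (\<lambda>m. h x * \<phi> m x) \<longlonglongrightarrow> h x * indicator (box l u) x"
        by (intro always_eventually allI tendsto_intros lim)
      show "AE x in lebesgue. norm (h x * \<phi> m x) \<le> \<bar>indicator (cbox l u) x * h x\<bar>" for m
      proof (intro always_eventually allI)
        fix x
        show "norm (h x * \<phi> m x) \<le> \<bar>indicator (cbox l u) x * h x\<bar>"
        proof (cases "x \<in> cbox l u")
          case True
          have "\<bar>h x\<bar> * \<bar>\<phi> m x\<bar> \<le> \<bar>h x\<bar> * 1" using b[of m x] by (intro mult_left_mono) auto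
          then show ?thesis using True by (simp add: abs_mult)
        qed (simp add: sup)
      qed
    qed
    moreover have "(\<integral>x. h x * \<phi> m x \<partial>lebesgue) = 0" for m by (rule z[OF tf])
    ultimately show ?thesis by (simp add: LIMSEQ_const_iff mult.commute)
  qed
  \<comment> \<open>\<open>AE_zero_of_boxes\<close> asks for global integrability, so
    \<open>h\<close> is cut off on an exhausting sequence of boxes; the countably many null sets are
    united afterwards.\<close>
  have "AE x in lebesgue. x \<in> box (\<chi> i. - real N) (\<chi> i. real N) \<longrightarrow> h x = 0" for N
  proof -
    let ?S = "box (\<chi> i. - real N) (\<chi> i. real N) :: (real ^ 'n) set"
    have i: "integrable lebesgue (\<lambda>x. indicator ?S x * h x)"
    proof (rule Bochner_Integration.integrable_bound[OF loc_integrable_cbox[OF h]])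
      have "indicator ?S \<in> borel_measurable lebesgue"
        by (intro borel_measurable_indicator fmeasurableD lmeasurable_box)
      then show "(\<lambda>x. indicator ?S x * h x) \<in> borel_measurable lebesgue"
        using hm by (intro borel_measurable_times)
      show "AE x in lebesgue. norm (indicator ?S x * h x) \<le> norm (indicator (cbox (\<chi> i. - real N) (\<chi> i. real N)) x * h x)"
        using box_subset_cbox by (intro always_eventually) (auto simp: indicator_def)
    qed
    have "AE x in lebesgue. indicator ?S x * h x = 0"
    proof (rule AE_zero_of_boxes[OF i])
      fix l u :: "real ^ 'n" assume "box l u \<subseteq> ?S"
      then have "(\<lambda>x. indicator (box l u) x * (indicator ?S x * h x)) = (\<lambda>x. indicator (box l u) x * h x)"
        by (auto simp: indicator_def fun_eq_iff)
      then show "(\<integral>x. indicator (box l u) x * (indicator ?S x * h x) \<partial>lebesgue) = 0" using boxz by simp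
    qed simp
    then show ?thesis by eventually_elim (auto simp: indicator_def)
  qed
  then have "AE x in lebesgue. \<forall>N. x \<in> box (\<chi> i. - real N) (\<chi> i. real N) \<longrightarrow> h x = 0"
    by (subst AE_all_countable) auto
  then show ?thesis
  proof eventually_elim
    case (elim x)
    obtain N where N: "norm x < real N" using reals_Archimedean2 by blast
    have "\<bar>x $ i\<bar> < real N" for i using component_le_norm_cart[of x i] N by linarith
    then have "x \<in> box (\<chi> i. - real N) (\<chi> i. real N)"
      by (auto simp: mem_box_cart abs_less_iff minus_less_iff)
    with elim show ?case by blast
  qed
qed

section \<open>Uniqueness and linearity of weak derivatives\<close>

lemma loc_integrable_diff:
  "loc_integrable u \<Longrightarrow> loc_integrable v \<Longrightarrow> loc_integrable (\<lambda>x. u x - v x)"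
  by (auto simp: loc_integrable_def intro: set_integral_diff(1))

lemma loc_integrable_add:
  "loc_integrable u \<Longrightarrow> loc_integrable v \<Longrightarrow> loc_integrable (\<lambda>x. u x + v x)"
  by (auto simp: loc_integrable_def intro: set_integral_add(1))

lemma loc_integrable_cmult:
  "loc_integrable u \<Longrightarrow> loc_integrable (\<lambda>x. c * u x)"
  by (auto simp: loc_integrable_def)

lemma loc_integrable_times_bounded:
  fixes u :: "real ^ 'n \<Rightarrow> real"
  assumes "loc_integrable u" "\<phi> \<in> borel_measurable lebesgue" "\<And>x. \<bar>\<phi> x\<bar> \<le> K" "\<And>x. x \<notin> cube N \<Longrightarrow> \<phi> x = 0"
  shows "integrable lebesgue (\<lambda>x. u x * \<phi> x)"
proof (rule Bochner_Integration.integrable_bound)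
  let ?B = "cbox (\<chi> i. - real N) (\<chi> i. real N) :: (real ^ 'n) set"
  show "integrable lebesgue (\<lambda>x. K * (indicator ?B x * u x))"
    using loc_integrable_cbox[OF assms(1)] by (intro integrable_mult_right)
  show "(\<lambda>x. u x * \<phi> x) \<in> borel_measurable lebesgue"
    using assms loc_integrable_measurable by (intro borel_measurable_times) auto
  show "AE x in lebesgue. norm (u x * \<phi> x) \<le> norm (K * (indicator ?B x * u x))"
  proof (intro always_eventually allI)
    fix x
    show "norm (u x * \<phi> x) \<le> norm (K * (indicator ?B x * u x))"
    proof (cases "x \<in> cube N")
      case True
      then have "x \<in> ?B" by (auto simp: cube_def mem_box_cart less_imp_le)
      moreover have "\<bar>u x\<bar> * \<bar>\<phi> x\<bar> \<le> \<bar>u x\<bar> * \<bar>K\<bar>"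
        using assms(3)[of x] by (intro mult_left_mono) auto
      ultimately show ?thesis by (simp add: abs_mult mult.commute)
    qed (simp add: assms(4))
  qed
qed

lemma loc_integrable_test:
  fixes u :: "real ^ 'n \<Rightarrow> real"
  assumes u: "loc_integrable u" and t: "test_function \<phi>"
  shows "integrable lebesgue (\<lambda>x. u x * \<phi> x)" "integrable lebesgue (\<lambda>x. u x * partial_deriv i \<phi> x)"
  using test_function_bounded[OF t] loc_integrable_times_bounded[OF u] by metis+

lemma has_weak_partial_unique:
  assumes "has_weak_partial i u g" "has_weak_partial i u g'"
  shows "AE x in lebesgue. g x = g' x"
proof -
  have l: "loc_integrable g" "loc_integrable g'" using assms by (auto simp: has_weak_partial_def)
  have "AE x in lebesgue. g x - g' x = 0"
  proof (rule fundamental_lemma[OF loc_integrable_diff[OF l]])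
    fix \<phi> :: "real^'a \<Rightarrow> real" assume t: "test_function \<phi>"
    have "(\<integral>x. g x * \<phi> x \<partial>lebesgue) = (\<integral>x. g' x * \<phi> x \<partial>lebesgue)"
      using assms t unfolding has_weak_partial_def by (metis neg_equal_iff_equal)
    then show "(\<integral>x. (g x - g' x) * \<phi> x \<partial>lebesgue) = 0"
      using loc_integrable_test(1)[OF l(1) t] loc_integrable_test(1)[OF l(2) t]
      by (simp add: left_diff_distrib)
  qed
  then show ?thesis by simp
qed

text \<open>This makes the choice behind \<open>weak_partial\<close> harmless: any explicitly known
  derivative may be substituted for it, at the price of working almost everywhere.\<close>

lemma weak_partial_eq:
  assumes "has_weak_partial i u g"
  shows "has_weak_partial i u (weak_partial i u)" "AE x in lebesgue. weak_partial i u x = g x"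
proof -
  show "has_weak_partial i u (weak_partial i u)"
    unfolding weak_partial_def by (rule someI[of "has_weak_partial i u", OF assms])
  then show "AE x in lebesgue. weak_partial i u x = g x"
    using has_weak_partial_unique assms by blast
qed

lemma has_weak_partial_add:
  assumes "has_weak_partial i u g" "has_weak_partial i v h"
  shows "has_weak_partial i (\<lambda>x. u x + v x) (\<lambda>x. g x + h x)"
  using assms unfolding has_weak_partial_def
  by (auto simp: loc_integrable_add distrib_right loc_integrable_test)

lemma has_weak_partial_cmult:
  assumes "has_weak_partial i u g"
  shows "has_weak_partial i (\<lambda>x. c * u x) (\<lambda>x. c * g x)"
  using assms unfolding has_weak_partial_def
  by (auto simp: loc_integrable_cmult mult.assoc)

lemma smooth_loc_integrable:
  assumes "continuous_on UNIV (u :: real ^ 'n \<Rightarrow> real)" shows "loc_integrable u"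
  unfolding loc_integrable_def
proof (intro allI impI)
  fix K :: "(real ^ 'n) set" assume "compact K"
  then obtain l where "K \<subseteq> cbox (- l) l" using bounded_subset_cbox_symmetric[OF compact_imp_bounded] by blast
  moreover have "u absolutely_integrable_on cbox (- l) l"
    by (rule absolutely_integrable_continuous[OF continuous_on_subset[OF assms]]) auto
  moreover have "K \<in> sets lebesgue" using \<open>compact K\<close> by (intro fmeasurableD lmeasurable_compact)
  ultimately show "u absolutely_integrable_on K" by (meson set_integrable_subset)
qed

lemma smooth_has_weak_partial:
  assumes "smooth u" shows "has_weak_partial i u (partial_deriv i u)"
  unfolding has_weak_partial_def
  by (intro conjI allI impI smooth_integration_by_parts smooth_loc_integrable smooth_continuous smooth_partial assms)

section \<open>Periodic functions and their weak derivatives\<close>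

lemma L2_per_iff: "u \<in> L2_per \<longleftrightarrow> u \<in> borel_measurable lebesgue \<and> ae_periodic u \<and> sqint cellM u"
  by (auto simp: L2_per_def sqint_def cellM_measurable)

lemma L2_norm_eq: "L2_norm u = l2n cellM u"
  by (simp add: L2_norm_def l2n_def)

lemma sqint_cell_integrable:
  fixes u :: "real ^ 'n \<Rightarrow> real"
  assumes "sqint cellM u" shows "integrable cellM u"
proof -
  have "sqint cellM (\<lambda>x. 1 :: real)" using finite_cellM by (auto intro: sqint_bounded[of _ _ 1])
  from sqint_mult_integrable[OF assms this] show ?thesis by simp
qed

lemma ae_periodic_compose2:
  assumes "ae_periodic u" "ae_periodic v" shows "ae_periodic (\<lambda>x. f (u x) (v x))"
  unfolding ae_periodic_def
proof
  fix i
  from assms have "AE x in lebesgue. u (x + axis i 1) = u x" "AE x in lebesgue. v (x + axis i 1) = v x"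
    by (auto simp: ae_periodic_def)
  then show "AE x in lebesgue. f (u (x + axis i 1)) (v (x + axis i 1)) = f (u x) (v x)" by eventually_elim simp
qed

lemma ae_periodic_compose: "ae_periodic u \<Longrightarrow> ae_periodic (\<lambda>x. f (u x))"
  using ae_periodic_compose2[of u u "\<lambda>a b. f a"] by simp

lemma L2_per_add: "u \<in> L2_per \<Longrightarrow> v \<in> L2_per \<Longrightarrow> (\<lambda>x. u x + v x) \<in> L2_per"
  by (auto simp: L2_per_iff intro: sqint_add ae_periodic_compose2)

lemma L2_per_diff: "u \<in> L2_per \<Longrightarrow> v \<in> L2_per \<Longrightarrow> (\<lambda>x. u x - v x) \<in> L2_per"
  by (auto simp: L2_per_iff intro: sqint_diff ae_periodic_compose2)

lemma L2_per_scaleR: "u \<in> L2_per \<Longrightarrow> (\<lambda>x. c *\<^sub>R u x) \<in> L2_per"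
  by (auto simp: L2_per_iff intro: sqint_scaleR ae_periodic_compose)

lemma L2_per_cmult: "(u :: real ^ 'n \<Rightarrow> real) \<in> L2_per \<Longrightarrow> (\<lambda>x. c * u x) \<in> L2_per"
  using L2_per_scaleR[of u c] by simp

lemma L2_per_const: "(\<lambda>x. c) \<in> L2_per"
  by (auto simp: L2_per_iff ae_periodic_def intro: sqint_bounded[OF finite_cellM, of _ "norm c"])

lemma L2_per_sum:
  "(\<And>i. i \<in> I \<Longrightarrow> u i \<in> L2_per) \<Longrightarrow> (\<lambda>x. \<Sum>i\<in>I. u i x) \<in> L2_per"
  by (induct I rule: infinite_finite_induct) (auto intro: L2_per_const L2_per_add)

lemma ae_periodic_cong:
  assumes "ae_periodic u" "AE x in lebesgue. u x = v x" shows "ae_periodic v"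
  unfolding ae_periodic_def
proof
  fix i
  have "AE x in lebesgue. u (x + axis i 1) = u x" using assms by (simp add: ae_periodic_def)
  with assms(2) AE_translate[OF assms(2), of "axis i 1"]
  show "AE x in lebesgue. v (x + axis i 1) = v x" by eventually_elim metis
qed

lemma L2_per_cong:
  assumes "u \<in> L2_per" "AE x in lebesgue. u x = v x" "v \<in> borel_measurable lebesgue"
  shows "v \<in> L2_per"
  using assms sqint_cong_AE[of cellM u v, OF _ cellM_measurable cellM_AE]
  by (auto simp: L2_per_iff intro: ae_periodic_cong)

lemma L2_per_test:
  fixes u \<phi> :: "real ^ 'n \<Rightarrow> real"
  assumes u: "u \<in> L2_per" and p: "\<phi> \<in> borel_measurable lebesgue" "\<And>x. \<bar>\<phi> x\<bar> \<le> K" "\<And>x. x \<notin> cube N \<Longrightarrow> \<phi> x = 0"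
  shows "integrable lebesgue (\<lambda>x. u x * \<phi> x)"
    "(\<integral>x. u x * \<phi> x \<partial>lebesgue) = (\<integral>x. u x * (\<Sum>k\<in>cube_shifts N. \<phi> (x + shift k)) \<partial>cellM)"
  using periodic_test_unfold[OF _ _ _ p, of u] u sqint_cell_integrable by (auto simp: L2_per_iff)

text \<open>Unfolding, with the indicator of \<open>K\<close> in the role of the test
  function.\<close>

lemma L2_per_loc_integrable:
  fixes u :: "real ^ 'n \<Rightarrow> real"
  assumes u: "u \<in> L2_per" shows "loc_integrable u"
  unfolding loc_integrable_def
proof (intro allI impI)
  fix K :: "(real ^ 'n) set" assume K: "compact K"
  then obtain N where N: "K \<subseteq> cube N" using bounded_subset_cube compact_imp_bounded by blast
  have "integrable lebesgue (\<lambda>x. u x * indicator K x)"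
  proof (rule L2_per_test(1)[OF u, of _ 1 N])
    show "indicator K \<in> borel_measurable lebesgue"
      using K by (intro borel_measurable_indicator fmeasurableD lmeasurable_compact)
  qed (use N in \<open>auto simp: indicator_def\<close>)
  then show "u absolutely_integrable_on K" by (simp add: set_integrable_def mult.commute)
qed

text \<open>The periodization of \<open>\<phi>\<close> is a finite sum of bounded functions, hence
  square integrable on the cell. Integrals over the space are therefore continuous in the norm of
  the cell alone.\<close>

lemma L2_per_test_tendsto:
  fixes u :: "real ^ 'n \<Rightarrow> real"
  assumes un: "\<And>n. un n \<in> L2_per" and u: "u \<in> L2_per"
    and l: "(\<lambda>n. l2n cellM (\<lambda>x. un n x - u x)) \<longlonglongrightarrow> 0"
    and p: "\<phi> \<in> borel_measurable lebesgue" "\<And>x. \<bar>\<phi> x\<bar> \<le> K" "\<And>x. x \<notin> cube N \<Longrightarrow> \<phi> x = 0"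
  shows "(\<lambda>n. \<integral>x. un n x * \<phi> x \<partial>lebesgue) \<longlonglongrightarrow> (\<integral>x. u x * \<phi> x \<partial>lebesgue)"
proof -
  let ?P = "\<lambda>x. \<Sum>k\<in>cube_shifts N. \<phi> (x + shift k)"
  have P: "sqint cellM ?P"
  proof (intro sqint_sum)
    fix k :: "'n \<Rightarrow> int"
    show "sqint cellM (\<lambda>x. \<phi> (x + shift k))"
      using p by (intro sqint_bounded[of _ _ K]) (auto intro: finite_cellM cellM_measurable borel_measurable_translate)
  qed
  have "(\<lambda>n. l2ip cellM (un n) ?P) \<longlonglongrightarrow> l2ip cellM u ?P"
    using un u l P by (intro l2ip_tendsto) (auto simp: L2_per_iff l2n_def)
  moreover have "(\<integral>x. un n x * \<phi> x \<partial>lebesgue) = l2ip cellM (un n) ?P" for n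
    using L2_per_test(2)[OF un p] by (simp add: l2ip_def)
  moreover have "(\<integral>x. u x * \<phi> x \<partial>lebesgue) = l2ip cellM u ?P"
    using L2_per_test(2)[OF u p] by (simp add: l2ip_def)
  ultimately show ?thesis by simp
qed

text \<open>Both sides of the defining identity are continuous under convergence on the cell. This
  is what turns limits of Sobolev fields into Sobolev fields in the completeness proof.\<close>

lemma has_weak_partial_closed:
  fixes u g :: "real ^ 'n \<Rightarrow> real"
  assumes un: "\<And>n. un n \<in> L2_per" "\<And>n. gn n \<in> L2_per" "\<And>n. has_weak_partial i (un n) (gn n)"
    and u: "u \<in> L2_per" "g \<in> L2_per"
    and l: "(\<lambda>n. l2n cellM (\<lambda>x. un n x - u x)) \<longlonglongrightarrow> 0" "(\<lambda>n. l2n cellM (\<lambda>x. gn n x - g x)) \<longlonglongrightarrow> 0"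
  shows "has_weak_partial i u g"
  unfolding has_weak_partial_def
proof (intro conjI allI impI L2_per_loc_integrable u)
  fix \<phi> :: "real ^ 'n \<Rightarrow> real" assume t: "test_function \<phi>"
  note b = test_function_bounded(1,2)[OF t] test_function_bounded(3,4,5)[OF t, where i=i]
  obtain K1 where K1: "\<And>x. \<bar>\<phi> x\<bar> \<le> K1" using b(1) by blast
  obtain K2 where K2: "\<And>x. \<bar>partial_deriv i \<phi> x\<bar> \<le> K2" using b(3) by blast
  obtain N where N: "\<And>x. x \<notin> cube N \<Longrightarrow> \<phi> x = 0" "\<And>x. x \<notin> cube N \<Longrightarrow> partial_deriv i \<phi> x = 0"
    using b(5) by blast
  have "(\<lambda>n. \<integral>x. un n x * partial_deriv i \<phi> x \<partial>lebesgue) \<longlonglongrightarrow> (\<integral>x. u x * partial_deriv i \<phi> x \<partial>lebesgue)"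
    by (rule L2_per_test_tendsto[OF un(1) u(1) l(1) b(4) K2 N(2)])
  moreover have "(\<lambda>n. - (\<integral>x. gn n x * \<phi> x \<partial>lebesgue)) \<longlonglongrightarrow> - (\<integral>x. g x * \<phi> x \<partial>lebesgue)"
    by (intro tendsto_minus L2_per_test_tendsto[OF un(2) u(2) l(2) b(2) K1 N(1)])
  moreover have "(\<integral>x. un n x * partial_deriv i \<phi> x \<partial>lebesgue) = - (\<integral>x. gn n x * \<phi> x \<partial>lebesgue)" for n
    using un(3)[of n] t by (auto simp: has_weak_partial_def)
  ultimately show "(\<integral>x. u x * partial_deriv i \<phi> x \<partial>lebesgue) = - (\<integral>x. g x * \<phi> x \<partial>lebesgue)"
    using LIMSEQ_unique by simp
qed

section \<open>A partition of unity and periodic test functions\<close>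

definition partition_fun :: "real ^ 'n \<Rightarrow> real" where
  "partition_fun x = (\<Prod>i\<in>UNIV. step (x $ i + 1) - step (x $ i))"

lemma partition_fun_smooth: "partition_fun \<in> elem_smooth"
proof -
  have "(\<lambda>x :: real ^ 'n. step (x $ i + 1) - step (x $ i)) \<in> elem_smooth" for i
    using elem_smooth_diff[OF step_coord_elem_smooth[of 1 i 1] step_coord_elem_smooth[of 1 i 0]] by simp
  then show ?thesis unfolding partition_fun_def[abs_def] by (intro elem_smooth_prod)
qed

lemma partition_fun_support:
  assumes "\<not> (\<forall>i. -1 \<le> x $ i \<and> x $ i < 1)" shows "partition_fun x = 0"
proof -
  from assms obtain i where "x $ i < -1 \<or> x $ i \<ge> 1" by (auto simp: not_le not_less)
  then have "step (x $ i + 1) - step (x $ i) = 0" by (auto simp: step_0 step_1)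
  then have ex: "\<exists>i\<in>UNIV. step (x $ i + 1) - step (x $ i) = 0" by blast
  show ?thesis unfolding partition_fun_def by (rule prod_zero[OF _ ex]) simp
qed

text \<open>Each factor \<open>step (t + 1) - step t\<close> is a bump whose integer translates
  telescope, and distributivity turns the sum over \<open>k\<close> into a product of
  one-dimensional sums. For \<open>0 < t < 1\<close> the offsets from -2 to 1 leave
  \<open>step (t + 2) - step (t - 2) = 1\<close>.\<close>

lemma partition_fun_sum:
  assumes "x \<in> unit_cell"
  shows "(\<Sum>k\<in>cube_shifts 2. partition_fun (x + shift k)) = 1"
proof -
  have "(\<Sum>k\<in>cube_shifts 2. partition_fun (x + shift k)) =
      (\<Sum>k\<in>PiE UNIV (\<lambda>_. {-2..<2}). \<Prod>i\<in>UNIV. step (x $ i + real_of_int (k i) + 1) - step (x $ i + real_of_int (k i)))"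
    by (simp add: cube_shifts_def partition_fun_def)
  also have "\<dots> = (\<Prod>i\<in>UNIV. \<Sum>m\<in>{-2..<2::int}. step (x $ i + real_of_int m + 1) - step (x $ i + real_of_int m))"
    by (rule prod_sum_PiE[symmetric]) auto
  also have "\<dots> = (\<Prod>i\<in>(UNIV :: 'a set). 1)"
  proof (rule prod.cong[OF refl])
    fix i :: 'a
    have "{-2..<2::int} = {-2, -1, 0, 1}" by auto
    moreover have "0 < x $ i" "x $ i < 1" using assms by (auto simp: unit_cell_def)
    ultimately show "(\<Sum>m\<in>{-2..<2::int}. step (x $ i + real_of_int m + 1) - step (x $ i + real_of_int m)) = 1"
      by (simp add: step_0 step_1)
  qed
  finally show ?thesis by simp
qed

text \<open>Periodicity at every point, in contrast to \<open>ae_periodic\<close>: the sums of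
  translates below must agree pointwise before they can be differentiated.\<close>

definition periodic :: "(real ^ 'n \<Rightarrow> 'b) \<Rightarrow> bool" where
  "periodic e \<longleftrightarrow> (\<forall>k x. e (x + shift k) = e x)"

text \<open>Multiplying \<open>e\<close> by a partition of unity yields a test function whose integer translates sum
  to \<open>e\<close>.\<close>

lemma cell_integration_by_parts:
  fixes u g e :: "real ^ 'n \<Rightarrow> real"
  assumes u: "u \<in> L2_per" and g: "g \<in> L2_per" and w: "has_weak_partial i u g"
    and e: "e \<in> elem_smooth" "periodic e"
  shows "(\<integral>x. u x * partial_deriv i e x \<partial>cellM) = - (\<integral>x. g x * e x \<partial>cellM)"
proof -
  define \<phi> where "\<phi> x = e x * partition_fun x" for x
  have es: "\<phi> \<in> elem_smooth" unfolding \<phi>_def[abs_def] by (intro elem_smooth.mult e partition_fun_smooth)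
  have z: "\<phi> x = 0" if "x \<notin> cbox (\<chi> i. -1) (\<chi> i. 1)" for x
  proof -
    have "\<not> (\<forall>i. -1 \<le> x $ i \<and> x $ i < 1)" using that less_imp_le unfolding mem_box_cart by fastforce
    then show ?thesis by (simp add: \<phi>_def partition_fun_support)
  qed
  have t: "test_function \<phi>"
    by (rule test_functionI[OF es z])
  note b = test_function_bounded(1,2)[OF t] test_function_bounded(3,4,5)[OF t, where i=i]
  obtain K1 where K1: "\<And>x. \<bar>\<phi> x\<bar> \<le> K1" using b(1) by blast
  obtain K2 where K2: "\<And>x. \<bar>partial_deriv i \<phi> x\<bar> \<le> K2" using b(3) by blast
  \<comment> \<open>The function \<open>\<phi>\<close> vanishes off the closed box with half side 1.
    The larger \<open>cube 2\<close> ensures that a point outside it has a whole neighbourhood where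
    \<open>\<phi>\<close> is zero, so the derivative vanishes there too.\<close>
  have m: "x \<in> - cbox (\<chi> i. -1) (\<chi> i. 1)" if "x \<notin> cube 2" for x :: "real ^ 'n"
  proof (rule ccontr)
    assume "\<not> ?thesis"
    then have b: "-1 \<le> x $ i \<and> x $ i \<le> 1" for i by (auto simp: mem_box_cart)
    have "- real 2 \<le> x $ i \<and> x $ i < real 2" for i using b[of i] by auto
    then show False using that by (simp add: cube_def)
  qed
  have N1: "\<phi> x = 0" if "x \<notin> cube 2" for x using z m[OF that] by simp
  have N2: "partial_deriv i \<phi> x = 0" if "x \<notin> cube 2" for x
  proof -
    have o: "open (- cbox (\<chi> i. -1) (\<chi> i. 1) :: (real^'n) set)" by (intro open_Compl closed_cbox)
    have "partial_deriv i \<phi> x = partial_deriv i (\<lambda>x. 0) x"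
      by (rule partial_deriv_cong_open[OF o m[OF that]])
         (auto intro: z)
    then show ?thesis by (simp add: partial_deriv_const)
  qed
  have S: "(\<Sum>k\<in>cube_shifts 2. \<phi> (x + shift k)) = e x" if "x \<in> unit_cell" for x
    using partition_fun_sum[OF that] e(2) by (simp add: \<phi>_def periodic_def flip: sum_distrib_left)
  have d: "(\<lambda>x. \<phi> (x + shift k)) differentiable (at x)" for k x
    by (rule partial_deriv_translate(2)) (rule elem_smooth_partial(2)[OF es])
  have S': "(\<Sum>k\<in>cube_shifts 2. partial_deriv i \<phi> (x + shift k)) = partial_deriv i e x" if "x \<in> unit_cell" for x
  proof -
    \<comment> \<open>The identity \<open>S\<close> holds on an open set, hence can be
      differentiated there.\<close>
    have o: "open (unit_cell :: (real ^ 'n) set)" unfolding unit_cell_box by (rule open_box)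
    have "(\<Sum>k\<in>cube_shifts 2. partial_deriv i \<phi> (x + shift k)) = (\<Sum>k\<in>cube_shifts 2. partial_deriv i (\<lambda>x. \<phi> (x + shift k)) x)"
      using elem_smooth_partial(2)[OF es] by (intro sum.cong refl partial_deriv_translate(1)[symmetric])
    also have "\<dots> = partial_deriv i (\<lambda>x. \<Sum>k\<in>cube_shifts 2. \<phi> (x + shift k)) x"
      using d by (intro partial_deriv_sum[symmetric])
    also have "\<dots> = partial_deriv i e x"
      using that S elem_smooth_partial(2)[OF e(1)] by (intro partial_deriv_cong_open[OF o]) auto
    finally show ?thesis .
  qed
  have "(\<integral>x. u x * partial_deriv i \<phi> x \<partial>lebesgue) = - (\<integral>x. g x * \<phi> x \<partial>lebesgue)"
    using w t by (simp add: has_weak_partial_def)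
  moreover have "(\<integral>x. u x * partial_deriv i \<phi> x \<partial>lebesgue) = (\<integral>x. u x * partial_deriv i e x \<partial>cellM)"
    by (subst L2_per_test(2)[OF u b(4) K2, of 2], erule N2, rule Bochner_Integration.integral_cong) (simp_all add: S')
  moreover have "(\<integral>x. g x * \<phi> x \<partial>lebesgue) = (\<integral>x. g x * e x \<partial>cellM)"
    by (subst L2_per_test(2)[OF g b(2) K1, of 2], erule N1, rule Bochner_Integration.integral_cong) (simp_all add: S)
  ultimately show ?thesis by simp
qed

section \<open>Fourier series\<close>

definition freq :: "('n::finite \<Rightarrow> int) \<Rightarrow> real ^ 'n" where
  "freq k = (\<chi> i. 2 * pi * of_int (k i))"

text \<open>Real modes are indexed by all integer vectors, so \<open>k\<close> and
  \<open>- k\<close> give the same function up to sign. For nonzero \<open>k\<close> a mode has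
  squared norm 1/2; in a sum over a symmetric index set every pair occurs twice, which supplies the
  missing factor 2, so that \<open>fsum\<close> carries no normalising constants.\<close>

definition cosm :: "('n::finite \<Rightarrow> int) \<Rightarrow> real ^ 'n \<Rightarrow> real" where
  "cosm k x = cos (freq k \<bullet> x)"

definition sinm :: "('n::finite \<Rightarrow> int) \<Rightarrow> real ^ 'n \<Rightarrow> real" where
  "sinm k x = sin (freq k \<bullet> x)"

lemma freq_nth [simp]: "freq k $ i = 2 * pi * of_int (k i)"
  by (simp add: freq_def)

lemma freq_add: "freq (\<lambda>i. k i + l i) = freq k + freq l"
  by (simp add: vec_eq_iff algebra_simps)

lemma freq_diff: "freq (\<lambda>i. k i - l i) = freq k - freq l"
  by (simp add: vec_eq_iff algebra_simps)

lemma freq_uminus: "freq (\<lambda>i. - k i) = - freq k"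
  by (simp add: vec_eq_iff)

lemma cosm_elem_smooth: "cosm k \<in> elem_smooth"
  using elem_smooth.cos[of "freq k" 0] by (simp add: cosm_def[abs_def])

lemma sinm_elem_smooth: "sinm k \<in> elem_smooth"
  using elem_smooth.cos[of "freq k" "- pi / 2"] by (simp add: sinm_def[abs_def] cos_diff)

lemma freq_shift: "\<exists>n::int. freq k \<bullet> shift m = 2 * pi * of_int n"
  by (rule exI[of _ "\<Sum>i\<in>UNIV. k i * m i"]) (simp add: inner_vec_def sum_distrib_left mult_ac)

lemma cosm_periodic: "periodic (cosm k)" and sinm_periodic: "periodic (sinm k)"
proof -
  have "cos (freq k \<bullet> shift m) = 1 \<and> sin (freq k \<bullet> shift m) = 0" for m
    using freq_shift[of k m] cos_int_2pin sin_int_2pin by auto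
  then show "periodic (cosm k)" "periodic (sinm k)"
    by (simp_all add: periodic_def cosm_def sinm_def inner_add_right cos_add sin_add)
qed

lemma cosm_partial: "partial_deriv i (cosm k) x = - freq k $ i * sinm k x"
proof -
  have "(cosm k has_derivative (\<lambda>h. - sin (freq k \<bullet> x) * (freq k \<bullet> h))) (at x)"
    unfolding cosm_def[abs_def] by (auto intro!: derivative_eq_intros)
  from partial_deriv_eq[OF this, of i] show ?thesis by (simp add: sinm_def inner_axis)
qed

lemma sinm_partial: "partial_deriv i (sinm k) x = freq k $ i * cosm k x"
proof -
  have "(sinm k has_derivative (\<lambda>h. cos (freq k \<bullet> x) * (freq k \<bullet> h))) (at x)"
    unfolding sinm_def[abs_def] by (auto intro!: derivative_eq_intros)
  from partial_deriv_eq[OF this, of i] show ?thesis by (simp add: cosm_def inner_axis)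
qed

lemma periodic_ae_periodic: "periodic e \<Longrightarrow> ae_periodic e"
proof -
  assume p: "periodic e"
  have "e (x + axis i 1) = e x" for i x
  proof -
    have "shift (\<lambda>j. if j = i then 1 else 0) = (axis i 1 :: real ^ 'a)"
      by (auto simp: vec_eq_iff axis_def)
    then show ?thesis using p unfolding periodic_def by metis
  qed
  then show ?thesis by (simp add: ae_periodic_def)
qed

lemma bounded_periodic_L2:
  fixes e :: "real ^ 'n \<Rightarrow> real"
  assumes "e \<in> elem_smooth" "periodic e" "\<And>x. \<bar>e x\<bar> \<le> K"
  shows "e \<in> L2_per"
  unfolding L2_per_iff using assms smooth_measurable[OF elem_smooth_smooth[OF assms(1)]] periodic_ae_periodic
  by (auto intro!: sqint_bounded[of _ _ K] finite_cellM cellM_measurable)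

lemma cosm_L2: "cosm k \<in> L2_per" and sinm_L2: "sinm k \<in> L2_per"
  by (rule bounded_periodic_L2[OF cosm_elem_smooth cosm_periodic, of _ 1], simp add: cosm_def)
     (rule bounded_periodic_L2[OF sinm_elem_smooth sinm_periodic, of _ 1], simp add: sinm_def)

lemma cosm_sqint: "sqint cellM (cosm k)" and sinm_sqint: "sqint cellM (sinm k)"
  using cosm_L2 sinm_L2 by (auto simp: L2_per_iff)

text \<open>Integration by parts against the constant 1, whose weak derivative is zero.\<close>

lemma integral_periodic_partial:
  assumes "e \<in> elem_smooth" "periodic e"
  shows "(\<integral>x. partial_deriv i e x \<partial>cellM) = 0"
proof -
  have "has_weak_partial i (\<lambda>x. 1 :: real) (partial_deriv i (\<lambda>x. 1))"
    by (intro smooth_has_weak_partial elem_smooth_smooth elem_smooth.const)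
  then have w: "has_weak_partial i (\<lambda>x. 1 :: real) (\<lambda>x. 0)" by (simp add: partial_deriv_const[abs_def])
  from cell_integration_by_parts[OF L2_per_const L2_per_const w assms] show ?thesis by simp
qed

text \<open>If \<open>k i \<noteq> 0\<close>, the mode is a multiple of the partial derivative in
  direction \<open>i\<close> of the corresponding sine, which integrates to zero over a
  period.\<close>

lemma integral_cosm: "(\<integral>x. cosm k x \<partial>cellM) = (if k = (\<lambda>_. 0) then 1 else 0)"
proof (cases "k = (\<lambda>_. 0)")
  case True
  then have "cosm k = (\<lambda>x. 1)" by (simp add: cosm_def fun_eq_iff inner_vec_def)
  then show ?thesis using True by simp
next
  case False
  then obtain i where "k i \<noteq> 0" by auto
  moreover have "freq k $ i * (\<integral>x. cosm k x \<partial>cellM) = 0"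
    using integral_periodic_partial[OF sinm_elem_smooth sinm_periodic, of i k] by (simp add: sinm_partial)
  ultimately show ?thesis using False by simp
qed

lemma integral_sinm: "(\<integral>x. sinm k x \<partial>cellM) = 0"
proof (cases "k = (\<lambda>_. 0)")
  case True
  then show ?thesis by (simp add: sinm_def inner_vec_def)
next
  case False
  then obtain i where "k i \<noteq> 0" by auto
  moreover have "freq k $ i * (\<integral>x. sinm k x \<partial>cellM) = 0"
    using integral_periodic_partial[OF cosm_elem_smooth cosm_periodic, of i k] by (simp add: cosm_partial)
  ultimately show ?thesis by simp
qed

lemma cosm_cosm: "cosm k x * cosm l x = (cosm (\<lambda>i. k i - l i) x + cosm (\<lambda>i. k i + l i) x) / 2"
  and sinm_sinm: "sinm k x * sinm l x = (cosm (\<lambda>i. k i - l i) x - cosm (\<lambda>i. k i + l i) x) / 2"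
  and sinm_cosm: "sinm k x * cosm l x = (sinm (\<lambda>i. k i + l i) x + sinm (\<lambda>i. k i - l i) x) / 2"
  by (simp_all add: cosm_def sinm_def freq_add freq_diff inner_add_left inner_diff_left
      cos_times_cos sin_times_sin sin_times_cos)

lemma cosm_integrable: "integrable cellM (cosm k)" and sinm_integrable: "integrable cellM (sinm k)"
  by (intro sqint_cell_integrable cosm_sqint sinm_sqint)+

lemma diff_zero_fun: "(\<lambda>i. k i - l i) = (\<lambda>_. 0) \<longleftrightarrow> k = (l :: _ \<Rightarrow> int)"
  and add_zero_fun: "(\<lambda>i. k i + l i) = (\<lambda>_. 0) \<longleftrightarrow> k = (\<lambda>i. - l i :: int)"
  by (auto simp: fun_eq_iff eq_neg_iff_add_eq_0)

text \<open>Product formulas reduce everything to integrals of single modes. The second Kronecker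
  symbol records the coincidence of \<open>k\<close> with \<open>- l\<close>; at
  \<open>k = l = 0\<close> both are active, giving norm 1 for the constant and 0 for the
  sine.\<close>

lemma l2ip_cosm_cosm: "l2ip cellM (cosm k) (cosm l) = ((if k = l then 1 else 0) + (if k = (\<lambda>i. - l i) then 1 else 0)) / 2"
  and l2ip_sinm_sinm: "l2ip cellM (sinm k) (sinm l) = ((if k = l then 1 else 0) - (if k = (\<lambda>i. - l i) then 1 else 0)) / 2"
  and l2ip_sinm_cosm: "l2ip cellM (sinm k) (cosm l) = 0"
  by (simp_all add: l2ip_def cosm_cosm sinm_sinm sinm_cosm integral_cosm integral_sinm cosm_integrable sinm_integrable diff_zero_fun add_zero_fun)

definition cosc :: "(real ^ 'n \<Rightarrow> real) \<Rightarrow> ('n::finite \<Rightarrow> int) \<Rightarrow> real" where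
  "cosc u k = l2ip cellM u (cosm k)"

definition sinc :: "(real ^ 'n \<Rightarrow> real) \<Rightarrow> ('n::finite \<Rightarrow> int) \<Rightarrow> real" where
  "sinc u k = l2ip cellM u (sinm k)"

definition modes :: "nat \<Rightarrow> ('n::finite \<Rightarrow> int) set" where
  "modes N = {k. \<forall>i. \<bar>k i\<bar> \<le> int N}"

definition fsum :: "nat \<Rightarrow> (real ^ 'n \<Rightarrow> real) \<Rightarrow> real ^ 'n \<Rightarrow> real" where
  "fsum N u x = (\<Sum>k\<in>modes N. cosc u k * cosm k x + sinc u k * sinm k x)"

lemma finite_modes [simp]: "finite (modes N :: ('n::finite \<Rightarrow> int) set)"
proof -
  have "modes N = (PiE UNIV (\<lambda>_. {- int N..int N}) :: ('n \<Rightarrow> int) set)"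
  proof -
    have "\<bar>a\<bar> \<le> int N \<longleftrightarrow> a \<in> {- int N..int N}" for a by (simp add: abs_le_iff) linarith
    then show ?thesis unfolding modes_def PiE_UNIV_domain Pi_def by simp
  qed
  then show ?thesis by (simp add: finite_PiE)
qed

lemma modes_uminus [simp]: "(\<lambda>i. - k i) \<in> modes N \<longleftrightarrow> k \<in> modes N"
  by (simp add: modes_def)

lemma modes_mono: "M \<le> N \<Longrightarrow> modes M \<subseteq> modes N"
  unfolding modes_def using of_nat_mono[of M N, where 'a=int] by (auto intro: order_trans)

lemma modes_ex: "\<exists>N. (k :: 'n::finite \<Rightarrow> int) \<in> modes N"
proof (intro exI)
  show "k \<in> modes (nat (\<Sum>i\<in>UNIV. \<bar>k i\<bar>))"
    unfolding modes_def by (auto simp: sum_nonneg intro: member_le_sum)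
qed

lemma cosm_uminus: "cosm (\<lambda>i. - k i) = cosm k" and sinm_uminus: "sinm (\<lambda>i. - k i) = (\<lambda>x. - sinm k x)"
  by (auto simp: cosm_def sinm_def freq_uminus fun_eq_iff)

lemma cosc_uminus: "cosc u (\<lambda>i. - k i) = cosc u k" and sinc_uminus: "sinc u (\<lambda>i. - k i) = - sinc u k"
  by (auto simp: cosc_def sinc_def cosm_uminus sinm_uminus l2ip_def)

lemma fsum_L2: "fsum N u \<in> L2_per"
  unfolding fsum_def[abs_def]
  by (intro L2_per_sum L2_per_add L2_per_cmult cosm_L2 sinm_L2)

lemma fsum_sqint: "sqint cellM (fsum N u)"
  using fsum_L2 by (auto simp: L2_per_iff)

lemma l2ip_fsum:
  assumes "sqint cellM w"
  shows "l2ip cellM (fsum N u) w = (\<Sum>k\<in>modes N. cosc u k * cosc w k + sinc u k * sinc w k)"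
proof -
  have i: "integrable cellM (\<lambda>x. cosm k x * w x)" "integrable cellM (\<lambda>x. sinm k x * w x)" for k
    by (intro sqint_mult_integrable cosm_sqint sinm_sqint assms)+
  have "l2ip cellM (fsum N u) w = (\<integral>x. (\<Sum>k\<in>modes N. cosc u k * (cosm k x * w x) + sinc u k * (sinm k x * w x)) \<partial>cellM)"
    by (simp add: l2ip_def fsum_def sum_distrib_right distrib_right mult.assoc)
  also have "\<dots> = (\<Sum>k\<in>modes N. cosc u k * (\<integral>x. cosm k x * w x \<partial>cellM) + sinc u k * (\<integral>x. sinm k x * w x \<partial>cellM))"
    using i by simp
  finally show ?thesis by (simp add: cosc_def sinc_def l2ip_def mult.commute)
qed

text \<open>The terms \<open>k = l\<close> and \<open>k = - l\<close> contribute one half each; for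
  \<open>l = 0\<close> they are one and the same term, which contributes both halves.\<close>

lemma cosc_fsum: "cosc (fsum N u) l = (if l \<in> modes N then cosc u l else 0)"
proof -
  have s: "sinc (cosm l) k = 0" for k by (simp add: sinc_def l2ip_commute[of _ "cosm l"] l2ip_sinm_cosm)
  have c: "cosc (cosm l) k = ((if k = l then 1 else 0) + (if k = (\<lambda>i. - l i) then 1 else 0)) / 2" for k
    by (simp add: cosc_def l2ip_commute[of _ "cosm l"] l2ip_cosm_cosm)
  have "cosc (fsum N u) l = (\<Sum>k\<in>modes N. (if k = l then cosc u l / 2 else 0) + (if k = (\<lambda>i. - l i) then cosc u l / 2 else 0))"
    unfolding cosc_def[of "fsum N u"] l2ip_fsum[OF cosm_sqint] s c
    by (intro sum.cong refl) (auto simp: cosc_uminus)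
  then show ?thesis by (simp add: sum.distrib)
qed

lemma sinc_fsum: "sinc (fsum N u) l = (if l \<in> modes N then sinc u l else 0)"
proof -
  have c: "cosc (sinm l) k = 0" for k by (simp add: cosc_def l2ip_sinm_cosm)
  have s: "sinc (sinm l) k = ((if k = l then 1 else 0) - (if k = (\<lambda>i. - l i) then 1 else 0)) / 2" for k
    by (simp add: sinc_def l2ip_commute[of _ "sinm l"] l2ip_sinm_sinm)
  \<comment> \<open>If \<open>l = - l\<close>, the two Kronecker symbols cancel; the formula
    survives because the odd coefficient is then zero.\<close>
  have z: "sinc u l = 0" if "(\<lambda>i. - l i) = l" using sinc_uminus[of u l] that by simp
  have "sinc (fsum N u) l = (\<Sum>k\<in>modes N. (if k = l then sinc u l / 2 else 0) + (if k = (\<lambda>i. - l i) then sinc u l / 2 else 0))"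
    unfolding sinc_def[of "fsum N u"] l2ip_fsum[OF sinm_sqint] s c
    by (intro sum.cong refl) (auto simp: sinc_uminus z)
  then show ?thesis by (simp add: sum.distrib)
qed

section \<open>Trigonometric polynomials and completeness of the modes\<close>

inductive_set trig :: "(real ^ 'n \<Rightarrow> real) set" where
  cosm: "cosm k \<in> trig"
| sinm: "sinm k \<in> trig"
| add: "f \<in> trig \<Longrightarrow> g \<in> trig \<Longrightarrow> (\<lambda>x. f x + g x) \<in> trig"
| cmult: "f \<in> trig \<Longrightarrow> (\<lambda>x. c * f x) \<in> trig"

lemma trig_sqint: "f \<in> trig \<Longrightarrow> sqint cellM f"
  by (induct rule: trig.induct) (auto intro: cosm_sqint sinm_sqint sqint_add sqint_cmult)

lemma trig_const: "(\<lambda>x :: real ^ 'n. c) \<in> trig"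
proof -
  have "cosm (\<lambda>_ :: 'n. 0) = (\<lambda>x. 1)" by (simp add: cosm_def fun_eq_iff inner_vec_def)
  then show ?thesis using trig.cmult[OF trig.cosm[of "\<lambda>_ :: 'n. 0"], of c] by simp
qed

text \<open>Product-to-sum formulas; by linearity they make the trigonometric polynomials an
  algebra.\<close>

lemma trig_mult_basis:
  assumes "f \<in> trig" shows "(\<lambda>x. f x * cosm l x) \<in> trig \<and> (\<lambda>x. f x * sinm l x) \<in> trig"
  using assms
proof induct
  case (cosm k)
  have "(\<lambda>x. (1/2) * cosm (\<lambda>i. k i - l i) x + (1/2) * cosm (\<lambda>i. k i + l i) x) \<in> trig"
    "(\<lambda>x. (1/2) * sinm (\<lambda>i. l i + k i) x + (1/2) * sinm (\<lambda>i. l i - k i) x) \<in> trig"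
    by (intro trig.intros)+
  then show ?case by (simp add: cosm_cosm mult.commute[of "cosm k _" "sinm l _"] sinm_cosm add_divide_distrib)
next
  case (sinm k)
  have "(\<lambda>x. (1/2) * sinm (\<lambda>i. k i + l i) x + (1/2) * sinm (\<lambda>i. k i - l i) x) \<in> trig"
    "(\<lambda>x. (1/2) * cosm (\<lambda>i. k i - l i) x + (-1/2) * cosm (\<lambda>i. k i + l i) x) \<in> trig"
    by (intro trig.intros)+
  then show ?case by (simp add: sinm_cosm sinm_sinm add_divide_distrib diff_divide_distrib)
next
  case (add f g)
  then show ?case by (simp add: distrib_right trig.add)
next
  case (cmult f c)
  then show ?case by (simp add: mult.assoc trig.cmult)
qed

lemma trig_mult:
  assumes "f \<in> trig" "g \<in> trig" shows "(\<lambda>x. f x * g x) \<in> trig"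
  using assms(2)
proof induct
  case (add g h)
  then show ?case by (simp add: distrib_left trig.add)
next
  case (cmult g c)
  then show ?case using trig.cmult[of "\<lambda>x. f x * g x" c] by (simp add: mult.left_commute)
qed (use trig_mult_basis[OF assms(1)] in auto)

lemma trig_prod: "(\<And>i. i \<in> I \<Longrightarrow> f i \<in> trig) \<Longrightarrow> (\<lambda>x. \<Prod>i\<in>I. f i x) \<in> trig"
  by (induct I rule: infinite_finite_induct) (auto intro: trig_const trig_mult)

lemma trig_polynomial:
  assumes "real_polynomial_function p" "f \<in> trig"
  shows "(\<lambda>x. p (f x :: real)) \<in> trig"
  using assms(1)
proof induct
  case (linear p)
  then have "p y = p 1 * y" for y
    using linear_cmul[OF bounded_linear.linear[OF linear], of y 1] by simp
  then have "(\<lambda>x. p (f x)) = (\<lambda>x. p 1 * f x)" by (intro ext)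
  then show ?case using trig.cmult[OF assms(2), of "p 1"] by (simp only:)
qed (auto intro: trig_const trig.add trig_mult)

lemma trig_coord: "(\<lambda>x. cos (2 * pi * (x $ i - c))) \<in> trig"
proof -
  let ?k = "\<lambda>j. if j = i then 1 else 0 :: int"
  have "freq ?k \<bullet> x = 2 * pi * x $ i" for x
    by (simp add: inner_vec_def if_distrib[of of_int] if_distrib[of "\<lambda>z. _ * z * _"] cong: if_cong)
  then have "(\<lambda>x. cos (2 * pi * (x $ i - c))) = (\<lambda>x. cos (2 * pi * c) * cosm ?k x + sin (2 * pi * c) * sinm ?k x)"
    by (simp add: cosm_def sinm_def fun_eq_iff right_diff_distrib cos_diff)
  then show ?thesis by (simp add: trig.intros)
qed

text \<open>Within one period an interval is a superlevel set of the cosine centred at its midpoint,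
  since that cosine decreases with the distance \<open>t\<close> from the centre as long as
  \<open>t\<close> is at most 1/2.\<close>

lemma cos_window:
  fixes x l u :: real
  assumes "0 \<le> l" "l < u" "u \<le> 1" "0 < x" "x < 1"
  shows "cos (2 * pi * (x - (l + u) / 2)) > cos (pi * (u - l)) \<longleftrightarrow> l < x \<and> x < u"
proof -
  define t where "t = \<bar>x - (l + u) / 2\<bar>"
  define w where "w = (u - l) / 2"
  have w: "0 < w" "w \<le> 1/2" using assms by (auto simp: w_def)
  \<comment> \<open>The upper bound matters when \<open>t\<close> exceeds 1/2: the reflected
    distance \<open>1 - t\<close> is then still larger than \<open>w\<close>, so such points are not
    mistaken for inner ones.\<close>
  have tw: "0 \<le> t" "t < 1 - w" using assms by (auto simp: t_def w_def abs_if field_simps)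
  have iff: "l < x \<and> x < u \<longleftrightarrow> t < w" by (auto simp: t_def w_def abs_if field_simps)
  have ct: "cos (2 * pi * (x - (l + u) / 2)) = cos (2 * pi * t)"
  proof (cases "x - (l + u) / 2 \<ge> 0")
    case False
    then have "2 * pi * (x - (l + u) / 2) = - (2 * pi * t)" by (simp add: t_def field_simps)
    then show ?thesis by (simp only: cos_minus)
  qed (simp add: t_def)
  have cw: "cos (pi * (u - l)) = cos (2 * pi * w)" by (simp add: w_def)
  have mono: "cos (2 * pi * a) > cos (2 * pi * b) \<longleftrightarrow> a < b" if "0 \<le> a" "a \<le> 1/2" "0 \<le> b" "b \<le> 1/2" for a b
    using that by (subst cos_mono_less_eq) (auto simp: mult_left_le)
  show ?thesis
  proof (cases "t \<le> 1/2")
    case True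
    then show ?thesis unfolding iff ct cw using mono[of t w] w tw by simp
  next
    case False
    have "2 * pi * t = 2 * pi - 2 * pi * (1 - t)" by (simp add: algebra_simps)
    then have "cos (2 * pi * t) = cos (2 * pi * (1 - t))"
      by (metis cos_2pi_minus)
    then show ?thesis unfolding iff ct cw using mono[of "1 - t" w] w tw False by simp
  qed
qed

text \<open>Ramps of slope \<open>m\<close> starting at \<open>\<kappa>\<close> are approximated on
  \<open>[-1, 1]\<close> by Weierstrass polynomials with error \<open>1 / (m + 1)\<close>; the bound
  2 is the height of the ramp plus this error. The ramps vanish at \<open>\<kappa>\<close> itself,
  which fits the strict inequalities of an open box.\<close>

lemma polynomial_step:
  fixes \<kappa> :: real
  shows "\<exists>p. (\<forall>m. real_polynomial_function (p m)) \<and> (\<forall>m y. \<bar>y\<bar> \<le> 1 \<longrightarrow> \<bar>p m y\<bar> \<le> (2::real))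
     \<and> (\<forall>y. \<bar>y\<bar> \<le> 1 \<longrightarrow> (\<lambda>m. p m y) \<longlonglongrightarrow> (if y > \<kappa> then 1 else 0))"
proof -
  define F where "F m y = min 1 (max 0 (real m * (y - \<kappa>)))" for m y
  have "\<exists>p. real_polynomial_function p \<and> (\<forall>y\<in>{-1..1}. \<bar>F m y - p y\<bar> < 1 / real (Suc m))" for m
  proof -
    have "continuous_on {-1..1} (F m)" unfolding F_def by (intro continuous_intros)
    from Stone_Weierstrass_real_polynomial_function[OF compact_Icc this, of "1 / real (Suc m)"]
    show ?thesis by (metis of_nat_0_less_iff zero_less_Suc zero_less_divide_1_iff)
  qed
  then obtain p where p: "\<And>m. real_polynomial_function (p m)" "\<And>m y. y \<in> {-1..1} \<Longrightarrow> \<bar>F m y - p m y\<bar> < 1 / real (Suc m)"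
    by metis
  have "\<bar>p m y\<bar> \<le> 2" if "\<bar>y\<bar> \<le> 1" for m y
  proof -
    have "\<bar>F m y\<bar> \<le> 1" by (simp add: F_def min_def max_def)
    moreover have "\<bar>F m y - p m y\<bar> < 1 / real (Suc m)" using that by (intro p) (auto simp: abs_le_iff)
    moreover have "1 / real (Suc m) \<le> 1" by simp
    ultimately show ?thesis by linarith
  qed
  moreover have "(\<lambda>m. p m y) \<longlonglongrightarrow> (if y > \<kappa> then 1 else 0)" if "\<bar>y\<bar> \<le> 1" for y
  proof -
    have "(\<lambda>m. F m y) \<longlonglongrightarrow> (if y > \<kappa> then 1 else 0)"
    proof (cases "y > \<kappa>")
      case True
      obtain M where M: "1 / (y - \<kappa>) < real M" using reals_Archimedean2 by blast
      have "F m y = 1" if "m \<ge> M" for m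
      proof -
        have "1 / (y - \<kappa>) \<le> real m" using M that by simp
        then have "1 \<le> real m * (y - \<kappa>)" using True by (simp add: field_simps)
        then show ?thesis by (simp add: F_def)
      qed
      then show ?thesis using True by (intro tendsto_eventually eventually_sequentiallyI[of M]) auto
    next
      case False
      then have "F m y = 0" for m by (simp add: F_def mult_nonneg_nonpos)
      then show ?thesis using False by simp
    qed
    moreover have "(\<lambda>m. F m y - p m y) \<longlonglongrightarrow> 0"
    proof (rule Lim_null_comparison)
      show "\<forall>\<^sub>F m in sequentially. norm (F m y - p m y) \<le> 1 / real (Suc m)"
        using p(2)[of y] that by (intro always_eventually allI) (auto simp: abs_le_iff[of y] intro: less_imp_le)
      show "(\<lambda>m. 1 / real (Suc m)) \<longlonglongrightarrow> 0" by (rule LIMSEQ_Suc[OF lim_1_over_n])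
    qed
    ultimately have "(\<lambda>m. F m y - (F m y - p m y)) \<longlonglongrightarrow> (if y > \<kappa> then 1 else 0) - 0" by (rule tendsto_diff)
    then show ?thesis by simp
  qed
  ultimately show ?thesis using p(1) by blast
qed

text \<open>Products of polynomials in \<open>cos (2 \<pi> (x\<^sub>i - c\<^sub>i))\<close> are trigonometric polynomials and converge
  boundedly to the indicator function of any box in the cell, so that \<open>v\<close> integrates to zero
  over all boxes.\<close>

lemma trig_complete:
  fixes v :: "real ^ 'n \<Rightarrow> real"
  assumes v: "sqint cellM v" and z: "\<And>k. cosc v k = 0" "\<And>k. sinc v k = 0"
  shows "AE x in cellM. v x = 0"
proof -
  have trig0: "l2ip cellM f v = 0" if "f \<in> trig" for f
    using that
  proof induct
    case (add f g)
    then show ?case using l2ip_add_left[OF trig_sqint trig_sqint v] by simp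
  next
    case (cmult f c)
    then show ?case using l2ip_scaleR_left[of cellM c f v] by simp
  qed (use z in \<open>auto simp: cosc_def sinc_def l2ip_commute[of _ v]\<close>)
  have vi: "integrable cellM v" by (rule sqint_cell_integrable[OF v])
  have main: "(\<integral>x. indicator (box l u) x * v x \<partial>cellM) = 0" if sub: "box l u \<subseteq> unit_cell" for l u :: "real ^ 'n"
  proof (cases "box l u = {}")
    case True
    then show ?thesis by simp
  next
    case False
    then have lu: "l $ i < u $ i" for i by (auto simp: interval_eq_empty_cart not_le)
    have "l $ i \<ge> 0 \<and> u $ i \<le> 1" for i
      using sub False unfolding unit_cell_box by (subst (asm) subset_interval_cart) (auto simp: lu less_imp_le)
    then have lu': "l $ i \<ge> 0" "u $ i \<le> 1" for i by auto
    have "\<exists>p. \<forall>i. (\<forall>m. real_polynomial_function (p i m)) \<and> (\<forall>m y. \<bar>y\<bar> \<le> 1 \<longrightarrow> \<bar>p i m y\<bar> \<le> (2::real))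
     \<and> (\<forall>y. \<bar>y\<bar> \<le> 1 \<longrightarrow> (\<lambda>m. p i m y) \<longlonglongrightarrow> (if y > cos (pi * (u $ i - l $ i)) then 1 else 0))"
      by (rule choice) (intro allI polynomial_step)
    then obtain p where p: "\<And>i m. real_polynomial_function (p i m)" "\<And>i m y. \<bar>y\<bar> \<le> 1 \<Longrightarrow> \<bar>p i m y\<bar> \<le> (2::real)"
     "\<And>i y. \<bar>y\<bar> \<le> 1 \<Longrightarrow> (\<lambda>m. p i m y) \<longlonglongrightarrow> (if y > cos (pi * (u $ i - l $ i)) then 1 else 0)" by blast
    define G where "G m x = (\<Prod>i\<in>UNIV. p i m (cos (2 * pi * (x $ i - (l $ i + u $ i) / 2))))" for m and x :: "real ^ 'n"
    have Gt: "G m \<in> trig" for m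
    proof -
      have "(\<lambda>x. p i m (cos (2 * pi * (x $ i - (l $ i + u $ i) / 2)))) \<in> trig" for i
        by (rule trig_polynomial[OF p(1) trig_coord])
      then show ?thesis unfolding G_def[abs_def] by (intro trig_prod)
    qed
    have Gb: "\<bar>G m x\<bar> \<le> 2 ^ CARD('n)" for m x
    proof -
      have "\<bar>G m x\<bar> = (\<Prod>i\<in>UNIV. \<bar>p i m (cos (2 * pi * (x $ i - (l $ i + u $ i) / 2)))\<bar>)"
        by (simp add: G_def abs_prod)
      also have "\<dots> \<le> (\<Prod>i\<in>(UNIV :: 'n set). 2)" by (intro prod_mono) (auto intro!: p)
      finally show ?thesis by simp
    qed
    have Gl: "(\<lambda>m. G m x) \<longlonglongrightarrow> indicator (box l u) x" if x: "x \<in> unit_cell" for x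
    proof -
      have "(\<lambda>m. G m x) \<longlonglongrightarrow> (\<Prod>i\<in>UNIV. if cos (2 * pi * (x $ i - (l $ i + u $ i) / 2)) > cos (pi * (u $ i - l $ i)) then 1 else 0)"
        unfolding G_def by (intro tendsto_prod p) simp
      also have "(\<Prod>i\<in>UNIV. if cos (2 * pi * (x $ i - (l $ i + u $ i) / 2)) > cos (pi * (u $ i - l $ i)) then 1 else 0)
          = (\<Prod>i\<in>UNIV. if l $ i < x $ i \<and> x $ i < u $ i then 1 else (0::real))"
        using x lu lu' by (intro prod.cong refl) (simp add: cos_window unit_cell_def)
      also have "\<dots> = indicator (box l u) x"
      proof (cases "x \<in> box l u")
        case True
        then show ?thesis by (auto simp: mem_box_cart intro!: prod.neutral)
      next
        case False
        then have ex: "\<exists>i\<in>UNIV. (if l $ i < x $ i \<and> x $ i < u $ i then 1 else (0::real)) = 0" by (auto simp: mem_box_cart)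
        have "(\<Prod>i\<in>UNIV. if l $ i < x $ i \<and> x $ i < u $ i then 1 else (0::real)) = 0" by (rule prod_zero[OF _ ex]) simp
        then show ?thesis using False by simp
      qed
      finally show ?thesis .
    qed
    have vm: "v \<in> borel_measurable cellM" using v by (simp add: sqint_def)
    have "(\<lambda>m. \<integral>x. G m x * v x \<partial>cellM) \<longlonglongrightarrow> (\<integral>x. indicator (box l u) x * v x \<partial>cellM)"
    proof (rule integral_dominated_convergence)
      have "indicator (box l u) \<in> borel_measurable (cellM :: (real ^ 'n) measure)"
        by (intro cellM_measurable borel_measurable_indicator fmeasurableD lmeasurable_box)
      then show "(\<lambda>x. indicator (box l u) x * v x) \<in> borel_measurable cellM" using vm by (intro borel_measurable_times)
      show "(\<lambda>x. G m x * v x) \<in> borel_measurable cellM" for m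
        using vm trig_sqint[OF Gt] by (intro borel_measurable_times) (auto simp: sqint_def)
      show "integrable cellM (\<lambda>x. 2 ^ CARD('n) * \<bar>v x\<bar>)" using vi by (intro integrable_mult_right integrable_abs)
      show "AE x in cellM. (\<lambda>m. G m x * v x) \<longlonglongrightarrow> indicator (box l u) x * v x"
        by (rule AE_I2) (auto intro!: tendsto_intros Gl)
      show "AE x in cellM. norm (G m x * v x) \<le> 2 ^ CARD('n) * \<bar>v x\<bar>" for m
        using Gb by (intro AE_I2) (auto simp: abs_mult intro!: mult_right_mono)
    qed
    moreover have "(\<integral>x. G m x * v x \<partial>cellM) = 0" for m
      using trig0[OF Gt] by (simp add: l2ip_def)
    ultimately show ?thesis by (simp add: LIMSEQ_const_iff)
  qed
  have "AE x in lebesgue. indicator unit_cell x * v x = 0"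
  proof (rule AE_zero_of_boxes[of _ 0 "\<chi> i. 1"])
    show "integrable lebesgue (\<lambda>x. indicator unit_cell x * v x)"
      using vi by (simp add: integrable_cellM_eq)
    fix l u :: "real ^ 'n" assume sub: "box l u \<subseteq> box 0 (\<chi> i. 1)"
    have "(\<integral>x. indicator (box l u) x * (indicator unit_cell x * v x) \<partial>lebesgue) = (\<integral>x. indicator (box l u) x * v x \<partial>cellM)"
      unfolding integral_cellM_eq by (intro Bochner_Integration.integral_cong refl) (simp add: mult_ac)
    then show "(\<integral>x. indicator (box l u) x * (indicator unit_cell x * v x) \<partial>lebesgue) = 0"
      using main sub by (simp add: unit_cell_box)
  qed (simp add: unit_cell_box)
  then have "AE x in lebesgue. x \<in> unit_cell \<longrightarrow> v x = 0" by eventually_elim (auto simp: indicator_def)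
  then show ?thesis by (subst AE_restrict_space_iff) auto
qed

section \<open>Convergence of Fourier series and Parseval's identity\<close>

lemma l2n_diff_square:
  assumes "sqint M f" "sqint M g"
  shows "(l2n M (\<lambda>x. f x - g x))\<^sup>2 = (l2n M f)\<^sup>2 - 2 * l2ip M f g + (l2n M g)\<^sup>2"
proof -
  have "(l2n M (\<lambda>x. f x + (- g x)))\<^sup>2 = (l2n M f)\<^sup>2 + 2 * l2ip M f (\<lambda>x. - g x) + (l2n M (\<lambda>x. - g x))\<^sup>2"
    by (intro l2n_add_square sqint_uminus assms)
  moreover have "l2ip M f (\<lambda>x. - g x) = - l2ip M f g" by (simp add: l2ip_def)
  ultimately show ?thesis by (simp add: l2n_uminus)
qed

text \<open>By orthogonality, squared distances of partial sums are differences of the sums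
  \<open>Q\<close> of squared coefficients, which are monotone and bounded by Bessel's inequality.
  The resulting limit \<open>w\<close> has the same coefficients as \<open>u\<close>, and
  \<open>trig_complete\<close> identifies the two.\<close>

lemma fsum_tendsto:
  fixes u :: "real ^ 'n \<Rightarrow> real"
  assumes u: "sqint cellM u"
  shows "(\<lambda>N. l2n cellM (\<lambda>x. fsum N u x - u x)) \<longlonglongrightarrow> 0"
proof -
  define Q where "Q N = (\<Sum>k\<in>modes N. (cosc u k)\<^sup>2 + (sinc u k)\<^sup>2)" for N
  have uf: "l2ip cellM (fsum N u) u = Q N" for N
    by (simp add: l2ip_fsum[OF u] Q_def power2_eq_square)
  have ff: "l2ip cellM (fsum M u) (fsum N u) = Q M" if "M \<le> N" for M N
    using modes_mono[OF that] unfolding l2ip_fsum[OF fsum_sqint] Q_def cosc_fsum sinc_fsum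
    by (intro sum.cong) (auto simp: power2_eq_square)
  have fn: "(l2n cellM (fsum N u))\<^sup>2 = Q N" for N using ff[of N N] by (simp add: l2ip_self)
  have fd: "(l2n cellM (\<lambda>x. fsum M u x - fsum N u x))\<^sup>2 = Q N - Q M" if "M \<le> N" for M N
    by (simp add: l2n_diff_square[OF fsum_sqint fsum_sqint] fn ff[OF that])
  have Qm: "Q M \<le> Q N" if "M \<le> N" for M N using fd[OF that] by (metis diff_ge_0_iff_ge zero_le_power2)
  have Qb: "Q N \<le> (l2n cellM u)\<^sup>2" for N
    using l2n_diff_square[OF fsum_sqint u, of N u] zero_le_power2[of "l2n cellM (\<lambda>x. fsum N u x - u x)"] by (simp add: fn uf)
  have "convergent Q"
    by (rule Bseq_mono_convergent[OF BseqI'[of Q "(l2n cellM u)\<^sup>2"]])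
       (use Qb Qm in \<open>auto simp: Q_def sum_nonneg\<close>)
  then have Qc: "Cauchy Q" by (rule convergent_Cauchy)
  have cau: "\<exists>N. \<forall>m\<ge>N. \<forall>n\<ge>N. l2n cellM (\<lambda>x. fsum m u x - fsum n u x) < e" if e: "e > 0" for e
  proof -
    obtain N where N: "\<And>m n. m \<ge> N \<Longrightarrow> n \<ge> N \<Longrightarrow> \<bar>Q m - Q n\<bar> < e\<^sup>2"
      using Qc e unfolding Cauchy_def dist_real_def by (metis zero_less_power)
    have *: "l2n cellM (\<lambda>x. fsum m u x - fsum n u x) < e" if "m \<ge> N" "n \<ge> m" for m n
    proof -
      have "(l2n cellM (\<lambda>x. fsum m u x - fsum n u x))\<^sup>2 < e\<^sup>2"
        using N[of n m] that by (simp add: fd abs_if split: if_splits)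
      then show ?thesis using e by (simp add: power2_less_imp_less)
    qed
    show ?thesis
    proof (intro exI allI impI)
      fix m n assume "N \<le> m" "N \<le> n"
      then show "l2n cellM (\<lambda>x. fsum m u x - fsum n u x) < e"
        using *[of m n] *[of n m] l2n_minus_commute[of cellM "fsum m u" "fsum n u"] by (cases "m \<le> n") auto
    qed
  qed
  obtain w where w: "sqint cellM w" "(\<lambda>n. l2n cellM (\<lambda>x. fsum n u x - w x)) \<longlonglongrightarrow> 0"
    using L2_complete[OF finite_cellM fsum_sqint cau] .
  have lim: "l2ip cellM w e = l2ip cellM u e" if e: "sqint cellM e"
    and ev: "\<forall>\<^sub>F n in sequentially. l2ip cellM (fsum n u) e = l2ip cellM u e" for e
  proof -
    have "(\<lambda>n. l2ip cellM (fsum n u) e) \<longlonglongrightarrow> l2ip cellM w e"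
      by (intro l2ip_tendsto fsum_sqint w e) (simp add: l2n_def)
    moreover have "(\<lambda>n. l2ip cellM (fsum n u) e) \<longlonglongrightarrow> l2ip cellM u e"
      by (rule tendsto_eventually[OF ev])
    ultimately show ?thesis by (rule LIMSEQ_unique)
  qed
  have ev: "\<forall>\<^sub>F n in sequentially. k \<in> modes n" for k :: "'n \<Rightarrow> int"
  proof -
    obtain M where "k \<in> modes M" using modes_ex by blast
    then show ?thesis by (intro eventually_sequentiallyI[of M]) (use modes_mono in blast)
  qed
  have "cosc w k = cosc u k" for k
    unfolding cosc_def
  proof (rule lim[OF cosm_sqint])
    show "\<forall>\<^sub>F n in sequentially. l2ip cellM (fsum n u) (cosm k) = l2ip cellM u (cosm k)"
      using ev[of k] by eventually_elim (simp add: cosc_fsum flip: cosc_def)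
  qed
  moreover have "sinc w k = sinc u k" for k
    unfolding sinc_def
  proof (rule lim[OF sinm_sqint])
    show "\<forall>\<^sub>F n in sequentially. l2ip cellM (fsum n u) (sinm k) = l2ip cellM u (sinm k)"
      using ev[of k] by eventually_elim (simp add: sinc_fsum flip: sinc_def)
  qed
  ultimately have "AE x in cellM. w x - u x = 0"
    using w u by (intro trig_complete sqint_diff)
      (auto simp: cosc_def sinc_def l2ip_diff_left cosm_sqint sinm_sqint)
  then have "l2n cellM (\<lambda>x. fsum n u x - w x) = l2n cellM (\<lambda>x. fsum n u x - u x)" for n
    by (intro l2n_cong_AE) (use w u fsum_sqint[of n u] in \<open>auto simp: sqint_def\<close>)
  then show ?thesis using w(2) by simp
qed

lemma Parseval:
  assumes "sqint cellM u" "sqint cellM v"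
  shows "(\<lambda>N. \<Sum>k\<in>modes N. cosc u k * cosc v k + sinc u k * sinc v k) \<longlonglongrightarrow> l2ip cellM u v"
proof -
  have "(\<lambda>N. l2ip cellM (fsum N u) v) \<longlonglongrightarrow> l2ip cellM u v"
    by (intro l2ip_tendsto fsum_sqint fsum_tendsto assms) (simp add: l2n_def)
  then show ?thesis by (simp add: l2ip_fsum[OF assms(2)])
qed

section \<open>Weak derivatives on the Fourier side\<close>

lemma weak_partial_coeff:
  assumes "u \<in> L2_per" "g \<in> L2_per" "has_weak_partial i u g"
  shows "cosc g k = freq k $ i * sinc u k" "sinc g k = - (freq k $ i * cosc u k)"
proof -
  have "(\<integral>x. u x * (freq k $ i * sinm k x) \<partial>cellM) = freq k $ i * (\<integral>x. u x * sinm k x \<partial>cellM)"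
    by (subst integral_mult_right_zero[symmetric]) (simp add: mult_ac)
  moreover have "(\<integral>x. u x * (freq k $ i * cosm k x) \<partial>cellM) = freq k $ i * (\<integral>x. u x * cosm k x \<partial>cellM)"
    by (subst integral_mult_right_zero[symmetric]) (simp add: mult_ac)
  ultimately show "cosc g k = freq k $ i * sinc u k" "sinc g k = - (freq k $ i * cosc u k)"
    using cell_integration_by_parts[OF assms cosm_elem_smooth cosm_periodic, of k]
      cell_integration_by_parts[OF assms sinm_elem_smooth sinm_periodic, of k]
    by (simp_all add: cosc_def sinc_def l2ip_def cosm_partial sinm_partial del: freq_nth)
qed

text \<open>The functions are only once weakly differentiable, so mixed second derivatives cannot be
  formed. On the Fourier side both products carry the same factor
  \<open>freq k $ i * freq k $ j\<close>, and Parseval's identity equates the integrals.\<close>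

lemma weak_partial_swap:
  assumes u: "u \<in> L2_per" "ui \<in> L2_per" "uj \<in> L2_per" "has_weak_partial i u ui" "has_weak_partial j u uj"
    and v: "v \<in> L2_per" "vi \<in> L2_per" "vj \<in> L2_per" "has_weak_partial i v vi" "has_weak_partial j v vj"
  shows "l2ip cellM ui vj = l2ip cellM uj vi"
proof -
  have s: "sqint cellM ui" "sqint cellM uj" "sqint cellM vi" "sqint cellM vj"
    using u v by (auto simp: L2_per_iff)
  have "cosc ui k * cosc vj k + sinc ui k * sinc vj k = cosc uj k * cosc vi k + sinc uj k * sinc vi k" for k
    by (simp add: weak_partial_coeff[OF u(1,2,4)] weak_partial_coeff[OF u(1,3,5)]
        weak_partial_coeff[OF v(1,2,4)] weak_partial_coeff[OF v(1,3,5)])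
  then show ?thesis
    using LIMSEQ_unique[OF Parseval[OF s(1,4)]] Parseval[OF s(2,3)] by simp
qed

text \<open>A nonzero integer vector has a frequency of length at least \<open>2 * pi\<close>, and
  the zero mode is absent because the mean vanishes. Parseval's identity then allows a comparison
  mode by mode.\<close>

lemma Poincare_periodic:
  fixes u :: "real ^ 'n \<Rightarrow> real"
  assumes u: "u \<in> L2_per" "(\<integral>x. u x \<partial>cellM) = 0"
    and g: "\<And>i. g i \<in> L2_per" "\<And>i. has_weak_partial i u (g i)"
  shows "(2 * pi)\<^sup>2 * (l2n cellM u)\<^sup>2 \<le> (\<Sum>i\<in>UNIV. (l2n cellM (g i))\<^sup>2)"
proof -
  have su: "sqint cellM u" and sg: "\<And>i. sqint cellM (g i)" using u g by (auto simp: L2_per_iff)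
  have l1: "(\<lambda>N. (2 * pi)\<^sup>2 * (\<Sum>k\<in>modes N. cosc u k * cosc u k + sinc u k * sinc u k)) \<longlonglongrightarrow> (2 * pi)\<^sup>2 * (l2n cellM u)\<^sup>2"
    unfolding l2ip_self[symmetric] by (intro tendsto_intros Parseval su)
  have l2: "(\<lambda>N. \<Sum>i\<in>UNIV. \<Sum>k\<in>modes N. cosc (g i) k * cosc (g i) k + sinc (g i) k * sinc (g i) k) \<longlonglongrightarrow> (\<Sum>i\<in>UNIV. (l2n cellM (g i))\<^sup>2)"
    unfolding l2ip_self[symmetric] by (intro tendsto_sum Parseval sg)
  show ?thesis
  proof (rule LIMSEQ_le[OF l1 l2], intro exI allI impI)
    fix N :: nat
    have "(2 * pi)\<^sup>2 * (\<Sum>k\<in>modes N. cosc u k * cosc u k + sinc u k * sinc u k)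
        = (\<Sum>k\<in>modes N. (2 * pi)\<^sup>2 * ((cosc u k)\<^sup>2 + (sinc u k)\<^sup>2))"
      by (simp add: sum_distrib_left power2_eq_square)
    also have "\<dots> \<le> (\<Sum>k\<in>modes N. \<Sum>i\<in>UNIV. cosc (g i) k * cosc (g i) k + sinc (g i) k * sinc (g i) k)"
    proof (rule sum_mono)
      fix k :: "'n \<Rightarrow> int"
      have eq: "(\<Sum>i\<in>UNIV. cosc (g i) k * cosc (g i) k + sinc (g i) k * sinc (g i) k)
          = (\<Sum>i\<in>UNIV. (freq k $ i)\<^sup>2) * ((cosc u k)\<^sup>2 + (sinc u k)\<^sup>2)"
        unfolding sum_distrib_right
        by (intro sum.cong refl) (simp add: weak_partial_coeff[OF u(1) g] power2_eq_square algebra_simps del: freq_nth)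
      show "(2 * pi)\<^sup>2 * ((cosc u k)\<^sup>2 + (sinc u k)\<^sup>2) \<le> (\<Sum>i\<in>UNIV. cosc (g i) k * cosc (g i) k + sinc (g i) k * sinc (g i) k)"
      proof (cases "k = (\<lambda>_. 0)")
        case True
        have "cosc u k = 0" "sinc u k = 0"
          using u(2) unfolding True cosc_def sinc_def l2ip_def cosm_def sinm_def by (simp_all add: inner_vec_def)
        then show ?thesis unfolding eq by simp
      next
        case False
        then obtain i where "k i \<noteq> 0" by auto
        then have "1 \<le> \<bar>k i\<bar>" by simp
        then have "1 \<le> (real_of_int (k i))\<^sup>2" using one_le_power[of "\<bar>real_of_int (k i)\<bar>" 2] by simp
        then have "(2 * pi)\<^sup>2 * 1 \<le> (2 * pi)\<^sup>2 * (real_of_int (k i))\<^sup>2" by (intro mult_left_mono) auto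
        also have "\<dots> = (freq k $ i)\<^sup>2" by (simp add: power_mult_distrib)
        also have "\<dots> \<le> (\<Sum>i\<in>UNIV. (freq k $ i)\<^sup>2)" by (rule member_le_sum) auto
        finally show ?thesis unfolding eq by (intro mult_right_mono) auto
      qed
    qed
    also have "\<dots> = (\<Sum>i\<in>UNIV. \<Sum>k\<in>modes N. cosc (g i) k * cosc (g i) k + sinc (g i) k * sinc (g i) k)"
      by (rule sum.swap)
    finally show "(2 * pi)\<^sup>2 * (\<Sum>k\<in>modes N. cosc u k * cosc u k + sinc u k * sinc u k)
      \<le> (\<Sum>i\<in>UNIV. \<Sum>k\<in>modes N. cosc (g i) k * cosc (g i) k + sinc (g i) k * sinc (g i) k)" .
  qed
qed

section \<open>Trigonometric potentials with prescribed Laplacian\<close>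

lemma trig_elem_smooth: "f \<in> trig \<Longrightarrow> f \<in> elem_smooth"
  by (induct rule: trig.induct) (auto intro: cosm_elem_smooth sinm_elem_smooth elem_smooth.add elem_smooth_cmult)

lemma trig_L2: "f \<in> trig \<Longrightarrow> f \<in> L2_per"
  by (induct rule: trig.induct) (auto intro: cosm_L2 sinm_L2 L2_per_add L2_per_cmult)

lemma trig_periodic: "f \<in> trig \<Longrightarrow> periodic f"
proof (induct rule: trig.induct)
  case (cosm k) show ?case by (rule cosm_periodic)
next
  case (sinm k) show ?case by (rule sinm_periodic)
qed (auto simp: periodic_def)

lemma trig_smooth: "f \<in> trig \<Longrightarrow> smooth f"
  by (intro elem_smooth_smooth trig_elem_smooth)

lemma trig_sum: "(\<And>k. k \<in> I \<Longrightarrow> f k \<in> trig) \<Longrightarrow> (\<lambda>x. \<Sum>k\<in>I. f k x) \<in> trig"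
  by (induct I rule: infinite_finite_induct) (auto intro: trig_const trig.add)

lemma cosm_partial_fun: "partial_deriv i (cosm k) = (\<lambda>x. - freq k $ i * sinm k x)"
  and sinm_partial_fun: "partial_deriv i (sinm k) = (\<lambda>x. freq k $ i * cosm k x)"
  by (simp_all add: fun_eq_iff cosm_partial sinm_partial)

lemma trig_partial_add:
  assumes "f \<in> trig" "g \<in> trig"
  shows "partial_deriv i (\<lambda>x. f x + g x) = (\<lambda>x. partial_deriv i f x + partial_deriv i g x)"
  using assms by (intro ext partial_deriv_add elem_smooth_partial trig_elem_smooth)

lemma trig_partial_cmult:
  assumes "f \<in> trig"
  shows "partial_deriv i (\<lambda>x. c * f x) = (\<lambda>x. c * partial_deriv i f x)"
  using assms by (intro ext partial_deriv_cmult elem_smooth_partial trig_elem_smooth)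

lemma trig_partial_sum:
  assumes "\<And>k. k \<in> I \<Longrightarrow> f k \<in> trig"
  shows "partial_deriv i (\<lambda>x. \<Sum>k\<in>I. f k x) = (\<lambda>x. \<Sum>k\<in>I. partial_deriv i (f k) x)"
  using assms by (intro ext partial_deriv_sum elem_smooth_partial trig_elem_smooth)

lemma trig_partial: "f \<in> trig \<Longrightarrow> partial_deriv i f \<in> trig"
proof (induct rule: trig.induct)
  case (cosm k) show ?case unfolding cosm_partial_fun by (intro trig.cmult trig.sinm)
next
  case (sinm k) show ?case unfolding sinm_partial_fun by (intro trig.cmult trig.cosm)
next
  case (add f g) then show ?case unfolding trig_partial_add[OF add(1,3)] by (intro trig.add)
next
  case (cmult f c) then show ?case unfolding trig_partial_cmult[OF cmult(1)] by (intro trig.cmult)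
qed

lemma trig_partial_commute: "f \<in> trig \<Longrightarrow> partial_deriv i (partial_deriv j f) = partial_deriv j (partial_deriv i f)"
proof (induct rule: trig.induct)
  case (cosm k)
  show ?case unfolding cosm_partial_fun trig_partial_cmult[OF trig.sinm] sinm_partial_fun by (simp add: mult_ac)
next
  case (sinm k)
  show ?case unfolding sinm_partial_fun trig_partial_cmult[OF trig.cosm] cosm_partial_fun by (simp add: mult_ac)
next
  case (add f g)
  then show ?case by (simp add: trig_partial_add trig_partial)
next
  case (cmult f c)
  then show ?case by (simp add: trig_partial_cmult trig_partial)
qed

text \<open>The summand for \<open>k = 0\<close> vanishes because \<open>x / 0 = 0\<close>.\<close>

definition inv_laplace :: "nat \<Rightarrow> (real ^ 'n \<Rightarrow> real) \<Rightarrow> real ^ 'n \<Rightarrow> real" where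
  "inv_laplace N s x = (\<Sum>k\<in>modes N. (- cosc s k / (freq k \<bullet> freq k)) * cosm k x + (- sinc s k / (freq k \<bullet> freq k)) * sinm k x)"

lemma inv_laplace_trig: "inv_laplace N s \<in> trig"
  unfolding inv_laplace_def[abs_def] by (intro trig_sum trig.intros)

text \<open>Differentiating twice multiplies a mode by minus the square of a frequency component, so
  the Laplacian cancels the division. Only the constant mode escapes this, and its coefficient is
  zero since \<open>s\<close> has mean zero.\<close>

lemma laplace_inv_laplace:
  fixes s :: "real ^ 'n \<Rightarrow> real"
  assumes s: "(\<integral>x. s x \<partial>cellM) = 0"
  shows "(\<Sum>i\<in>UNIV. partial_deriv i (partial_deriv i (inv_laplace N s)) x) = fsum N s x"
proof -
  have t: "(\<lambda>x. a * cosm k x) \<in> trig" "(\<lambda>x. b * sinm k x) \<in> trig" for a b and k :: "'n \<Rightarrow> int"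
    by (intro trig.intros)+
  have p1: "partial_deriv i (\<lambda>x. a * cosm k x + b * sinm k x) = (\<lambda>x. (b * freq k $ i) * cosm k x + (- (a * freq k $ i)) * sinm k x)"
    for a b i and k :: "'n \<Rightarrow> int"
    by (simp add: fun_eq_iff trig_partial_add t trig_partial_cmult trig.cosm trig.sinm cosm_partial_fun sinm_partial_fun del: freq_nth)
  have p2: "partial_deriv i (partial_deriv i (\<lambda>x. a * cosm k x + b * sinm k x)) = (\<lambda>x. - (freq k $ i)\<^sup>2 * (a * cosm k x + b * sinm k x))"
    for a b i and k :: "'n \<Rightarrow> int"
    unfolding p1 by (simp add: fun_eq_iff power2_eq_square algebra_simps del: freq_nth)
  have d: "partial_deriv i (partial_deriv i (inv_laplace N s)) x = (\<Sum>k\<in>modes N. - (freq k $ i)\<^sup>2 * ((- cosc s k / (freq k \<bullet> freq k)) * cosm k x + (- sinc s k / (freq k \<bullet> freq k)) * sinm k x))" for i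
  proof -
    have "partial_deriv i (partial_deriv i (\<lambda>x. \<Sum>k\<in>modes N. a k * cosm k x + b k * sinm k x)) =
        (\<lambda>x. \<Sum>k\<in>modes N. - (freq k $ i)\<^sup>2 * (a k * cosm k x + b k * sinm k x))" for a b
    proof -
      have tk: "(\<lambda>x. a k * cosm k x + b k * sinm k x) \<in> trig" for k by (intro trig.add t)
      show ?thesis
        by (subst trig_partial_sum, rule tk, subst trig_partial_sum, rule trig_partial[OF tk]) (simp only: p2)
    qed
    then show ?thesis unfolding inv_laplace_def[abs_def] by (rule fun_cong)
  qed
  have "(\<Sum>i\<in>UNIV. partial_deriv i (partial_deriv i (inv_laplace N s)) x)
      = (\<Sum>k\<in>modes N. \<Sum>i\<in>UNIV. - (freq k $ i)\<^sup>2 * ((- cosc s k / (freq k \<bullet> freq k)) * cosm k x + (- sinc s k / (freq k \<bullet> freq k)) * sinm k x))"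
    unfolding d by (rule sum.swap)
  also have "\<dots> = fsum N s x"
    unfolding fsum_def
  proof (rule sum.cong[OF refl])
    fix k :: "'n \<Rightarrow> int"
    let ?T = "(- cosc s k / (freq k \<bullet> freq k)) * cosm k x + (- sinc s k / (freq k \<bullet> freq k)) * sinm k x"
    have "(\<Sum>i\<in>UNIV. - (freq k $ i)\<^sup>2 * ?T) = - (freq k \<bullet> freq k) * ?T"
      by (simp add: inner_vec_def power2_eq_square sum_negf flip: sum_distrib_right del: freq_nth)
    also have "\<dots> = cosc s k * cosm k x + sinc s k * sinm k x"
    proof (cases "freq k = 0")
      case True
      then have "cosc s k = 0" "sinc s k = 0"
        using s by (simp_all add: cosc_def sinc_def l2ip_def cosm_def sinm_def)
      then show ?thesis by simp
    next
      case False
      then have "freq k \<bullet> freq k \<noteq> 0" by simp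
      then show ?thesis by (simp add: field_simps)
    qed
    finally show "(\<Sum>i\<in>UNIV. - (freq k $ i)\<^sup>2 * ?T) = cosc s k * cosm k x + sinc s k * sinm k x" .
  qed
  finally show ?thesis .
qed

section \<open>The Lax--Milgram lemma for a perturbed semi-inner product\<close>

text \<open>Elements are functions rather than classes, so \<open>ip u u = 0\<close> does not force
  \<open>u = 0\<close>. Completeness accordingly provides some limit, and the solvability results
  derived from it assert existence only.\<close>

locale semi_hilbert =
  fixes P :: "('a \<Rightarrow> 'b::real_vector) set" and ip :: "('a \<Rightarrow> 'b) \<Rightarrow> ('a \<Rightarrow> 'b) \<Rightarrow> real"
  assumes zero: "(\<lambda>x. 0) \<in> P"
    and add: "\<And>u v. u \<in> P \<Longrightarrow> v \<in> P \<Longrightarrow> (\<lambda>x. u x + v x) \<in> P"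
    and scale: "\<And>c u. u \<in> P \<Longrightarrow> (\<lambda>x. c *\<^sub>R u x) \<in> P"
    and ip_add: "\<And>u v w. u \<in> P \<Longrightarrow> v \<in> P \<Longrightarrow> w \<in> P \<Longrightarrow> ip (\<lambda>x. u x + v x) w = ip u w + ip v w"
    and ip_scale: "\<And>c u w. u \<in> P \<Longrightarrow> w \<in> P \<Longrightarrow> ip (\<lambda>x. c *\<^sub>R u x) w = c * ip u w"
    and ip_commute: "\<And>u v. u \<in> P \<Longrightarrow> v \<in> P \<Longrightarrow> ip u v = ip v u"
    and ip_nonneg: "\<And>u. u \<in> P \<Longrightarrow> 0 \<le> ip u u"
    and complete: "\<And>vs. (\<And>n::nat. vs n \<in> P) \<Longrightarrow>
        (\<And>e. e > 0 \<Longrightarrow> \<exists>N. \<forall>m\<ge>N. \<forall>n\<ge>N. sqrt (ip (\<lambda>x. vs m x - vs n x) (\<lambda>x. vs m x - vs n x)) < e) \<Longrightarrow>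
        \<exists>v\<in>P. (\<lambda>n. sqrt (ip (\<lambda>x. vs n x - v x) (\<lambda>x. vs n x - v x))) \<longlonglongrightarrow> 0"
begin

section \<open>Elementary properties of the seminorm\<close>

definition nrm :: "('a \<Rightarrow> 'b) \<Rightarrow> real" where "nrm v = sqrt (ip v v)"

lemma nrm_nonneg: "v \<in> P \<Longrightarrow> 0 \<le> nrm v"
  by (simp add: nrm_def ip_nonneg)

lemma nrm_square: "v \<in> P \<Longrightarrow> (nrm v)\<^sup>2 = ip v v"
  by (simp add: nrm_def ip_nonneg)

lemma diff: "u \<in> P \<Longrightarrow> v \<in> P \<Longrightarrow> (\<lambda>x. u x - v x) \<in> P"
  using add[OF _ scale, of u v "-1"] by simp

lemma ip_diff:
  assumes "u \<in> P" "v \<in> P" "w \<in> P" shows "ip (\<lambda>x. u x - v x) w = ip u w - ip v w"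
  using ip_add[OF assms(1) scale[OF assms(2), of "-1"] assms(3)] ip_scale[OF assms(2,3), of "-1"] by simp

lemma ip_add_right:
  assumes "u \<in> P" "v \<in> P" "w \<in> P" shows "ip w (\<lambda>x. u x + v x) = ip w u + ip w v"
  using ip_add[OF assms] ip_commute assms add by metis

lemma ip_diff_right:
  assumes "u \<in> P" "v \<in> P" "w \<in> P" shows "ip w (\<lambda>x. u x - v x) = ip w u - ip w v"
  using ip_diff[OF assms] ip_commute assms diff by metis

lemma ip_scale_right:
  assumes "u \<in> P" "w \<in> P" shows "ip w (\<lambda>x. c *\<^sub>R u x) = c * ip w u"
  using ip_scale[OF assms] ip_commute assms scale by metis

lemma Cauchy_Schwarz:
  assumes "u \<in> P" "w \<in> P" shows "\<bar>ip u w\<bar> \<le> nrm u * nrm w"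
  unfolding nrm_def
proof (rule discriminant_CS)
  fix t
  have tw: "(\<lambda>x. t *\<^sub>R w x) \<in> P" by (intro scale assms)
  have s: "(\<lambda>x. u x + t *\<^sub>R w x) \<in> P" by (intro add tw assms)
  have "ip (\<lambda>x. u x + t *\<^sub>R w x) (\<lambda>x. u x + t *\<^sub>R w x) = ip u u + 2 * t * ip u w + t\<^sup>2 * ip w w"
    by (simp add: ip_add[OF assms(1) tw s] ip_add_right[OF assms(1) tw] tw assms ip_scale ip_scale_right
        ip_commute[of w u] power2_eq_square algebra_simps)
  then show "0 \<le> ip u u + 2 * t * ip u w + t\<^sup>2 * ip w w" using ip_nonneg[OF s] by simp
qed (use assms ip_nonneg in auto)

lemma nrm_triangle:
  assumes "u \<in> P" "v \<in> P" shows "nrm (\<lambda>x. u x + v x) \<le> nrm u + nrm v"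
proof (rule power2_le_imp_le)
  have "(nrm (\<lambda>x. u x + v x))\<^sup>2 = (nrm u)\<^sup>2 + 2 * ip u v + (nrm v)\<^sup>2"
    using assms by (simp add: nrm_square add ip_add ip_add_right ip_commute[of v u])
  then show "(nrm (\<lambda>x. u x + v x))\<^sup>2 \<le> (nrm u + nrm v)\<^sup>2"
    using Cauchy_Schwarz[OF assms] by (simp add: power2_sum)
qed (use assms nrm_nonneg in simp)

lemma nrm_scale: "v \<in> P \<Longrightarrow> nrm (\<lambda>x. c *\<^sub>R v x) = \<bar>c\<bar> * nrm v"
  unfolding nrm_def by (simp add: ip_scale scale ip_scale_right real_sqrt_mult flip: mult.assoc power2_eq_square)

lemma nrm_minus_commute:
  assumes "u \<in> P" "v \<in> P" shows "nrm (\<lambda>x. u x - v x) = nrm (\<lambda>x. v x - u x)"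
  using nrm_scale[OF diff[OF assms], of "-1"] by simp

lemma complete_nrm:
  assumes "\<And>n::nat. vs n \<in> P" "\<And>e. e > 0 \<Longrightarrow> \<exists>N. \<forall>m\<ge>N. \<forall>n\<ge>N. nrm (\<lambda>x. vs m x - vs n x) < e"
  obtains v where "v \<in> P" "(\<lambda>n. nrm (\<lambda>x. vs n x - v x)) \<longlonglongrightarrow> 0"
  using complete[of vs] assms unfolding nrm_def by blast

lemma ip_tendsto:
  assumes "\<And>n::nat. vs n \<in> P" "v \<in> P" "w \<in> P" "(\<lambda>n. nrm (\<lambda>x. vs n x - v x)) \<longlonglongrightarrow> 0"
  shows "(\<lambda>n. ip (vs n) w) \<longlonglongrightarrow> ip v w"
proof -
  have "(\<lambda>n. ip (vs n) w - ip v w) \<longlonglongrightarrow> 0"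
  proof (rule Lim_null_comparison[OF always_eventually])
    show "\<forall>n. norm (ip (vs n) w - ip v w) \<le> nrm (\<lambda>x. vs n x - v x) * nrm w"
      using assms Cauchy_Schwarz[OF diff[OF assms(1,2)] assms(3)] by (simp add: ip_diff)
    show "(\<lambda>n. nrm (\<lambda>x. vs n x - v x) * nrm w) \<longlonglongrightarrow> 0"
      using tendsto_mult_right[OF assms(4), of "nrm w"] by simp
  qed
  then show ?thesis by (simp add: LIM_zero_iff)
qed

text \<open>The representative minimises \<open>J v = ip v v - 2 * L v\<close>: the parallelogram
  identity makes minimising sequences Cauchy, and minimality along lines gives the equation.\<close>

lemma Riesz:
  assumes L_add: "\<And>u v. u \<in> P \<Longrightarrow> v \<in> P \<Longrightarrow> L (\<lambda>x. u x + v x) = L u + L v"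
    and L_scale: "\<And>c u. u \<in> P \<Longrightarrow> L (\<lambda>x. c *\<^sub>R u x) = c * L u"
    and L_bound: "\<And>u. u \<in> P \<Longrightarrow> \<bar>L u\<bar> \<le> K * nrm u"
  shows "\<exists>z\<in>P. \<forall>w\<in>P. ip z w = L w"
proof -
  define J where "J v = ip v v - 2 * L v" for v
  have Jb: "J v \<ge> - K\<^sup>2" if "v \<in> P" for v
  proof -
    have "J v \<ge> (nrm v)\<^sup>2 - 2 * (K * nrm v)"
      using L_bound[OF that] by (simp add: J_def nrm_square[OF that] abs_le_iff)
    moreover have "(nrm v)\<^sup>2 - 2 * (K * nrm v) = (nrm v - K)\<^sup>2 - K\<^sup>2" by (simp add: power2_diff)
    ultimately show ?thesis by (smt (verit) zero_le_power2)
  qed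
  define m where "m = Inf (J ` P)"
  have bdd: "bdd_below (J ` P)" using Jb by (auto intro!: bdd_belowI2)
  have mJ: "m \<le> J v" if "v \<in> P" for v unfolding m_def using bdd that by (intro cInf_lower) auto
  have "\<exists>v\<in>P. J v < m + 1 / real (Suc n)" for n
    using cInf_lessD[of "J ` P" "m + 1 / real (Suc n)"] zero by (auto simp: m_def)
  then obtain vs where vs: "\<And>n. vs n \<in> P" "\<And>n. J (vs n) < m + 1 / real (Suc n)" by metis
  have Ldiff: "L (\<lambda>x. u x - v x) = L u - L v" if "u \<in> P" "v \<in> P" for u v
    using L_add[OF that(1) scale[OF that(2), of "-1"]] L_scale[OF that(2), of "-1"] by simp
  have par: "(nrm (\<lambda>x. u x - v x))\<^sup>2 \<le> 2 * (J u - m) + 2 * (J v - m)" if uv: "u \<in> P" "v \<in> P" for u v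
  proof -
    have h: "(\<lambda>x. (1/2) *\<^sub>R (u x + v x)) \<in> P" by (intro scale add uv)
    have J2: "J (\<lambda>x. (1/2) *\<^sub>R (u x + v x)) = (1/4) * (ip u u + 2 * ip u v + ip v v) - (L u + L v)"
      using uv by (simp add: J_def ip_scale ip_scale_right scale add ip_add ip_add_right L_scale L_add ip_commute[of v u] add_divide_distrib)
    have n2: "(nrm (\<lambda>x. u x - v x))\<^sup>2 = ip u u - 2 * ip u v + ip v v"
      using uv by (simp add: nrm_square diff ip_diff ip_diff_right ip_commute[of v u])
    have "(nrm (\<lambda>x. u x - v x))\<^sup>2 = 2 * J u + 2 * J v - 4 * J (\<lambda>x. (1/2) *\<^sub>R (u x + v x))"
    proof -
      have lin: "X = 2 * (a - 2 * l) + 2 * (c - 2 * k) - 4 * Y" if "Y = 1 / 4 * (a + 2 * b + c) - (l + k)" "X = a - 2 * b + c" for X Y a b c l k :: real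
        using that by (simp add: field_simps)
      show ?thesis unfolding J_def[of u] J_def[of v] by (rule lin[OF J2 n2])
    qed
    then show ?thesis using mJ[OF h] by argo
  qed
  have cau: "\<exists>N. \<forall>a\<ge>N. \<forall>b\<ge>N. nrm (\<lambda>x. vs a x - vs b x) < e" if e: "e > 0" for e
  proof -
    \<comment> \<open>From \<open>N\<close> on, the deviation of \<open>J\<close> from its infimum
      is below \<open>e^2 / 4\<close>; \<open>par\<close> doubles the two deviations, for a total
      below \<open>e^2\<close>.\<close>
    obtain N where N: "4 / e\<^sup>2 < real N" using reals_Archimedean2 by blast
    show ?thesis
    proof (intro exI allI impI)
      fix a b assume ab: "N \<le> a" "N \<le> b"
      have e2: "1 / real (Suc c) < e\<^sup>2 / 4" if "N \<le> c" for c
      proof -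
        have "4 / e\<^sup>2 < real (Suc c)" using N that by linarith
        then show ?thesis using e by (simp add: field_simps)
      qed
      have "(nrm (\<lambda>x. vs a x - vs b x))\<^sup>2 < e\<^sup>2"
      proof -
        have lin: "X < E" if "X \<le> 2 * (A - m) + 2 * (B - m)" "A < m + c" "B < m + d" "c < E / 4" "d < E / 4" for X A B c d E :: real
          using that by argo
        show ?thesis
          by (rule lin[OF par[OF vs(1)[of a] vs(1)[of b]] vs(2)[of a] vs(2)[of b] e2[OF ab(1)] e2[OF ab(2)]])
      qed
      then show "nrm (\<lambda>x. vs a x - vs b x) < e" using e by (simp add: power2_less_imp_less)
    qed
  qed
  obtain z where z: "z \<in> P" "(\<lambda>n. nrm (\<lambda>x. vs n x - z x)) \<longlonglongrightarrow> 0"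
    using complete_nrm[OF vs(1) cau] by blast
  have Jz: "J z \<le> m"
  proof (rule LIMSEQ_le_const)
    let ?d = "\<lambda>n x. vs n x - z x"
    have Jexp: "J z \<le> m + 1 / real (Suc n) + (2 * nrm z * nrm (?d n) + 2 * (K * nrm (?d n)))" for n
    proof -
      have dP: "?d n \<in> P" by (intro diff vs z)
      have "ip (?d n) (?d n) = ip (vs n) (vs n) - 2 * ip (vs n) z + ip z z"
        using vs z by (simp add: diff ip_diff ip_diff_right ip_commute[of z "vs n"])
      moreover have "ip z (?d n) = ip (vs n) z - ip z z" using vs z by (simp add: ip_diff_right ip_commute[of z "vs n"])
      ultimately have "J (vs n) = J z + 2 * ip z (?d n) + ip (?d n) (?d n) - 2 * L (?d n)"
        using vs z by (simp add: J_def Ldiff)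
      moreover have "\<bar>ip z (?d n)\<bar> \<le> nrm z * nrm (?d n)" by (intro Cauchy_Schwarz z dP)
      moreover have "\<bar>L (?d n)\<bar> \<le> K * nrm (?d n)" by (rule L_bound[OF dP])
      moreover have "0 \<le> ip (?d n) (?d n)" by (rule ip_nonneg[OF dP])
      ultimately show ?thesis using vs(2)[of n] by (simp only: abs_le_iff mult.assoc) linarith
    qed
    then show "\<exists>N. \<forall>n\<ge>N. J z \<le> m + 1 / real (Suc n) + (2 * nrm z * nrm (?d n) + 2 * (K * nrm (?d n)))" by blast
    have "(\<lambda>n. m + 1 / real (Suc n) + (2 * nrm z * nrm (?d n) + 2 * (K * nrm (?d n)))) \<longlonglongrightarrow> m + 0 + (2 * nrm z * 0 + 2 * (K * 0))"
      by (intro tendsto_intros z LIMSEQ_Suc[OF lim_1_over_n])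
    then show "(\<lambda>n. m + 1 / real (Suc n) + (2 * nrm z * nrm (?d n) + 2 * (K * nrm (?d n)))) \<longlonglongrightarrow> m" by simp
  qed
  have "ip z w = L w" if w: "w \<in> P" for w
  proof -
    \<comment> \<open>The quadratic in \<open>t\<close> is \<open>J\<close> at
      \<open>z + t w\<close> minus \<open>J z\<close>. It has constant term 0 and is nonnegative, so
      its linear coefficient must vanish.\<close>
    have "\<bar>ip z w - L w\<bar> \<le> sqrt 0 * sqrt (ip w w)"
    proof (rule discriminant_CS)
      fix t
      have tw: "(\<lambda>x. t *\<^sub>R w x) \<in> P" by (intro scale w)
      have s: "(\<lambda>x. z x + t *\<^sub>R w x) \<in> P" by (intro add tw z)
      have "ip (\<lambda>x. z x + t *\<^sub>R w x) (\<lambda>x. z x + t *\<^sub>R w x) = ip z z + 2 * t * ip z w + t\<^sup>2 * ip w w"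
        by (simp add: ip_add[OF z(1) tw s] ip_add_right[OF z(1) tw] tw z w ip_scale ip_scale_right
            ip_commute[of w z] power2_eq_square algebra_simps)
      moreover have "L (\<lambda>x. z x + t *\<^sub>R w x) = L z + t * L w" by (simp add: L_add[OF z(1) tw] L_scale w)
      ultimately have "J (\<lambda>x. z x + t *\<^sub>R w x) = J z + (2 * t * (ip z w - L w) + t\<^sup>2 * ip w w)"
        by (simp add: J_def algebra_simps)
      then show "0 \<le> 0 + 2 * t * (ip z w - L w) + t\<^sup>2 * ip w w" using mJ[OF s] Jz by linarith
    qed (use w ip_nonneg in auto)
    then show ?thesis by simp
  qed
  with z show ?thesis by blast
qed

text \<open>The solution is the fixed point of the contraction that maps \<open>z\<close> to the Riesz representative
  of \<open>L - R z\<close>.\<close>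

lemma Lax_Milgram:
  assumes L_add: "\<And>u v. u \<in> P \<Longrightarrow> v \<in> P \<Longrightarrow> L (\<lambda>x. u x + v x) = L u + L v"
    and L_scale: "\<And>c u. u \<in> P \<Longrightarrow> L (\<lambda>x. c *\<^sub>R u x) = c * L u"
    and L_bound: "\<And>u. u \<in> P \<Longrightarrow> \<bar>L u\<bar> \<le> K * nrm u"
    and R_add: "\<And>z u v. z \<in> P \<Longrightarrow> u \<in> P \<Longrightarrow> v \<in> P \<Longrightarrow> R z (\<lambda>x. u x + v x) = R z u + R z v"
    and R_scale: "\<And>z c u. z \<in> P \<Longrightarrow> u \<in> P \<Longrightarrow> R z (\<lambda>x. c *\<^sub>R u x) = c * R z u"
    and R_diff: "\<And>u v z. u \<in> P \<Longrightarrow> v \<in> P \<Longrightarrow> z \<in> P \<Longrightarrow> R (\<lambda>x. u x - v x) z = R u z - R v z"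
    and R_bound: "\<And>u v. u \<in> P \<Longrightarrow> v \<in> P \<Longrightarrow> \<bar>R u v\<bar> \<le> q * nrm u * nrm v"
    and q: "0 \<le> q" "q < 1"
  shows "\<exists>z\<in>P. \<forall>w\<in>P. ip z w + R z w = L w"
proof -
  have "\<exists>y\<in>P. \<forall>w\<in>P. ip y w = L w - R z w" if z: "z \<in> P" for z
  proof (rule Riesz)
    fix u assume u: "u \<in> P"
    show "\<bar>L u - R z u\<bar> \<le> (K + q * nrm z) * nrm u"
      using L_bound[OF u] R_bound[OF z u] by (simp add: distrib_right abs_le_iff)
  qed (simp_all add: L_add R_add L_scale R_scale z algebra_simps)
  then obtain T where T: "\<And>z. z \<in> P \<Longrightarrow> T z \<in> P" "\<And>z w. z \<in> P \<Longrightarrow> w \<in> P \<Longrightarrow> ip (T z) w = L w - R z w" by metis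
  \<comment> \<open>The two Riesz equations are tested with the difference of the representatives,
    where their right-hand sides differ by \<open>R\<close> at \<open>u - v\<close> only.\<close>
  have contr: "nrm (\<lambda>x. T u x - T v x) \<le> q * nrm (\<lambda>x. u x - v x)" if uv: "u \<in> P" "v \<in> P" for u v
  proof -
    let ?d = "\<lambda>x. T u x - T v x" and ?e = "\<lambda>x. u x - v x"
    have d: "?d \<in> P" "?e \<in> P" by (intro diff T uv)+
    have "(nrm ?d)\<^sup>2 = ip (T u) ?d - ip (T v) ?d" by (simp add: nrm_square d ip_diff[OF T(1)[OF uv(1)] T(1)[OF uv(2)] d(1)])
    also have "\<dots> = - R ?e ?d" using uv d by (simp add: T R_diff)
    also have "\<dots> \<le> q * nrm ?e * nrm ?d" using R_bound[OF d(2,1)] by linarith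
    finally have *: "nrm ?d * nrm ?d \<le> (q * nrm ?e) * nrm ?d" by (simp add: power2_eq_square)
    show ?thesis
    proof (cases "nrm ?d = 0")
      case True
      then show ?thesis using q nrm_nonneg[OF d(2)] by simp
    next
      case False
      then have "nrm ?d > 0" using nrm_nonneg[OF d(1)] by simp
      with * show ?thesis by (simp add: mult_le_cancel_right)
    qed
  qed
  \<comment> \<open>Since \<open>nrm\<close> is merely a seminorm on functions, the Picard iteration
    is run explicitly; it starts at the zero function.\<close>
  define zs where "zs n = (T ^^ n) (\<lambda>x. 0)" for n
  have zP: "zs n \<in> P" for n by (induct n) (auto simp: zs_def zero T)
  have zS: "zs (Suc n) = T (zs n)" for n by (simp add: zs_def)
  define D where "D = nrm (\<lambda>x. zs 1 x - zs 0 x)"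
  have D: "D \<ge> 0" unfolding D_def by (intro nrm_nonneg diff zP)
  have step: "nrm (\<lambda>x. zs (Suc n) x - zs n x) \<le> D * q ^ n" for n
  proof (induct n)
    case (Suc n)
    have "nrm (\<lambda>x. zs (Suc (Suc n)) x - zs (Suc n) x) \<le> q * nrm (\<lambda>x. zs (Suc n) x - zs n x)"
      using contr[OF zP zP, of "Suc n" n] by (simp add: zS)
    also have "\<dots> \<le> q * (D * q ^ n)" by (intro mult_left_mono Suc q)
    finally show ?case by (simp add: mult_ac)
  qed (simp add: D_def)
  \<comment> \<open>Multiplying through by \<open>1 - q\<close> turns the geometric sum into
    \<open>1 - q ^ j\<close>, so that the induction involves no quotients.\<close>
  have tail: "nrm (\<lambda>x. zs (n + j) x - zs n x) * (1 - q) \<le> D * q ^ n * (1 - q ^ j)" for n j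
  proof (induct j)
    case 0
    \<comment> \<open>The difference is the zero function, whose seminorm is 0 by homogeneity with
      factor 0.\<close>
    show ?case using nrm_scale[OF zP[of n], of 0] by simp
  next
    case (Suc j)
    have "nrm (\<lambda>x. zs (n + Suc j) x - zs n x) \<le> nrm (\<lambda>x. zs (Suc (n + j)) x - zs (n + j) x) + nrm (\<lambda>x. zs (n + j) x - zs n x)"
      using nrm_triangle[OF diff[OF zP[of "Suc (n + j)"] zP[of "n + j"]] diff[OF zP[of "n + j"] zP[of n]]] by simp
    then have "nrm (\<lambda>x. zs (n + Suc j) x - zs n x) * (1 - q) \<le> (D * q ^ (n + j) + nrm (\<lambda>x. zs (n + j) x - zs n x)) * (1 - q)"
      using step[of "n + j"] q by (intro mult_right_mono) auto
    also have "\<dots> \<le> D * q ^ (n + j) * (1 - q) + D * q ^ n * (1 - q ^ j)"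
      using Suc by (simp add: distrib_right)
    also have "\<dots> = D * q ^ n * (1 - q ^ Suc j)" by (simp add: power_add algebra_simps)
    finally show ?case .
  qed
  have tail': "nrm (\<lambda>x. zs (n + j) x - zs n x) \<le> D / (1 - q) * q ^ n" for n j
  proof -
    have "D * q ^ n * (1 - q ^ j) \<le> D * q ^ n * 1" using D q by (intro mult_left_mono) auto
    then show ?thesis using tail[of n j] q by (simp add: field_simps)
  qed
  have cau: "\<exists>N. \<forall>m\<ge>N. \<forall>n\<ge>N. nrm (\<lambda>x. zs m x - zs n x) < e" if e: "e > 0" for e
  proof -
    have "(\<lambda>n. D / (1 - q) * q ^ n) \<longlonglongrightarrow> D / (1 - q) * 0"
      using q by (intro tendsto_intros LIMSEQ_realpow_zero) auto
    then have "\<forall>\<^sub>F n in sequentially. D / (1 - q) * q ^ n < e"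
      using e by (intro order_tendstoD(2)[of _ "D / (1 - q) * 0"]) auto
    then obtain N where N: "\<And>n. n \<ge> N \<Longrightarrow> D / (1 - q) * q ^ n < e" by (auto simp: eventually_sequentially)
    have *: "nrm (\<lambda>x. zs m x - zs n x) < e" if "n \<ge> N" "m \<ge> n" for m n
      using tail'[of n "m - n"] N[OF that(1)] that by simp
    show ?thesis
    proof (intro exI allI impI)
      fix m n assume "N \<le> m" "N \<le> n"
      then show "nrm (\<lambda>x. zs m x - zs n x) < e"
        using *[of n m] *[of m n] nrm_minus_commute[OF zP[of m] zP[of n]] by (cases "n \<le> m") auto
    qed
  qed
  obtain z where z: "z \<in> P" "(\<lambda>n. nrm (\<lambda>x. zs n x - z x)) \<longlonglongrightarrow> 0"
    using complete_nrm[OF zP cau] by blast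
  have "ip z w + R z w = L w" if w: "w \<in> P" for w
  proof -
    have "(\<lambda>n. ip (zs (Suc n)) w) \<longlonglongrightarrow> ip z w"
      using ip_tendsto[OF zP z(1) w z(2)] by (rule LIMSEQ_Suc)
    moreover have "(\<lambda>n. R (zs n) w) \<longlonglongrightarrow> R z w"
    proof -
      have "(\<lambda>n. R (zs n) w - R z w) \<longlonglongrightarrow> 0"
      proof (rule Lim_null_comparison[OF always_eventually])
        show "\<forall>n. norm (R (zs n) w - R z w) \<le> q * nrm (\<lambda>x. zs n x - z x) * nrm w"
          using R_bound[OF diff[OF zP z(1)] w] by (simp add: R_diff[OF zP z(1) w])
        have "(\<lambda>n. q * nrm (\<lambda>x. zs n x - z x) * nrm w) \<longlonglongrightarrow> q * 0 * nrm w" by (intro tendsto_intros z)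
        then show "(\<lambda>n. q * nrm (\<lambda>x. zs n x - z x) * nrm w) \<longlonglongrightarrow> 0" by simp
      qed
      then show ?thesis by (simp add: LIM_zero_iff)
    qed
    ultimately have "(\<lambda>n. ip (zs (Suc n)) w + R (zs n) w) \<longlonglongrightarrow> ip z w + R z w" by (rule tendsto_add)
    moreover have "ip (zs (Suc n)) w + R (zs n) w = L w" for n by (simp add: zS T zP w)
    ultimately show ?thesis by (simp add: LIMSEQ_const_iff)
  qed
  with z show ?thesis by blast
qed

end

section \<open>Vector fields in the periodic Sobolev space\<close>

lemma borel_measurable_vec_nth:
  fixes f :: "'a \<Rightarrow> 'b::euclidean_space ^ 'n"
  assumes "f \<in> borel_measurable M" shows "(\<lambda>x. f x $ i) \<in> borel_measurable M"
  by (rule measurable_compose[OF assms borel_measurable_continuous_onI]) (intro continuous_intros)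

lemma borel_measurable_vecI:
  fixes f :: "'a \<Rightarrow> 'b::euclidean_space ^ 'n"
  assumes "\<And>i. (\<lambda>x. f x $ i) \<in> borel_measurable M" shows "f \<in> borel_measurable M"
proof (subst borel_measurable_euclidean_space, rule ballI)
  fix e :: "'b ^ 'n" assume "e \<in> Basis"
  then obtain i b where "e = axis i b" by (auto simp: Basis_vec_def)
  then show "(\<lambda>x. f x \<bullet> e) \<in> borel_measurable M"
    using assms[of i] by (simp add: inner_axis)
qed

lemma norm_vec_square: "(norm (x :: 'b::euclidean_space ^ 'n))\<^sup>2 = (\<Sum>i\<in>UNIV. (norm (x $ i))\<^sup>2)"
  by (simp add: norm_vec_def L2_set_def sum_nonneg)

lemma sqint_vecI:
  fixes f :: "'a \<Rightarrow> 'b::euclidean_space ^ 'n"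
  assumes "\<And>i. sqint M (\<lambda>x. f x $ i)" shows "sqint M f"
  using assms unfolding sqint_def norm_vec_square by (auto intro: borel_measurable_vecI)

lemma sqint_vec_nth:
  fixes f :: "'a \<Rightarrow> 'b::euclidean_space ^ 'n"
  assumes "sqint M f" shows "sqint M (\<lambda>x. f x $ i)"
  using assms by (rule sqint_bound[of _ _ _ 1]) (use assms in \<open>auto simp: sqint_def Finite_Cartesian_Product.norm_nth_le intro: borel_measurable_vec_nth\<close>)

lemma l2ip_vec:
  fixes f g :: "'a \<Rightarrow> 'b::euclidean_space ^ 'n"
  assumes "sqint M f" "sqint M g"
  shows "l2ip M f g = (\<Sum>i\<in>UNIV. l2ip M (\<lambda>x. f x $ i) (\<lambda>x. g x $ i))"
  unfolding l2ip_def inner_vec_def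
  using sqint_inner_integrable[OF sqint_vec_nth[OF assms(1)] sqint_vec_nth[OF assms(2)]] by simp

lemma l2n_vec:
  fixes f :: "'a \<Rightarrow> 'b::euclidean_space ^ 'n"
  assumes "sqint M f" shows "(l2n M f)\<^sup>2 = (\<Sum>i\<in>UNIV. (l2n M (\<lambda>x. f x $ i))\<^sup>2)"
  unfolding l2ip_self[symmetric] by (rule l2ip_vec[OF assms assms])

lemma l2n_vec_nth_le:
  fixes f :: "'a \<Rightarrow> 'b::euclidean_space ^ 'n"
  assumes "sqint M f" shows "l2n M (\<lambda>x. f x $ i) \<le> l2n M f"
  using assms by (intro l2n_mono sqint_vec_nth) (auto simp: Finite_Cartesian_Product.norm_nth_le)

lemma ae_periodic_vecI:
  fixes f :: "real ^ 'm \<Rightarrow> 'b ^ 'n"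
  assumes "\<And>i. ae_periodic (\<lambda>x. f x $ i)" shows "ae_periodic f"
  unfolding ae_periodic_def
proof
  fix j
  have "AE x in lebesgue. \<forall>i. f (x + axis j 1) $ i = f x $ i"
    using assms unfolding ae_periodic_def by (subst AE_all_countable) blast
  then show "AE x in lebesgue. f (x + axis j 1) = f x" by eventually_elim (simp add: vec_eq_iff)
qed

lemma L2_per_vecI:
  fixes f :: "real ^ 'm \<Rightarrow> 'b::euclidean_space ^ 'n"
  assumes "\<And>i. (\<lambda>x. f x $ i) \<in> L2_per" shows "f \<in> L2_per"
  using assms unfolding L2_per_iff by (auto intro: borel_measurable_vecI ae_periodic_vecI sqint_vecI)

lemma L2_per_vec_nth:
  fixes f :: "real ^ 'm \<Rightarrow> 'b::euclidean_space ^ 'n"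
  assumes "f \<in> L2_per" shows "(\<lambda>x. f x $ i) \<in> L2_per"
  using assms unfolding L2_per_iff by (auto intro: borel_measurable_vec_nth sqint_vec_nth ae_periodic_compose)

lemma L2_per_sqint: "u \<in> L2_per \<Longrightarrow> sqint cellM u"
  by (simp add: L2_per_iff)

text \<open>The explicit \<open>lim\<close> is formed at every point of the space. Off one null set
  the sequences at \<open>x\<close> and \<open>x + axis i 1\<close> are identical, so their limits
  agree, even where neither converges.\<close>

lemma L2_per_complete:
  fixes u :: "nat \<Rightarrow> real ^ 'n \<Rightarrow> 'b::euclidean_space"
  assumes u: "\<And>n. u n \<in> L2_per"
    and cau: "\<And>e. e > 0 \<Longrightarrow> \<exists>N. \<forall>m\<ge>N. \<forall>n\<ge>N. l2n cellM (\<lambda>x. u m x - u n x) < e"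
  obtains v where "v \<in> L2_per" "(\<lambda>n. l2n cellM (\<lambda>x. u n x - v x)) \<longlonglongrightarrow> 0"
proof -
  obtain r :: "nat \<Rightarrow> nat" where r: "sqint cellM (\<lambda>x. lim (\<lambda>k. u (r k) x))"
    "(\<lambda>n. l2n cellM (\<lambda>x. u n x - lim (\<lambda>k. u (r k) x))) \<longlonglongrightarrow> 0"
    using L2_complete[OF finite_cellM L2_per_sqint[OF u] cau] .
  have m: "u n \<in> borel_measurable lebesgue" for n using u by (simp add: L2_per_iff)
  have "(\<lambda>x. lim (\<lambda>k. u (r k) x)) \<in> borel_measurable lebesgue"
    by (intro borel_measurable_lim_metric m)
  moreover have "ae_periodic (\<lambda>x. lim (\<lambda>k. u (r k) x))"
    unfolding ae_periodic_def
  proof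
    fix i
    have "AE x in lebesgue. \<forall>k. u (r k) (x + axis i 1) = u (r k) x"
      using u by (subst AE_all_countable) (simp add: L2_per_iff ae_periodic_def)
    then show "AE x in lebesgue. lim (\<lambda>k. u (r k) (x + axis i 1)) = lim (\<lambda>k. u (r k) x)"
      by eventually_elim simp
  qed
  ultimately have "(\<lambda>x. lim (\<lambda>k. u (r k) x)) \<in> L2_per" using r by (simp add: L2_per_iff)
  then show ?thesis using r(2) by (rule that)
qed

section \<open>Periodic Sobolev fields and their weak Jacobians\<close>

lemma has_weak_partial_cong:
  assumes w: "has_weak_partial i u g" and u: "AE x in lebesgue. u x = u' x" "loc_integrable u'"
    and g: "AE x in lebesgue. g x = g' x" "loc_integrable g'"
  shows "has_weak_partial i u' g'"
  unfolding has_weak_partial_def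
proof (intro conjI allI impI u g)
  fix \<phi> :: "real ^ 'a \<Rightarrow> real" assume t: "test_function \<phi>"
  have l: "loc_integrable u" "loc_integrable g" using w by (auto simp: has_weak_partial_def)
  note b = test_function_bounded(2)[OF t] test_function_bounded(4)[OF t, of i]
  have "(\<integral>x. u' x * partial_deriv i \<phi> x \<partial>lebesgue) = (\<integral>x. u x * partial_deriv i \<phi> x \<partial>lebesgue)"
    using u l by (intro integral_cong_AE borel_measurable_times b loc_integrable_measurable) auto
  moreover have "(\<integral>x. g' x * \<phi> x \<partial>lebesgue) = (\<integral>x. g x * \<phi> x \<partial>lebesgue)"
    using g l by (intro integral_cong_AE borel_measurable_times b loc_integrable_measurable) auto
  ultimately show "(\<integral>x. u' x * partial_deriv i \<phi> x \<partial>lebesgue) = - (\<integral>x. g' x * \<phi> x \<partial>lebesgue)"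
    using w t by (simp add: has_weak_partial_def)
qed

text \<open>The function chosen by \<open>weak_partial\<close> need not be the periodic witness from
  the definition, but it agrees with it almost everywhere and so inherits periodicity and square
  integrability.\<close>

lemma H1_perD:
  assumes "u \<in> H1_per"
  shows "u \<in> L2_per" "has_weak_partial i u (weak_partial i u)" "weak_partial i u \<in> L2_per"
proof -
  show "u \<in> L2_per" using assms by (simp add: H1_per_def)
  obtain g where g: "g \<in> L2_per" "has_weak_partial i u g" using assms by (auto simp: H1_per_def)
  show w: "has_weak_partial i u (weak_partial i u)" by (rule weak_partial_eq[OF g(2)])
  have "weak_partial i u \<in> borel_measurable lebesgue"
    using w loc_integrable_measurable by (auto simp: has_weak_partial_def)
  moreover have "AE x in lebesgue. g x = weak_partial i u x"
    using weak_partial_eq(2)[OF g(2)] by eventually_elim simp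
  ultimately show "weak_partial i u \<in> L2_per" using L2_per_cong[OF g(1)] by blast
qed

lemma H1_perI:
  assumes "u \<in> L2_per" "\<And>i. g i \<in> L2_per" "\<And>i. has_weak_partial i u (g i)" shows "u \<in> H1_per"
  using assms by (auto simp: H1_per_def)

lemma weak_jacobian_nth: "weak_jacobian w x $ i $ j = weak_partial j (\<lambda>y. w y $ i) x"
  by (simp add: weak_jacobian_def)

lemma weak_div_eq: "weak_div w x = (\<Sum>i\<in>UNIV. weak_jacobian w x $ i $ i)"
  by (simp add: weak_div_def weak_jacobian_nth)

lemma weak_jacobian_AE:
  assumes "\<And>i j. has_weak_partial j (\<lambda>y. w y $ i) (\<lambda>x. G x $ i $ j)"
  shows "AE x in lebesgue. weak_jacobian w x = G x"
proof -
  have "AE x in lebesgue. \<forall>i j. weak_partial j (\<lambda>y. w y $ i) x = G x $ i $ j"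
    unfolding AE_all_countable using weak_partial_eq(2)[OF assms] by blast
  then show ?thesis by eventually_elim (simp add: vec_eq_iff weak_jacobian_nth)
qed

lemma H1_per0D:
  assumes "w \<in> H1_per0"
  shows "w \<in> L2_per" "(\<lambda>x. w x $ i) \<in> L2_per" "(\<lambda>x. weak_jacobian w x $ i $ j) \<in> L2_per" "weak_jacobian w \<in> L2_per"
    "has_weak_partial j (\<lambda>x. w x $ i) (\<lambda>x. weak_jacobian w x $ i $ j)"
    "(\<integral>x. w x $ i \<partial>cellM) = 0"
proof -
  have h: "(\<lambda>x. w x $ i) \<in> H1_per" for i using assms by (simp add: H1_per0_def)
  show c: "(\<lambda>x. w x $ i) \<in> L2_per" for i by (rule H1_perD(1)[OF h])
  then show "w \<in> L2_per" by (rule L2_per_vecI)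
  show j: "(\<lambda>x. weak_jacobian w x $ i $ j) \<in> L2_per" for i j
    using H1_perD(3)[OF h] by (simp add: weak_jacobian_nth)
  show "weak_jacobian w \<in> L2_per" by (intro L2_per_vecI j)
  show "has_weak_partial j (\<lambda>x. w x $ i) (\<lambda>x. weak_jacobian w x $ i $ j)"
    using H1_perD(2)[OF h] by (simp add: weak_jacobian_nth)
  show "(\<integral>x. w x $ i \<partial>cellM) = 0" using assms by (simp add: H1_per0_def)
qed

text \<open>Here \<open>G\<close> is an explicit candidate for the Jacobian. The second conclusion
  exchanges the chosen \<open>weak_jacobian\<close> for it; sums, multiples, limits and gradients of
  potentials are all handled this way.\<close>

lemma H1_per0I:
  assumes "\<And>i. (\<lambda>x. w x $ i) \<in> L2_per" "\<And>i j. (\<lambda>x. G x $ i $ j) \<in> L2_per"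
    "\<And>i j. has_weak_partial j (\<lambda>x. w x $ i) (\<lambda>x. G x $ i $ j)" "\<And>i. (\<integral>x. w x $ i \<partial>cellM) = 0"
  shows "w \<in> H1_per0" "AE x in lebesgue. weak_jacobian w x = G x"
proof -
  have "(\<lambda>x. w x $ i) \<in> H1_per" for i
    by (rule H1_perI[of _ "\<lambda>j x. G x $ i $ j"]) (intro assms)+
  then show "w \<in> H1_per0" using assms(4) by (simp add: H1_per0_def)
  show "AE x in lebesgue. weak_jacobian w x = G x" by (rule weak_jacobian_AE[OF assms(3)])
qed

lemma H1_per0_add:
  assumes v: "v \<in> H1_per0" and w: "w \<in> H1_per0"
  shows "(\<lambda>x. v x + w x) \<in> H1_per0"
    "AE x in lebesgue. weak_jacobian (\<lambda>x. v x + w x) x = weak_jacobian v x + weak_jacobian w x"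
proof -
  note dv = H1_per0D[OF v] and dw = H1_per0D[OF w]
  have a: "(\<lambda>x. (v x + w x) $ i) \<in> L2_per" for i
    using L2_per_add[OF dv(2) dw(2)] by simp
  have b: "(\<lambda>x. (weak_jacobian v x + weak_jacobian w x) $ i $ j) \<in> L2_per" for i j
    using L2_per_add[OF dv(3) dw(3)] by simp
  have c: "has_weak_partial j (\<lambda>x. (v x + w x) $ i) (\<lambda>x. (weak_jacobian v x + weak_jacobian w x) $ i $ j)" for i j
    using has_weak_partial_add[OF dv(5) dw(5)] by simp
  have d: "(\<integral>x. (v x + w x) $ i \<partial>cellM) = 0" for i
    using dv(6) dw(6) sqint_cell_integrable[OF L2_per_sqint[OF dv(2)]] sqint_cell_integrable[OF L2_per_sqint[OF dw(2)]] by simp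
  show "(\<lambda>x. v x + w x) \<in> H1_per0"
    "AE x in lebesgue. weak_jacobian (\<lambda>x. v x + w x) x = weak_jacobian v x + weak_jacobian w x"
    by (rule H1_per0I[OF a b c d])+
qed

lemma H1_per0_scaleR:
  assumes v: "v \<in> H1_per0"
  shows "(\<lambda>x. c *\<^sub>R v x) \<in> H1_per0"
    "AE x in lebesgue. weak_jacobian (\<lambda>x. c *\<^sub>R v x) x = c *\<^sub>R weak_jacobian v x"
proof -
  note dv = H1_per0D[OF v]
  have a: "(\<lambda>x. (c *\<^sub>R v x) $ i) \<in> L2_per" for i
    using L2_per_cmult[OF dv(2)] by simp
  have b: "(\<lambda>x. (c *\<^sub>R weak_jacobian v x) $ i $ j) \<in> L2_per" for i j
    using L2_per_cmult[OF dv(3)] by simp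
  have p: "has_weak_partial j (\<lambda>x. (c *\<^sub>R v x) $ i) (\<lambda>x. (c *\<^sub>R weak_jacobian v x) $ i $ j)" for i j
    using has_weak_partial_cmult[OF dv(5)] by simp
  have d: "(\<integral>x. (c *\<^sub>R v x) $ i \<partial>cellM) = 0" for i using dv(6) by simp
  show "(\<lambda>x. c *\<^sub>R v x) \<in> H1_per0"
    "AE x in lebesgue. weak_jacobian (\<lambda>x. c *\<^sub>R v x) x = c *\<^sub>R weak_jacobian v x"
    by (rule H1_per0I[OF a b p d])+
qed

lemma H1_per0_diff:
  assumes v: "v \<in> H1_per0" and w: "w \<in> H1_per0"
  shows "(\<lambda>x. v x - w x) \<in> H1_per0"
    "AE x in lebesgue. weak_jacobian (\<lambda>x. v x - w x) x = weak_jacobian v x - weak_jacobian w x"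
proof -
  note s = H1_per0_scaleR[OF w, of "-1"]
  show "(\<lambda>x. v x - w x) \<in> H1_per0" using H1_per0_add(1)[OF v s(1)] by simp
  show "AE x in lebesgue. weak_jacobian (\<lambda>x. v x - w x) x = weak_jacobian v x - weak_jacobian w x"
    using H1_per0_add(2)[OF v s(1)] s(2) by eventually_elim simp
qed

lemma Poincare_H1_per0:
  fixes w :: "real ^ 'n \<Rightarrow> real ^ 'n"
  assumes w: "w \<in> H1_per0"
  shows "(2 * pi)\<^sup>2 * (l2n cellM w)\<^sup>2 \<le> (l2n cellM (weak_jacobian w))\<^sup>2"
proof -
  note d = H1_per0D[OF w]
  have "(2 * pi)\<^sup>2 * (l2n cellM w)\<^sup>2 = (\<Sum>i\<in>UNIV. (2 * pi)\<^sup>2 * (l2n cellM (\<lambda>x. w x $ i))\<^sup>2)"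
    by (simp add: l2n_vec[OF L2_per_sqint[OF d(1)]] sum_distrib_left)
  also have "\<dots> \<le> (\<Sum>i\<in>UNIV. \<Sum>j\<in>UNIV. (l2n cellM (\<lambda>x. weak_jacobian w x $ i $ j))\<^sup>2)"
    by (intro sum_mono Poincare_periodic d)
  also have "\<dots> = (\<Sum>i\<in>UNIV. (l2n cellM (\<lambda>x. weak_jacobian w x $ i))\<^sup>2)"
    by (intro sum.cong refl l2n_vec[symmetric] L2_per_sqint L2_per_vecI d)
  also have "\<dots> = (l2n cellM (weak_jacobian w))\<^sup>2"
    by (intro l2n_vec[symmetric] L2_per_sqint d)
  finally show ?thesis .
qed

lemma Poincare_H1_per0_le:
  assumes w: "w \<in> H1_per0" shows "l2n cellM w \<le> l2n cellM (weak_jacobian w)"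
proof (rule power2_le_imp_le)
  have "1 \<le> 2 * pi" using pi_ge_two by simp
  then have "1 \<le> (2 * pi)\<^sup>2" by (rule one_le_power)
  then have "1 * (l2n cellM w)\<^sup>2 \<le> (2 * pi)\<^sup>2 * (l2n cellM w)\<^sup>2" by (intro mult_right_mono) auto
  then show "(l2n cellM w)\<^sup>2 \<le> (l2n cellM (weak_jacobian w))\<^sup>2" using Poincare_H1_per0[OF w] by linarith
qed simp

text \<open>The mean of a derivative is its coefficient at frequency 0, which differentiation
  multiplies by 0.\<close>

lemma integral_weak_jacobian:
  assumes "w \<in> H1_per0" shows "(\<integral>x. weak_jacobian w x $ i $ j \<partial>cellM) = 0"
proof -
  have "cosc (\<lambda>x. weak_jacobian w x $ i $ j) (\<lambda>_. 0) = 0"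
    by (subst weak_partial_coeff(1)[OF H1_per0D(2,3,5)[OF assms]]) simp
  then show ?thesis by (simp add: cosc_def l2ip_def cosm_def inner_vec_def)
qed

section \<open>The div-curl identity and completeness in the Jacobian norm\<close>

lemma l2ip_matrix:
  fixes F G :: "'a \<Rightarrow> real ^ 'n ^ 'm"
  assumes "sqint M F" "sqint M G"
  shows "l2ip M F G = (\<Sum>i\<in>UNIV. \<Sum>j\<in>UNIV. l2ip M (\<lambda>x. F x $ i $ j) (\<lambda>x. G x $ i $ j))"
  using assms by (simp add: l2ip_vec sqint_vec_nth)

lemma weak_div_sqint:
  assumes "w \<in> H1_per0" shows "weak_div w \<in> L2_per" "sqint cellM (weak_div w)"
proof -
  show "weak_div w \<in> L2_per"
    unfolding weak_div_eq[abs_def] by (intro L2_per_sum H1_per0D(3) assms)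
  then show "sqint cellM (weak_div w)" by (rule L2_per_sqint)
qed

text \<open>Expanding the product of the antisymmetric parts gives two copies of the full product
  minus two sums of mixed terms pairing entry \<open>(i, j)\<close> with entry
  \<open>(j, i)\<close>. By \<open>weak_partial_swap\<close> each mixed term becomes a product of
  diagonal entries, and these sum to the product of the divergences.\<close>

lemma div_curl_identity:
  fixes v w :: "real ^ 'n \<Rightarrow> real ^ 'n"
  assumes v: "v \<in> H1_per0" and w: "w \<in> H1_per0"
  shows "l2ip cellM (weak_jacobian v) (weak_jacobian w) =
    l2ip cellM (weak_div v) (weak_div w) +
    1 / 2 * (\<integral>x. (weak_jacobian v x - transpose (weak_jacobian v x)) \<bullet> (weak_jacobian w x - transpose (weak_jacobian w x)) \<partial>cellM)"
proof -
  let ?V = "\<lambda>i j x. weak_jacobian v x $ i $ j" and ?W = "\<lambda>i j x. weak_jacobian w x $ i $ j"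
  have s: "sqint cellM (?V i j)" "sqint cellM (?W i j)" for i j
    using H1_per0D(3)[OF v] H1_per0D(3)[OF w] L2_per_sqint by blast+
  have swap: "l2ip cellM (?V i j) (?W j i) = l2ip cellM (?V i i) (?W j j)" for i j
    by (rule weak_partial_swap[where i=j and j=i and u="\<lambda>x. v x $ i" and v="\<lambda>x. w x $ j"]) (intro H1_per0D v w)+
  have dd: "l2ip cellM (weak_div v) (weak_div w) = (\<Sum>i\<in>UNIV. \<Sum>j\<in>UNIV. l2ip cellM (?V i i) (?W j j))"
  proof -
    have "l2ip cellM (weak_div v) (weak_div w) = (\<integral>x. (\<Sum>i\<in>UNIV. \<Sum>j\<in>UNIV. ?V i i x * ?W j j x) \<partial>cellM)"
      by (simp add: l2ip_def weak_div_eq sum_product)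
    then show ?thesis using s by (simp add: l2ip_def sqint_mult_integrable)
  qed
  have ip: "l2ip cellM (weak_jacobian v) (weak_jacobian w) = (\<Sum>i\<in>UNIV. \<Sum>j\<in>UNIV. l2ip cellM (?V i j) (?W i j))"
    by (intro l2ip_matrix L2_per_sqint H1_per0D v w)
  have "(\<integral>x. (weak_jacobian v x - transpose (weak_jacobian v x)) \<bullet> (weak_jacobian w x - transpose (weak_jacobian w x)) \<partial>cellM)
     = (\<integral>x. (\<Sum>i\<in>UNIV. \<Sum>j\<in>UNIV. ?V i j x * ?W i j x - ?V i j x * ?W j i x - ?V j i x * ?W i j x + ?V j i x * ?W j i x) \<partial>cellM)"
    by (intro Bochner_Integration.integral_cong refl) (simp add: inner_vec_def transpose_def algebra_simps)
  also have "\<dots> = (\<Sum>i\<in>UNIV. \<Sum>j\<in>UNIV. l2ip cellM (?V i j) (?W i j) - l2ip cellM (?V i j) (?W j i) - l2ip cellM (?V j i) (?W i j) + l2ip cellM (?V j i) (?W j i))"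
    using s by (simp add: l2ip_def sqint_mult_integrable)
  also have "\<dots> = 2 * (\<Sum>i\<in>UNIV. \<Sum>j\<in>UNIV. l2ip cellM (?V i j) (?W i j)) - 2 * (\<Sum>i\<in>UNIV. \<Sum>j\<in>UNIV. l2ip cellM (?V i i) (?W j j))"
  proof -
    have "(\<Sum>i\<in>UNIV. \<Sum>j\<in>UNIV. l2ip cellM (?V j i) (?W j i)) = (\<Sum>i\<in>UNIV. \<Sum>j\<in>UNIV. l2ip cellM (?V i j) (?W i j))"
      "(\<Sum>i\<in>UNIV. \<Sum>j\<in>UNIV. l2ip cellM (?V j j) (?W i i)) = (\<Sum>i\<in>UNIV. \<Sum>j\<in>UNIV. l2ip cellM (?V i i) (?W j j))"
      by (rule sum.swap)+
    moreover have "(\<Sum>i\<in>UNIV. \<Sum>j\<in>UNIV. l2ip cellM (?V i j) (?W j i)) = (\<Sum>i\<in>UNIV. \<Sum>j\<in>UNIV. l2ip cellM (?V i i) (?W j j))"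
      "(\<Sum>i\<in>UNIV. \<Sum>j\<in>UNIV. l2ip cellM (?V j i) (?W i j)) = (\<Sum>i\<in>UNIV. \<Sum>j\<in>UNIV. l2ip cellM (?V j j) (?W i i))"
      by (intro sum.cong refl swap)+
    ultimately show ?thesis unfolding sum.distrib sum_subtractf by linarith
  qed
  finally show ?thesis unfolding ip dd by (simp add: diff_divide_distrib)
qed

text \<open>Take \<open>v = w\<close> in the identity and drop the nonnegative curl term.\<close>

lemma weak_div_le:
  assumes w: "w \<in> H1_per0" shows "l2n cellM (weak_div w) \<le> l2n cellM (weak_jacobian w)"
proof (rule power2_le_imp_le)
  have "0 \<le> (\<integral>x. (weak_jacobian w x - transpose (weak_jacobian w x)) \<bullet> (weak_jacobian w x - transpose (weak_jacobian w x)) \<partial>cellM)"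
    by (rule Bochner_Integration.integral_nonneg) simp
  then show "(l2n cellM (weak_div w))\<^sup>2 \<le> (l2n cellM (weak_jacobian w))\<^sup>2"
    using div_curl_identity[OF w w] by (simp add: l2ip_self)
qed simp

text \<open>The product sees only Jacobians, while closedness of \<open>P\<close> refers to the full
  \<open>H1\<close> norm; the Poincare inequality makes the fields Cauchy as well. Fields and
  Jacobians converge separately, and \<open>has_weak_partial_closed\<close> matches the two
  limits.\<close>

lemma closed_subspace_semi_hilbert:
  fixes P :: "(real ^ 'n \<Rightarrow> real ^ 'n) set"
  assumes P: "closed_subspace_H1_per0 P"
  shows "semi_hilbert P (\<lambda>v w. l2ip cellM (weak_jacobian v) (weak_jacobian w))"
proof -
  have sub: "v \<in> P \<Longrightarrow> v \<in> H1_per0" for v using P by (auto simp: closed_subspace_H1_per0_def)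
  have jm: "v \<in> H1_per0 \<Longrightarrow> sqint cellM (weak_jacobian v)" for v :: "real ^ 'n \<Rightarrow> real ^ 'n"
    by (intro L2_per_sqint H1_per0D)
  have meas: "v \<in> H1_per0 \<Longrightarrow> weak_jacobian v \<in> borel_measurable cellM" for v :: "real ^ 'n \<Rightarrow> real ^ 'n"
    using jm by (simp add: sqint_def)
  have jd: "l2n cellM (weak_jacobian (\<lambda>x. u x - v x)) = l2n cellM (\<lambda>x. weak_jacobian u x - weak_jacobian v x)"
    if "u \<in> H1_per0" "v \<in> H1_per0" for u v :: "real ^ 'n \<Rightarrow> real ^ 'n"
    using that by (intro l2n_cong_AE cellM_AE H1_per0_diff meas) (auto intro: borel_measurable_diff meas)
  show ?thesis
  proof
    show "(\<lambda>x. 0) \<in> P" using P by (simp add: closed_subspace_H1_per0_def)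
    fix u v w :: "real ^ 'n \<Rightarrow> real ^ 'n" and c :: real
    show "u \<in> P \<Longrightarrow> v \<in> P \<Longrightarrow> (\<lambda>x. u x + v x) \<in> P" using P by (simp add: closed_subspace_H1_per0_def)
    show "u \<in> P \<Longrightarrow> (\<lambda>x. c *\<^sub>R u x) \<in> P" using P by (simp add: closed_subspace_H1_per0_def)
    show "l2ip cellM (weak_jacobian (\<lambda>x. u x + v x)) (weak_jacobian w) = l2ip cellM (weak_jacobian u) (weak_jacobian w) + l2ip cellM (weak_jacobian v) (weak_jacobian w)"
      if uvw: "u \<in> P" "v \<in> P" "w \<in> P"
    proof -
      note h = uvw[THEN sub]
      have "l2ip cellM (weak_jacobian (\<lambda>x. u x + v x)) (weak_jacobian w) = l2ip cellM (\<lambda>x. weak_jacobian u x + weak_jacobian v x) (weak_jacobian w)"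
        using h by (intro l2ip_cong_AE cellM_AE H1_per0_add jm meas) (auto intro: borel_measurable_add meas)
      then show ?thesis using h by (simp add: l2ip_add_left jm)
    qed
    show "l2ip cellM (weak_jacobian (\<lambda>x. c *\<^sub>R u x)) (weak_jacobian w) = c * l2ip cellM (weak_jacobian u) (weak_jacobian w)"
      if uw: "u \<in> P" "w \<in> P"
    proof -
      note h = uw[THEN sub]
      have "l2ip cellM (weak_jacobian (\<lambda>x. c *\<^sub>R u x)) (weak_jacobian w) = l2ip cellM (\<lambda>x. c *\<^sub>R weak_jacobian u x) (weak_jacobian w)"
        using h by (intro l2ip_cong_AE cellM_AE H1_per0_scaleR jm meas) (auto intro: borel_measurable_scaleR meas)
      then show ?thesis by (simp add: l2ip_scaleR_left)
    qed
    show "l2ip cellM (weak_jacobian u) (weak_jacobian v) = l2ip cellM (weak_jacobian v) (weak_jacobian u)"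
      by (rule l2ip_commute)
    show "0 \<le> l2ip cellM (weak_jacobian u) (weak_jacobian u)" by (simp add: l2ip_self)
  next
    fix vs :: "nat \<Rightarrow> real ^ 'n \<Rightarrow> real ^ 'n"
    assume vs: "\<And>n. vs n \<in> P"
      and "\<And>e. e > 0 \<Longrightarrow> \<exists>N. \<forall>m\<ge>N. \<forall>n\<ge>N. sqrt (l2ip cellM (weak_jacobian (\<lambda>x. vs m x - vs n x)) (weak_jacobian (\<lambda>x. vs m x - vs n x))) < e"
    then have cau: "\<And>e. e > 0 \<Longrightarrow> \<exists>N. \<forall>m\<ge>N. \<forall>n\<ge>N. l2n cellM (weak_jacobian (\<lambda>x. vs m x - vs n x)) < e"
      by (simp add: l2ip_self)
    note h = vs[THEN sub]
    have cau1: "\<exists>N. \<forall>m\<ge>N. \<forall>n\<ge>N. l2n cellM (\<lambda>x. vs m x - vs n x) < e" if e: "e > 0" for e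
    proof -
      have le: "l2n cellM (\<lambda>x. vs m x - vs n x) \<le> l2n cellM (weak_jacobian (\<lambda>x. vs m x - vs n x))" for m n
        by (rule Poincare_H1_per0_le[OF H1_per0_diff(1)[OF h h]])
      obtain N where "\<And>m n. m \<ge> N \<Longrightarrow> n \<ge> N \<Longrightarrow> l2n cellM (weak_jacobian (\<lambda>x. vs m x - vs n x)) < e"
        using cau[OF e] by blast
      then show ?thesis using le_less_trans[OF le] by blast
    qed
    have cau2: "\<exists>N. \<forall>m\<ge>N. \<forall>n\<ge>N. l2n cellM (\<lambda>x. weak_jacobian (vs m) x - weak_jacobian (vs n) x) < e" if "e > 0" for e
      using cau[OF that] by (simp add: jd[OF h h])
    obtain v where v: "v \<in> L2_per" "(\<lambda>n. l2n cellM (\<lambda>x. vs n x - v x)) \<longlonglongrightarrow> 0"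
      using L2_per_complete[OF H1_per0D(1)[OF h] cau1] .
    obtain G where G: "G \<in> L2_per" "(\<lambda>n. l2n cellM (\<lambda>x. weak_jacobian (vs n) x - G x)) \<longlonglongrightarrow> 0"
      using L2_per_complete[OF H1_per0D(4)[OF h] cau2] .
    have vl: "(\<lambda>n. l2n cellM (\<lambda>x. vs n x $ i - v x $ i)) \<longlonglongrightarrow> 0" for i
    proof (rule tendsto_sandwich[OF _ _ tendsto_const v(2)])
      have "l2n cellM (\<lambda>x. (vs n x - v x) $ i) \<le> l2n cellM (\<lambda>x. vs n x - v x)" for n
        by (intro l2n_vec_nth_le sqint_diff L2_per_sqint H1_per0D h v)
      then show "\<forall>\<^sub>F n in sequentially. l2n cellM (\<lambda>x. vs n x $ i - v x $ i) \<le> l2n cellM (\<lambda>x. vs n x - v x)" by simp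
    qed simp
    have Gl: "(\<lambda>n. l2n cellM (\<lambda>x. weak_jacobian (vs n) x $ i $ j - G x $ i $ j)) \<longlonglongrightarrow> 0" for i j
    proof (rule tendsto_sandwich[OF _ _ tendsto_const G(2)])
      have "l2n cellM (\<lambda>x. (weak_jacobian (vs n) x - G x) $ i $ j) \<le> l2n cellM (\<lambda>x. weak_jacobian (vs n) x - G x)" for n
      proof -
        have s: "sqint cellM (\<lambda>x. weak_jacobian (vs n) x - G x)" by (intro sqint_diff L2_per_sqint H1_per0D h G)
        from l2n_vec_nth_le[OF sqint_vec_nth[OF s], of i j] l2n_vec_nth_le[OF s, of i] show ?thesis by linarith
      qed
      then show "\<forall>\<^sub>F n in sequentially. l2n cellM (\<lambda>x. weak_jacobian (vs n) x $ i $ j - G x $ i $ j) \<le> l2n cellM (\<lambda>x. weak_jacobian (vs n) x - G x)" by simp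
    qed simp
    have vc: "(\<lambda>x. v x $ i) \<in> L2_per" "(\<lambda>x. G x $ i $ j) \<in> L2_per" for i j
      by (intro L2_per_vec_nth v G)+
    have wp: "has_weak_partial j (\<lambda>x. v x $ i) (\<lambda>x. G x $ i $ j)" for i j
      by (rule has_weak_partial_closed[OF H1_per0D(2)[OF h] H1_per0D(3)[OF h] H1_per0D(5)[OF h] vc vl Gl])
    \<comment> \<open>Pairing with the constant 1 is continuous, so the vanishing mean passes to the
      limit.\<close>
    have mean: "(\<integral>x. v x $ i \<partial>cellM) = 0" for i
    proof -
      have "(\<lambda>n. l2ip cellM (\<lambda>x. vs n x $ i) (\<lambda>x. 1)) \<longlonglongrightarrow> l2ip cellM (\<lambda>x. v x $ i) (\<lambda>x. 1)"
        by (intro l2ip_tendsto L2_per_sqint H1_per0D(2) h vc vl L2_per_const) (simp add: l2n_def)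
      moreover have "l2ip cellM (\<lambda>x. vs n x $ i) (\<lambda>x. 1) = 0" for n
        using H1_per0D(6)[OF h] by (simp add: l2ip_def)
      ultimately show ?thesis by (simp add: LIMSEQ_const_iff l2ip_def)
    qed
    note v0 = H1_per0I[OF vc(1) vc(2) wp mean]
    have jl: "(\<lambda>n. l2n cellM (weak_jacobian (\<lambda>x. vs n x - v x))) \<longlonglongrightarrow> 0"
    proof -
      have "l2n cellM (weak_jacobian (\<lambda>x. vs n x - v x)) = l2n cellM (\<lambda>x. weak_jacobian (vs n) x - G x)" for n
      proof -
        have "AE x in lebesgue. weak_jacobian (\<lambda>x. vs n x - v x) x = weak_jacobian (vs n) x - G x"
          using H1_per0_diff(2)[OF h[of n] v0(1)] v0(2) by eventually_elim simp
        then show ?thesis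
          by (intro l2n_cong_AE cellM_AE meas H1_per0_diff h v0 borel_measurable_diff sqint_meas L2_per_sqint G)
      qed
      then show ?thesis using G(2) by simp
    qed
    have "(\<lambda>n. H1_norm (\<lambda>x. vs n x - v x)) \<longlonglongrightarrow> sqrt (0\<^sup>2 + 0\<^sup>2)"
      unfolding H1_norm_def L2_norm_eq by (intro tendsto_intros v(2) jl)
    then have hl: "(\<lambda>n. H1_norm (\<lambda>x. vs n x - v x)) \<longlonglongrightarrow> 0" by simp
    have "\<forall>vs v. (\<forall>k::nat. vs k \<in> P) \<and> v \<in> H1_per0 \<and> (\<lambda>k. H1_norm (\<lambda>x. vs k x - v x)) \<longlonglongrightarrow> 0 \<longrightarrow> v \<in> P"
      using P unfolding closed_subspace_H1_per0_def by (elim conjE)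
    from this[rule_format, of vs v] have "v \<in> P" using vs v0(1) hl by blast
    then show "\<exists>v\<in>P. (\<lambda>n. sqrt (l2ip cellM (weak_jacobian (\<lambda>x. vs n x - v x)) (weak_jacobian (\<lambda>x. vs n x - v x)))) \<longlonglongrightarrow> 0"
      using jl by (auto simp: l2ip_self)
  qed
qed

section \<open>The Cordes condition\<close>

lemma trace_inner: "trace A = (A :: real ^ 'n ^ 'n) \<bullet> mat 1"
  by (simp add: trace_def inner_vec_def mat_def if_distrib cong: if_cong)

lemma norm_mat_1: "(norm (mat 1 :: real ^ 'n ^ 'n))\<^sup>2 = real CARD('n)"
proof -
  have "(norm (mat 1 :: real ^ 'n ^ 'n))\<^sup>2 = trace (mat 1 :: real ^ 'n ^ 'n)"
    by (simp add: trace_inner power2_norm_eq_inner)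
  then show ?thesis by (simp add: trace_def mat_def)
qed

text \<open>With \<open>T = trace A\<close> and \<open>S = |A|^2 + |b|^2\<close> the left side is
  the quadratic \<open>\<gamma>^2 S - 2 \<gamma> T + n\<close>. The choice
  \<open>\<gamma> = T / S\<close> minimises it, with value \<open>n - T^2 / S\<close>, and the
  Cordes condition reads \<open>T^2 / S \<ge> n - 1 + \<delta>\<close>.\<close>

lemma Cordes_pointwise:
  fixes A :: "real ^ 'n ^ 'n" and b :: "real ^ 'n"
  assumes T: "0 < trace A" and d: "0 < real CARD('n) - 1 + \<delta>"
    and c: "((norm A)\<^sup>2 + (norm b)\<^sup>2) / (trace A)\<^sup>2 \<le> 1 / (real CARD('n) - 1 + \<delta>)"
  defines "\<gamma> \<equiv> trace A / ((norm A)\<^sup>2 + (norm b)\<^sup>2)"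
  shows "(norm (\<gamma> *\<^sub>R A - mat 1))\<^sup>2 + (norm (\<gamma> *\<^sub>R b))\<^sup>2 \<le> 1 - \<delta>"
proof -
  define S where "S = (norm A)\<^sup>2 + (norm b)\<^sup>2"
  have "A \<noteq> 0" using T by (auto simp: trace_def)
  then have S: "S > 0" by (simp add: S_def add_pos_nonneg)
  have "real CARD('n) - 1 + \<delta> \<le> (trace A)\<^sup>2 / S"
    using c T d S unfolding S_def[symmetric] by (simp add: field_simps)
  moreover have "(norm (\<gamma> *\<^sub>R A - mat 1))\<^sup>2 = \<gamma>\<^sup>2 * (norm A)\<^sup>2 - 2 * \<gamma> * trace A + real CARD('n)"
  proof -
    have "(\<gamma> *\<^sub>R A - mat 1) \<bullet> (\<gamma> *\<^sub>R A - mat 1) = \<gamma>\<^sup>2 * (A \<bullet> A) - 2 * \<gamma> * (A \<bullet> mat 1) + (mat 1 :: real ^ 'n ^ 'n) \<bullet> mat 1"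
      by (simp add: inner_diff_left inner_diff_right inner_commute[of "mat 1" A] power2_eq_square algebra_simps)
    then show ?thesis unfolding norm_mat_1[symmetric] trace_inner power2_norm_eq_inner .
  qed
  moreover have "\<gamma>\<^sup>2 * (norm A)\<^sup>2 + (norm (\<gamma> *\<^sub>R b))\<^sup>2 = \<gamma>\<^sup>2 * S"
    by (simp add: S_def power_mult_distrib algebra_simps)
  moreover have "\<gamma>\<^sup>2 * S = (trace A)\<^sup>2 / S" "\<gamma> * trace A = (trace A)\<^sup>2 / S"
  proof -
    have "\<gamma> = trace A / S" by (simp add: \<gamma>_def S_def)
    then show "\<gamma>\<^sup>2 * S = (trace A)\<^sup>2 / S" "\<gamma> * trace A = (trace A)\<^sup>2 / S"
      using S by (simp_all add: power2_eq_square)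
  qed
  ultimately show ?thesis by linarith
qed

text \<open>Under the root, the first factor is the pointwise Cordes bound; the second is 1 for the
  Jacobian plus the Poincare constant for the field itself.\<close>

definition contraction_const :: "real \<Rightarrow> real" where
  "contraction_const \<delta> = sqrt ((1 - \<delta>) * (1 + 1 / (2 * pi)\<^sup>2))"

text \<open>The threshold for \<open>\<delta>\<close> is equivalent to
  \<open>(1 - \<delta>) (1 + n / pi^2) < 1\<close>, where \<open>n / pi^2\<close> bounds the squared
  Poincare constant of a convex set of diameter \<open>sqrt n\<close>. The periodic constant
  \<open>1 / (2 pi)^2\<close> is smaller than this for every \<open>n\<close>.\<close>

lemma contraction_const_less_1:
  assumes d: "real CARD('n::finite) / (real CARD('n) + pi\<^sup>2) < \<delta>" and d1: "\<delta> \<le> 1"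
  shows "0 \<le> contraction_const \<delta>" "contraction_const \<delta> < 1"
proof -
  have n: "1 \<le> real CARD('n)" using zero_less_card_finite[where 'a='n] by linarith
  have p: "0 < pi\<^sup>2" by simp
  show "0 \<le> contraction_const \<delta>" using d1 by (simp add: contraction_const_def)
  have "1 - \<delta> < 1 - real CARD('n) / (real CARD('n) + pi\<^sup>2)" using d by simp
  also have "\<dots> = pi\<^sup>2 / (real CARD('n) + pi\<^sup>2)"
  proof -
    have "real CARD('n) + pi\<^sup>2 \<noteq> 0" using n p by linarith
    then show ?thesis by (simp add: diff_divide_eq_iff)
  qed
  also have "\<dots> \<le> pi\<^sup>2 / (1 + pi\<^sup>2)" using n p by (intro divide_left_mono mult_pos_pos add_pos_pos) auto
  finally have "(1 - \<delta>) * (1 + 1 / (2 * pi)\<^sup>2) < pi\<^sup>2 / (1 + pi\<^sup>2) * (1 + 1 / (2 * pi)\<^sup>2)"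
    by (intro mult_strict_right_mono) (auto intro: add_pos_nonneg)
  also have "\<dots> \<le> 1"
  proof -
    \<comment> \<open>With \<open>t = pi^2\<close> the product is
      \<open>(t + 1/4) / (t + 1)\<close>.\<close>
    have "t / (1 + t) * (1 + 1 / (4 * t)) \<le> 1" if t: "t > 0" for t :: real
    proof -
      have "t * (1 + 1 / (4 * t)) = t + 1 / 4" using t by (simp add: distrib_left)
      moreover have "t / (1 + t) * (1 + 1 / (4 * t)) = t * (1 + 1 / (4 * t)) / (1 + t)" by simp
      ultimately show ?thesis using t by simp
    qed
    from this[OF p] show ?thesis by (simp add: power_mult_distrib)
  qed
  finally show "contraction_const \<delta> < 1" by (simp add: contraction_const_def real_sqrt_lt_1_iff)
qed

definition residual ::
  "(real ^ 'n \<Rightarrow> real ^ 'n ^ 'n) \<Rightarrow> (real ^ 'n \<Rightarrow> real ^ 'n) \<Rightarrow> (real ^ 'n \<Rightarrow> real ^ 'n) \<Rightarrow> real ^ 'n \<Rightarrow> real" where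
  "residual A b w x = A_tilde A b x \<bullet> weak_jacobian w x + b_tilde A b x \<bullet> w x - weak_div w x"

lemma operator_eq: "A_tilde A b x \<bullet> weak_jacobian w x + b_tilde A b x \<bullet> w x = residual A b w x + weak_div w x"
  by (simp add: residual_def)

lemma weak_div_trace: "weak_div w x = trace (weak_jacobian w x)"
  by (simp add: weak_div_eq trace_def)

text \<open>The divergence is the inner product of the Jacobian with the identity matrix, so it can
  be absorbed into the coefficient, where the Cordes bound applies.\<close>

lemma residual_eq: "residual A b w x = (A_tilde A b x - mat 1) \<bullet> weak_jacobian w x + b_tilde A b x \<bullet> w x"
  by (simp add: residual_def weak_div_trace trace_inner inner_diff_left inner_commute[of "mat 1"])

section \<open>The perturbation of the inner product under the Cordes condition\<close>

locale cordes =
  fixes lam Lam \<delta> :: real and A :: "real ^ 'n \<Rightarrow> real ^ 'n ^ 'n" and b :: "real ^ 'n \<Rightarrow> real ^ 'n"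
  assumes setting: "setting_B lam Lam \<delta> A b"
begin

lemma delta: "real CARD('n) / (real CARD('n) + pi\<^sup>2) < \<delta>" "\<delta> \<le> 1"
  using setting by (auto simp: setting_B_def)

abbreviation q :: real where "q \<equiv> contraction_const \<delta>"

lemma q_bounds: "0 \<le> q" "q < 1"
  using contraction_const_less_1[OF delta] by auto

lemma coeff_bound: "AE x in lebesgue. (norm (A_tilde A b x - mat 1))\<^sup>2 + (norm (b_tilde A b x))\<^sup>2 \<le> 1 - \<delta>"
proof -
  have n: "1 \<le> real CARD('n)" using zero_less_card_finite[where 'a='n] by linarith
  have "0 \<le> real CARD('n) / (real CARD('n) + pi\<^sup>2)" by simp
  then have d: "0 < real CARD('n) - 1 + \<delta>" using delta n by linarith
  have lam: "0 < lam" using setting by (simp add: setting_B_def)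
  have "AE x in lebesgue. \<forall>\<xi>. lam * (\<xi> \<bullet> \<xi>) \<le> \<xi> \<bullet> (A x *v \<xi>) \<and> \<xi> \<bullet> (A x *v \<xi>) \<le> Lam * (\<xi> \<bullet> \<xi>)"
    "AE x in lebesgue. ((norm (A x))\<^sup>2 + (norm (b x))\<^sup>2) / (trace (A x))\<^sup>2 \<le> 1 / (real CARD('n) - 1 + \<delta>)"
    using setting by (auto simp: setting_B_def)
  then show ?thesis
  proof eventually_elim
    case (elim x)
    \<comment> \<open>Testing ellipticity with unit vectors bounds the diagonal from below, which
      makes the trace positive as \<open>Cordes_pointwise\<close> requires.\<close>
    have "lam \<le> A x $ i $ i" for i
      using elim(1)[rule_format, of "axis i 1"] by (simp add: inner_axis' matrix_vector_mult_basis column_def inner_axis_axis)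
    then have "(\<Sum>i\<in>(UNIV :: 'n set). lam) \<le> trace (A x)" unfolding trace_def by (intro sum_mono)
    moreover have "0 < (\<Sum>i\<in>(UNIV :: 'n set). lam)" using lam by (intro sum_pos) auto
    ultimately have "0 < trace (A x)" by linarith
    from Cordes_pointwise[OF this d elim(2)] show ?case
      by (simp add: A_tilde_def b_tilde_def renorm_def)
  qed
qed

lemma coeff_measurable: "A_tilde A b \<in> borel_measurable lebesgue" "b_tilde A b \<in> borel_measurable lebesgue"
proof -
  have m: "A \<in> borel_measurable lebesgue" "b \<in> borel_measurable lebesgue"
    using setting by (auto simp: setting_B_def Linf_per_def)
  have "(\<lambda>x. trace (A x)) \<in> borel_measurable lebesgue"
    unfolding trace_def by (intro borel_measurable_sum borel_measurable_vec_nth m)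
  then have "renorm A b \<in> borel_measurable lebesgue"
    unfolding renorm_def[abs_def] using m by (auto intro!: borel_measurable_divide borel_measurable_add borel_measurable_power)
  then show "A_tilde A b \<in> borel_measurable lebesgue" "b_tilde A b \<in> borel_measurable lebesgue"
    unfolding A_tilde_def[abs_def] b_tilde_def[abs_def] using m by (auto intro: borel_measurable_scaleR)
qed

lemma residual_bound:
  assumes w: "w \<in> H1_per0"
  shows "sqint cellM (residual A b w)" "l2n cellM (residual A b w) \<le> q * l2n cellM (weak_jacobian w)"
proof -
  note d = H1_per0D[OF w]
  have sw: "sqint cellM w" "sqint cellM (weak_jacobian w)" by (intro L2_per_sqint d)+
  have m: "residual A b w \<in> borel_measurable cellM"
    unfolding residual_eq[abs_def]
    by (intro borel_measurable_add borel_measurable_inner borel_measurable_diff borel_measurable_const sqint_meas sw cellM_measurable coeff_measurable)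
  have ae: "AE x in cellM. (residual A b w x)\<^sup>2 \<le> (1 - \<delta>) * ((norm (weak_jacobian w x))\<^sup>2 + (norm (w x))\<^sup>2)"
    using cellM_AE[OF coeff_bound]
  proof eventually_elim
    case (elim x)
    let ?a = "norm (A_tilde A b x - mat 1)" and ?c = "norm (b_tilde A b x)" and ?X = "norm (weak_jacobian w x)" and ?Y = "norm (w x)"
    have "\<bar>residual A b w x\<bar> \<le> ?a * ?X + ?c * ?Y"
      unfolding residual_eq
      using Cauchy_Schwarz_ineq2[of "A_tilde A b x - mat 1" "weak_jacobian w x"] Cauchy_Schwarz_ineq2[of "b_tilde A b x" "w x"] by linarith
    then have "(residual A b w x)\<^sup>2 \<le> (?a * ?X + ?c * ?Y)\<^sup>2" by (rule abs_le_square_iff[THEN iffD1, OF order_trans]) simp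
    \<comment> \<open>Cauchy-Schwarz in the plane, by Lagrange's identity. Treating both products
      together preserves the sum of squares that the Cordes condition controls.\<close>
    also have "\<dots> \<le> (?a\<^sup>2 + ?c\<^sup>2) * (?X\<^sup>2 + ?Y\<^sup>2)"
    proof -
      have "(?a\<^sup>2 + ?c\<^sup>2) * (?X\<^sup>2 + ?Y\<^sup>2) - (?a * ?X + ?c * ?Y)\<^sup>2 = (?a * ?Y - ?c * ?X)\<^sup>2"
        by (simp add: power2_eq_square algebra_simps)
      then show ?thesis by (metis diff_ge_0_iff_ge zero_le_power2)
    qed
    also have "\<dots> \<le> (1 - \<delta>) * (?X\<^sup>2 + ?Y\<^sup>2)" using elim by (intro mult_right_mono) auto
    finally show ?case .
  qed
  have i: "integrable cellM (\<lambda>x. (1 - \<delta>) * ((norm (weak_jacobian w x))\<^sup>2 + (norm (w x))\<^sup>2))"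
    using sw by (simp add: sqint_def)
  have i2: "integrable cellM (\<lambda>x. (residual A b w x)\<^sup>2)"
  proof (rule Bochner_Integration.integrable_bound[OF i])
    show "AE x in cellM. norm ((residual A b w x)\<^sup>2) \<le> norm ((1 - \<delta>) * ((norm (weak_jacobian w x))\<^sup>2 + (norm (w x))\<^sup>2))"
      using ae by eventually_elim simp
  qed (use m in simp)
  then show "sqint cellM (residual A b w)" using m by (simp add: sqint_def)
  have "(l2n cellM (residual A b w))\<^sup>2 = (\<integral>x. (residual A b w x)\<^sup>2 \<partial>cellM)" by (simp add: l2n_def)
  also have "\<dots> \<le> (\<integral>x. (1 - \<delta>) * ((norm (weak_jacobian w x))\<^sup>2 + (norm (w x))\<^sup>2) \<partial>cellM)"
    by (rule integral_mono_AE[OF i2 i ae])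
  also have "\<dots> = (1 - \<delta>) * ((l2n cellM (weak_jacobian w))\<^sup>2 + (l2n cellM w)\<^sup>2)"
    using sw by (simp add: sqint_def l2n_def)
  also have "\<dots> \<le> (1 - \<delta>) * ((l2n cellM (weak_jacobian w))\<^sup>2 + (l2n cellM (weak_jacobian w))\<^sup>2 / (2 * pi)\<^sup>2)"
    using Poincare_H1_per0[OF w] delta by (intro mult_left_mono add_left_mono) (auto simp: field_simps)
  also have "\<dots> = (1 - \<delta>) * (1 + 1 / (2 * pi)\<^sup>2) * (l2n cellM (weak_jacobian w))\<^sup>2" by (simp add: distrib_right distrib_left)
  also have "\<dots> = (q * l2n cellM (weak_jacobian w))\<^sup>2"
    using delta by (simp add: contraction_const_def power_mult_distrib)
  finally show "l2n cellM (residual A b w) \<le> q * l2n cellM (weak_jacobian w)"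
    by (rule power2_le_imp_le) (simp add: q_bounds)
qed

lemma residual_linear:
  assumes v: "v \<in> H1_per0" and w: "w \<in> H1_per0"
  shows "AE x in cellM. residual A b (\<lambda>x. v x + w x) x = residual A b v x + residual A b w x"
    "AE x in cellM. residual A b (\<lambda>x. c *\<^sub>R v x) x = c * residual A b v x"
    "AE x in cellM. weak_div (\<lambda>x. v x + w x) x = weak_div v x + weak_div w x"
    "AE x in cellM. weak_div (\<lambda>x. c *\<^sub>R v x) x = c * weak_div v x"
    "AE x in cellM. weak_div (\<lambda>x. v x - w x) x = weak_div v x - weak_div w x"
proof -
  note a = cellM_AE[OF H1_per0_add(2)[OF v w]] and s = cellM_AE[OF H1_per0_scaleR(2)[OF v, of c]]
  show "AE x in cellM. residual A b (\<lambda>x. v x + w x) x = residual A b v x + residual A b w x"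
    using a by eventually_elim (simp add: residual_eq inner_add_right)
  show "AE x in cellM. residual A b (\<lambda>x. c *\<^sub>R v x) x = c * residual A b v x"
    using s by eventually_elim (simp add: residual_eq distrib_left)
  show "AE x in cellM. weak_div (\<lambda>x. v x + w x) x = weak_div v x + weak_div w x"
    using a by eventually_elim (simp add: weak_div_eq sum.distrib)
  show "AE x in cellM. weak_div (\<lambda>x. c *\<^sub>R v x) x = c * weak_div v x"
    using s by eventually_elim (simp add: weak_div_eq sum_distrib_left)
  show "AE x in cellM. weak_div (\<lambda>x. v x - w x) x = weak_div v x - weak_div w x"
    using cellM_AE[OF H1_per0_diff(2)[OF v w]] by eventually_elim (simp add: weak_div_eq sum_subtractf)
qed

definition R :: "(real ^ 'n \<Rightarrow> real ^ 'n) \<Rightarrow> (real ^ 'n \<Rightarrow> real ^ 'n) \<Rightarrow> real" where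
  "R v w = l2ip cellM (weak_div v) (residual A b w)"

lemma R_bound:
  assumes v: "v \<in> H1_per0" and w: "w \<in> H1_per0"
  shows "\<bar>R v w\<bar> \<le> q * l2n cellM (weak_jacobian v) * l2n cellM (weak_jacobian w)"
proof -
  have "\<bar>R v w\<bar> \<le> l2n cellM (weak_div v) * l2n cellM (residual A b w)"
    unfolding R_def by (intro l2_Cauchy_Schwarz weak_div_sqint residual_bound v w)
  also have "\<dots> \<le> l2n cellM (weak_jacobian v) * (q * l2n cellM (weak_jacobian w))"
    by (intro mult_mono weak_div_le residual_bound v w) auto
  finally show ?thesis by (simp add: mult_ac)
qed

lemma R_linear:
  assumes z: "z \<in> H1_per0" and v: "v \<in> H1_per0" and w: "w \<in> H1_per0"
  shows "R z (\<lambda>x. v x + w x) = R z v + R z w" "R z (\<lambda>x. c *\<^sub>R v x) = c * R z v"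
    "R (\<lambda>x. v x - w x) z = R v z - R w z"
proof -
  note s = residual_bound(1)[OF z] residual_bound(1)[OF v] residual_bound(1)[OF w]
    weak_div_sqint(2)[OF z] weak_div_sqint(2)[OF v] weak_div_sqint(2)[OF w]
  have "R z (\<lambda>x. v x + w x) = l2ip cellM (weak_div z) (\<lambda>x. residual A b v x + residual A b w x)"
    unfolding R_def
    by (intro l2ip_cong_AE residual_linear v w s residual_bound H1_per0_add sqint_meas sqint_add) auto
  then show "R z (\<lambda>x. v x + w x) = R z v + R z w"
    using s by (simp add: R_def l2ip_commute[of _ "weak_div z"] l2ip_add_left)
  have "R z (\<lambda>x. c *\<^sub>R v x) = l2ip cellM (weak_div z) (\<lambda>x. c * residual A b v x)"
    unfolding R_def
    by (intro l2ip_cong_AE residual_linear(2)[OF v v] s residual_bound H1_per0_scaleR v sqint_meas sqint_cmult) auto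
  then show "R z (\<lambda>x. c *\<^sub>R v x) = c * R z v"
    using l2ip_scaleR_left[of cellM c "residual A b v" "weak_div z"] by (simp add: R_def l2ip_commute[of _ "weak_div z"])
  have "R (\<lambda>x. v x - w x) z = l2ip cellM (\<lambda>x. weak_div v x - weak_div w x) (residual A b z)"
    unfolding R_def
    by (intro l2ip_cong_AE residual_linear v w s weak_div_sqint H1_per0_diff sqint_meas sqint_diff) auto
  then show "R (\<lambda>x. v x - w x) z = R v z - R w z"
    using s by (simp add: R_def l2ip_diff_left)
qed

lemma operator_sqint:
  assumes "w \<in> H1_per0"
  shows "sqint cellM (\<lambda>x. A_tilde A b x \<bullet> weak_jacobian w x + b_tilde A b x \<bullet> w x)"
  unfolding operator_eq by (intro sqint_add residual_bound weak_div_sqint assms)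

lemma B2_eq:
  assumes v: "v \<in> H1_per0" and w: "w \<in> H1_per0"
  shows "B2 A b v w = l2ip cellM (weak_jacobian v) (weak_jacobian w) + R v w"
proof -
  have "(\<integral>x. weak_div v x * (residual A b w x + weak_div w x) \<partial>cellM) = R v w + l2ip cellM (weak_div v) (weak_div w)"
    using sqint_mult_integrable[OF weak_div_sqint(2)[OF v] residual_bound(1)[OF w]]
      sqint_mult_integrable[OF weak_div_sqint(2)[OF v] weak_div_sqint(2)[OF w]]
    by (simp add: R_def l2ip_def distrib_left)
  then show ?thesis unfolding B2_def operator_eq using div_curl_identity[OF v w] by simp
qed

text \<open>A divergence has mean zero over the cell, so only the residual contributes; this is how
  the load inherits the factor \<open>q\<close>.\<close>

lemma rhs_eq: "w \<in> H1_per0 \<Longrightarrow> rhs A b w = l2ip cellM (\<lambda>x. 1) (residual A b w)"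
proof -
  assume w: "w \<in> H1_per0"
  have "(\<integral>x. weak_div w x \<partial>cellM) = 0"
    unfolding weak_div_eq
    using integral_weak_jacobian[OF w] sqint_cell_integrable[OF L2_per_sqint[OF H1_per0D(3)[OF w]]] by simp
  then show ?thesis
    unfolding rhs_def operator_eq
    using sqint_cell_integrable[OF residual_bound(1)[OF w]] sqint_cell_integrable[OF weak_div_sqint(2)[OF w]]
    by (simp add: l2ip_def)
qed

lemma one_sqint: "sqint (cellM :: (real ^ 'n) measure) (\<lambda>x. 1 :: real)"
  by (rule L2_per_sqint[OF L2_per_const])

lemma l2n_one: "l2n (cellM :: (real ^ 'n) measure) (\<lambda>x. 1 :: real) = 1"
  by (simp add: l2n_def)

lemma rhs_bound: "w \<in> H1_per0 \<Longrightarrow> \<bar>rhs A b w\<bar> \<le> q * l2n cellM (weak_jacobian w)"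
  using l2_Cauchy_Schwarz[OF one_sqint residual_bound(1), of w] residual_bound(2)[of w]
  by (simp add: rhs_eq l2n_one)

lemma rhs_linear:
  assumes v: "v \<in> H1_per0" and w: "w \<in> H1_per0"
  shows "rhs A b (\<lambda>x. v x + w x) = rhs A b v + rhs A b w" "rhs A b (\<lambda>x. c *\<^sub>R v x) = c * rhs A b v"
proof -
  note s = residual_bound(1)[OF v] residual_bound(1)[OF w]
  have "rhs A b (\<lambda>x. v x + w x) = l2ip cellM (\<lambda>x. 1) (\<lambda>x. residual A b v x + residual A b w x)"
    unfolding rhs_eq[OF H1_per0_add(1)[OF v w]]
    by (intro l2ip_cong_AE residual_linear v w s residual_bound H1_per0_add sqint_meas sqint_add one_sqint) auto
  then show "rhs A b (\<lambda>x. v x + w x) = rhs A b v + rhs A b w"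
    using s by (simp add: rhs_eq v w l2ip_commute[of _ "\<lambda>x. 1"] l2ip_add_left one_sqint)
  have "rhs A b (\<lambda>x. c *\<^sub>R v x) = l2ip cellM (\<lambda>x. 1) (\<lambda>x. c * residual A b v x)"
    unfolding rhs_eq[OF H1_per0_scaleR(1)[OF v]]
    by (intro l2ip_cong_AE residual_linear(2)[OF v v] s residual_bound H1_per0_scaleR v sqint_meas sqint_cmult one_sqint) auto
  then show "rhs A b (\<lambda>x. c *\<^sub>R v x) = c * rhs A b v"
    using l2ip_scaleR_left[of cellM c "residual A b v" "\<lambda>x. 1"] by (simp add: rhs_eq v l2ip_commute[of _ "\<lambda>x. 1"])
qed

section \<open>Coercivity, boundedness and solvability of the discrete problem\<close>

lemma B2_coercive:
  assumes v: "v \<in> H1_per0"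
  shows "(1 - q) * (l2n cellM (weak_jacobian v))\<^sup>2 \<le> B2 A b v v"
  using R_bound[OF v v] by (simp add: B2_eq v l2ip_self power2_eq_square algebra_simps abs_le_iff)

lemma B2_bounded:
  assumes v: "v \<in> H1_per0" and w: "w \<in> H1_per0"
  shows "\<bar>B2 A b v w\<bar> \<le> (1 + q) * l2n cellM (weak_jacobian v) * l2n cellM (weak_jacobian w)"
proof -
  have "\<bar>l2ip cellM (weak_jacobian v) (weak_jacobian w)\<bar> \<le> l2n cellM (weak_jacobian v) * l2n cellM (weak_jacobian w)"
    by (intro l2_Cauchy_Schwarz L2_per_sqint H1_per0D v w)
  then show ?thesis using R_bound[OF v w] by (simp add: B2_eq v w algebra_simps abs_le_iff)
qed

lemma B2_linear:
  assumes z: "z \<in> H1_per0" and v: "v \<in> H1_per0" and w: "w \<in> H1_per0"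
  shows "B2 A b (\<lambda>x. v x - w x) z = B2 A b v z - B2 A b w z"
    "B2 A b z (\<lambda>x. v x + w x) = B2 A b z v + B2 A b z w"
proof -
  have s: "sqint cellM (weak_jacobian u)" if "u \<in> H1_per0" for u :: "real ^ 'n \<Rightarrow> real ^ 'n"
    by (intro L2_per_sqint H1_per0D that)
  have "l2ip cellM (weak_jacobian (\<lambda>x. v x - w x)) (weak_jacobian z) = l2ip cellM (\<lambda>x. weak_jacobian v x - weak_jacobian w x) (weak_jacobian z)"
    by (intro l2ip_cong_AE cellM_AE H1_per0_diff v w z s sqint_meas sqint_diff) auto
  then show "B2 A b (\<lambda>x. v x - w x) z = B2 A b v z - B2 A b w z"
    by (simp add: B2_eq H1_per0_diff v w z R_linear(3) l2ip_diff_left s)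
  have "l2ip cellM (weak_jacobian z) (weak_jacobian (\<lambda>x. v x + w x)) = l2ip cellM (weak_jacobian z) (\<lambda>x. weak_jacobian v x + weak_jacobian w x)"
    by (intro l2ip_cong_AE cellM_AE H1_per0_add v w z s sqint_meas sqint_add) auto
  then show "B2 A b z (\<lambda>x. v x + w x) = B2 A b z v + B2 A b z w"
    by (simp add: B2_eq H1_per0_add v w z R_linear(1) l2ip_commute[of _ "weak_jacobian z"] l2ip_add_left s)
qed

lemma discrete_solution:
  assumes P: "closed_subspace_H1_per0 P"
  shows "\<exists>z\<in>P. \<forall>w\<in>P. B2 A b z w = rhs A b w"
proof -
  interpret semi_hilbert P "\<lambda>v w. l2ip cellM (weak_jacobian v) (weak_jacobian w)"
    by (rule closed_subspace_semi_hilbert[OF P])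
  have sub: "v \<in> P \<Longrightarrow> v \<in> H1_per0" for v using P by (auto simp: closed_subspace_H1_per0_def)
  have n: "nrm v = l2n cellM (weak_jacobian v)" for v by (simp add: nrm_def l2ip_self)
  have "\<exists>z\<in>P. \<forall>w\<in>P. l2ip cellM (weak_jacobian z) (weak_jacobian w) + R z w = rhs A b w"
    by (rule Lax_Milgram[where q=q and K=q]) (simp_all add: n sub rhs_linear(1) rhs_linear(2)[OF sub sub] rhs_bound R_linear(1,3) R_linear(2)[OF sub sub sub] R_bound q_bounds)
  then show ?thesis using B2_eq sub by metis
qed

text \<open>These facts make \<open>\<phi>\<close> admissible in the very weak problem and its
  gradient admissible in the equation for \<open>\<rho>\<close>, with all chosen weak derivatives
  identified with the classical ones almost everywhere.\<close>

lemma trig_gradient: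
  assumes t: "\<phi> \<in> trig"
  defines "w \<equiv> (\<lambda>x. \<chi> i. partial_deriv i \<phi> x)" and "G \<equiv> (\<lambda>x. \<chi> i j. partial_deriv j (partial_deriv i \<phi>) x)"
  shows "w \<in> H1_per0" "AE x in lebesgue. weak_jacobian w x = G x"
    "\<phi> \<in> H2_per" "AE x in lebesgue. weak_grad \<phi> x = w x" "AE x in lebesgue. weak_hessian \<phi> x = G x"
    "weak_grad \<phi> \<in> borel_measurable lebesgue" "weak_hessian \<phi> \<in> borel_measurable lebesgue"
proof -
  have t1: "partial_deriv i \<phi> \<in> trig" and t2: "partial_deriv j (partial_deriv i \<phi>) \<in> trig" for i j
    by (intro trig_partial t)+
  have a: "(\<lambda>x. w x $ i) \<in> L2_per" "(\<lambda>x. G x $ i $ j) \<in> L2_per" for i j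
    using trig_L2[OF t1] trig_L2[OF t2] by (simp_all add: w_def G_def)
  have p: "has_weak_partial j (\<lambda>x. w x $ i) (\<lambda>x. G x $ i $ j)" for i j
    using smooth_has_weak_partial[OF trig_smooth[OF t1]] by (simp add: w_def G_def)
  have m: "(\<integral>x. w x $ i \<partial>cellM) = 0" for i
    using integral_periodic_partial[OF trig_elem_smooth[OF t] trig_periodic[OF t]] by (simp add: w_def)
  show "w \<in> H1_per0" "AE x in lebesgue. weak_jacobian w x = G x" by (rule H1_per0I[OF a p m])+
  have hp: "has_weak_partial i \<phi> (partial_deriv i \<phi>)" for i by (rule smooth_has_weak_partial[OF trig_smooth[OF t]])
  have h1: "\<phi> \<in> H1_per" by (rule H1_perI[OF trig_L2[OF t] trig_L2[OF t1] hp])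
  note wp = H1_perD(2,3)[OF h1] and wpe = weak_partial_eq(2)[OF hp]
  have hp2: "has_weak_partial j (weak_partial i \<phi>) (partial_deriv j (partial_deriv i \<phi>))" for i j
    by (rule has_weak_partial_cong[OF smooth_has_weak_partial[OF trig_smooth[OF t1]]])
       (use wpe[of i] in \<open>auto intro!: L2_per_loc_integrable wp trig_L2 t2\<close>)
  have h2: "weak_partial i \<phi> \<in> H1_per" for i by (rule H1_perI[OF wp(2) trig_L2[OF t2] hp2])
  show "\<phi> \<in> H2_per" using h1 h2 by (simp add: H2_per_def)
  have "AE x in lebesgue. \<forall>i. weak_partial i \<phi> x = partial_deriv i \<phi> x" unfolding AE_all_countable using wpe by blast
  then show "AE x in lebesgue. weak_grad \<phi> x = w x" by eventually_elim (simp add: weak_grad_def w_def)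
  have "AE x in lebesgue. \<forall>i j. weak_partial i (weak_partial j \<phi>) x = partial_deriv i (partial_deriv j \<phi>) x"
    unfolding AE_all_countable using weak_partial_eq(2)[OF hp2] by blast
  \<comment> \<open>Entry \<open>(i, j)\<close> of the Hessian takes the derivative in direction
    \<open>j\<close> before that in direction \<open>i\<close>, the Jacobian of the gradient the
    other way round; hence the appeal to commutation.\<close>
  then show "AE x in lebesgue. weak_hessian \<phi> x = G x"
    by eventually_elim (simp add: weak_hessian_def G_def vec_eq_iff, metis trig_partial_commute[OF t])
  show "weak_grad \<phi> \<in> borel_measurable lebesgue"
    by (rule borel_measurable_vecI) (use wp(2) in \<open>simp add: weak_grad_def L2_per_iff\<close>)
  show "weak_hessian \<phi> \<in> borel_measurable lebesgue"
    by (intro borel_measurable_vecI) (use H1_perD(3)[OF h2] in \<open>simp add: weak_hessian_def L2_per_iff\<close>)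
qed

text \<open>The estimate is made for the potential with Laplacian \<open>fsum N s\<close>, and
  \<open>N\<close> tends to infinity afterwards. On gradients the curl term of the div-curl identity
  vanishes, so Jacobian and Laplacian have equal norms and the residual is at most \<open>q\<close>
  times the norm of \<open>fsum N s\<close>.\<close>

lemma very_weak_solution_eq:
  assumes \<rho>: "\<rho> \<in> H1_per0" "\<And>w. w \<in> H1_per0 \<Longrightarrow> B2 A b \<rho> w = rhs A b w"
    and r: "normalized_very_weak_solution A b r"
  shows "AE x in cellM. r x = 1 - weak_div \<rho> x"
proof -
  define s where "s x = r x - (1 - weak_div \<rho> x)" for x
  have rL: "r \<in> L2_per" and r1: "(\<integral>x. r x \<partial>cellM) = 1"
    and rt: "\<And>\<phi>. \<phi> \<in> H2_per \<Longrightarrow> (\<integral>x. r x * (A_tilde A b x \<bullet> weak_hessian \<phi> x + b_tilde A b x \<bullet> weak_grad \<phi> x) \<partial>cellM) = 0"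
    using r by (auto simp: normalized_very_weak_solution_def)
  note rs = L2_per_sqint[OF rL] and ds = weak_div_sqint(2)[OF \<rho>(1)]
  have ss: "sqint cellM s" unfolding s_def[abs_def] by (intro sqint_diff rs ds one_sqint)
  have d0: "(\<integral>x. weak_div \<rho> x \<partial>cellM) = 0"
    unfolding weak_div_eq
    using integral_weak_jacobian[OF \<rho>(1)] sqint_cell_integrable[OF L2_per_sqint[OF H1_per0D(3)[OF \<rho>(1)]]] by simp
  have s0: "(\<integral>x. s x \<partial>cellM) = 0"
    unfolding s_def using sqint_cell_integrable[OF rs] sqint_cell_integrable[OF ds] sqint_cell_integrable[OF one_sqint] r1 d0 by simp
  have main: "l2ip cellM s (fsum N s) \<le> q * l2n cellM s * l2n cellM (fsum N s)" for N
  proof -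
    let ?\<phi> = "inv_laplace N s"
    define w where "w = (\<lambda>x. \<chi> i. partial_deriv i ?\<phi> x)"
    define G where "G = (\<lambda>x. \<chi> i j. partial_deriv j (partial_deriv i ?\<phi>) x)"
    note t = inv_laplace_trig[of N s]
    note g = trig_gradient[OF t, folded w_def G_def]
    have g2: "AE x in cellM. weak_jacobian w x = G x" using cellM_AE[OF g(2)] by (simp add: G_def)
    have g4: "AE x in cellM. weak_grad ?\<phi> x = w x" using cellM_AE[OF g(4)] by (simp add: w_def)
    have g5: "AE x in cellM. weak_hessian ?\<phi> x = G x" using cellM_AE[OF g(5)] by (simp add: G_def)
    let ?T = "\<lambda>x. A_tilde A b x \<bullet> weak_jacobian w x + b_tilde A b x \<bullet> w x"
    have Ts: "sqint cellM ?T" by (rule operator_sqint[OF g(1)])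
    have sym: "transpose (G x) = G x" for x
      using trig_partial_commute[OF t] by (simp add: G_def transpose_def vec_eq_iff)
    have curl: "AE x in cellM. weak_jacobian w x - transpose (weak_jacobian w x) = 0"
      using g2 by eventually_elim (simp add: sym)
    have curl0: "(\<integral>x. (weak_jacobian u x - transpose (weak_jacobian u x)) \<bullet> (weak_jacobian w x - transpose (weak_jacobian w x)) \<partial>cellM) = 0" for u
      by (rule integral_eq_zero_AE) (use curl in eventually_elim, simp)
    have "(\<integral>x. r x * ?T x \<partial>cellM) = (\<integral>x. r x * (A_tilde A b x \<bullet> weak_hessian ?\<phi> x + b_tilde A b x \<bullet> weak_grad ?\<phi> x) \<partial>cellM)"
    proof (rule integral_cong_AE)
      show "(\<lambda>x. r x * ?T x) \<in> borel_measurable cellM"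
        by (intro borel_measurable_times sqint_meas rs Ts)
      show "(\<lambda>x. r x * (A_tilde A b x \<bullet> weak_hessian ?\<phi> x + b_tilde A b x \<bullet> weak_grad ?\<phi> x)) \<in> borel_measurable cellM"
        by (intro borel_measurable_times borel_measurable_add borel_measurable_inner sqint_meas rs cellM_measurable coeff_measurable g)
      show "AE x in cellM. r x * ?T x = r x * (A_tilde A b x \<bullet> weak_hessian ?\<phi> x + b_tilde A b x \<bullet> weak_grad ?\<phi> x)"
        using g2 g4 g5 by eventually_elim simp
    qed
    then have rT: "l2ip cellM r ?T = 0" using rt[OF g(3)] by (simp add: l2ip_def)
    \<comment> \<open>Since \<open>w\<close> is a gradient, \<open>B2 A b \<rho> w\<close> reduces
      to its first integral.\<close>
    have "l2ip cellM (weak_div \<rho>) ?T = l2ip cellM (\<lambda>x. 1) ?T"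
      using \<rho>(2)[OF g(1)] curl0[of \<rho>] by (simp add: B2_def rhs_def l2ip_def)
    then have "l2ip cellM s ?T = 0"
      unfolding s_def[abs_def] using rT by (simp add: l2ip_diff_left sqint_diff rs ds one_sqint Ts)
    moreover have "l2ip cellM s ?T = l2ip cellM s (residual A b w) + l2ip cellM s (weak_div w)"
      unfolding operator_eq l2ip_commute[of cellM s] by (intro l2ip_add_left residual_bound weak_div_sqint g ss)
    moreover have "\<bar>l2ip cellM s (residual A b w)\<bar> \<le> l2n cellM s * l2n cellM (residual A b w)"
      by (intro l2_Cauchy_Schwarz ss residual_bound g)
    moreover have "l2n cellM s * l2n cellM (residual A b w) \<le> l2n cellM s * (q * l2n cellM (weak_jacobian w))"
      by (intro mult_left_mono residual_bound g) simp
    moreover have "l2n cellM (weak_jacobian w) = l2n cellM (weak_div w)"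
      using div_curl_identity[OF g(1) g(1)] curl0[of w] by (simp add: l2ip_self)
    moreover have dv: "AE x in cellM. weak_div w x = fsum N s x"
      using g2
    proof eventually_elim
      case (elim x)
      have "weak_div w x = (\<Sum>i\<in>UNIV. partial_deriv i (partial_deriv i ?\<phi>) x)"
        unfolding weak_div_eq elim by (simp add: G_def)
      then show ?case using laplace_inv_laplace[OF s0] by simp
    qed
    moreover have "l2n cellM (weak_div w) = l2n cellM (fsum N s)"
      by (intro l2n_cong_AE dv sqint_meas weak_div_sqint g fsum_sqint)
    moreover have "l2ip cellM s (weak_div w) = l2ip cellM s (fsum N s)"
      by (intro l2ip_cong_AE dv sqint_meas weak_div_sqint g fsum_sqint ss) auto
    ultimately show ?thesis by (simp add: mult_ac abs_le_iff)
  qed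
  have l1: "(\<lambda>N. l2ip cellM s (fsum N s)) \<longlonglongrightarrow> l2ip cellM s s"
    by (intro l2ip_tendsto ss fsum_sqint fsum_tendsto) (simp add: l2n_def)
  have "(\<lambda>N. l2ip cellM (fsum N s) (fsum N s)) \<longlonglongrightarrow> l2ip cellM s s"
    by (intro l2ip_tendsto ss fsum_sqint fsum_tendsto)
  then have "(\<lambda>N. sqrt (l2ip cellM (fsum N s) (fsum N s))) \<longlonglongrightarrow> sqrt (l2ip cellM s s)" by (rule tendsto_real_sqrt)
  then have "(\<lambda>N. l2n cellM (fsum N s)) \<longlonglongrightarrow> l2n cellM s" by (simp add: l2ip_self)
  then have l2: "(\<lambda>N. q * l2n cellM s * l2n cellM (fsum N s)) \<longlonglongrightarrow> q * l2n cellM s * l2n cellM s" by (intro tendsto_mult tendsto_const)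
  have "l2ip cellM s s \<le> q * l2n cellM s * l2n cellM s"
    by (rule LIMSEQ_le[OF l1 l2]) (use main in blast)
  then have "(1 - q) * (l2n cellM s)\<^sup>2 \<le> 0" by (simp add: l2ip_self power2_eq_square algebra_simps)
  then have "(l2n cellM s)\<^sup>2 \<le> 0" using q_bounds by (simp add: mult_le_0_iff)
  then have "l2n cellM s = 0" by simp
  from l2n_eq_0_AE[OF ss this] show ?thesis by eventually_elim (simp add: s_def)
qed

section \<open>Error estimate and uniqueness for the discrete solution\<close>

lemma quasi_optimality:
  assumes P: "closed_subspace_H1_per0 P" and \<rho>: "\<rho> \<in> H1_per0" "\<And>w. w \<in> H1_per0 \<Longrightarrow> B2 A b \<rho> w = rhs A b w"
    and z: "z \<in> P" "\<And>w. w \<in> P \<Longrightarrow> B2 A b z w = rhs A b w" and w: "w \<in> P"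
  shows "l2n cellM (weak_jacobian (\<lambda>x. \<rho> x - z x)) \<le> (1 + q) / (1 - q) * l2n cellM (weak_jacobian (\<lambda>x. \<rho> x - w x))"
proof -
  have sub: "v \<in> P \<Longrightarrow> v \<in> H1_per0" for v using P by (auto simp: closed_subspace_H1_per0_def)
  let ?e = "\<lambda>x. \<rho> x - z x" and ?d = "\<lambda>x. \<rho> x - w x" and ?f = "\<lambda>x. w x - z x"
  interpret semi_hilbert P "\<lambda>v w. l2ip cellM (weak_jacobian v) (weak_jacobian w)"
    by (rule closed_subspace_semi_hilbert[OF P])
  have f: "?f \<in> P" by (intro diff w z)
  have e: "?e \<in> H1_per0" "?d \<in> H1_per0" "?f \<in> H1_per0" by (intro H1_per0_diff \<rho> sub z w f)+
  \<comment> \<open>Galerkin orthogonality: \<open>\<rho>\<close> and \<open>z\<close> satisfy the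
    same equation for test fields in \<open>P\<close>. As \<open>?e\<close> is the sum of
    \<open>?d\<close> and \<open>?f\<close>, the second argument can be changed from
    \<open>?e\<close> to \<open>?d\<close>.\<close>
  have "B2 A b ?e ?f = 0" using \<rho>(2)[OF e(3)] z(2)[OF f] by (simp add: B2_linear(1) e \<rho> sub z)
  moreover have "B2 A b ?e (\<lambda>x. ?d x + ?f x) = B2 A b ?e ?d + B2 A b ?e ?f" by (rule B2_linear(2)[OF e])
  ultimately have "B2 A b ?e ?e = B2 A b ?e ?d" by simp
  with B2_coercive[OF e(1)] B2_bounded[OF e(1,2)]
  have "(1 - q) * (l2n cellM (weak_jacobian ?e))\<^sup>2 \<le> (1 + q) * l2n cellM (weak_jacobian ?e) * l2n cellM (weak_jacobian ?d)" by linarith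
  then have *: "l2n cellM (weak_jacobian ?e) * ((1 - q) * l2n cellM (weak_jacobian ?e)) \<le> l2n cellM (weak_jacobian ?e) * ((1 + q) * l2n cellM (weak_jacobian ?d))"
    by (simp add: power2_eq_square mult_ac)
  have "(1 - q) * l2n cellM (weak_jacobian ?e) \<le> (1 + q) * l2n cellM (weak_jacobian ?d)"
  proof (cases "l2n cellM (weak_jacobian ?e) = 0")
    case True
    then show ?thesis using q_bounds by simp
  next
    case False
    then have "l2n cellM (weak_jacobian ?e) > 0" using l2n_nonneg[of cellM "weak_jacobian ?e"] by linarith
    with * show ?thesis by (simp add: mult_le_cancel_left)
  qed
  then show ?thesis using q_bounds by (simp add: field_simps)
qed

text \<open>Coercivity annihilates the Jacobian of the difference, the Poincare inequality the
  difference itself on the cell, and periodicity carries this to the whole space.\<close>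

lemma discrete_unique:
  assumes P: "closed_subspace_H1_per0 P"
    and z: "z \<in> P" "\<And>w. w \<in> P \<Longrightarrow> B2 A b z w = rhs A b w"
    and z': "z' \<in> P" "\<And>w. w \<in> P \<Longrightarrow> B2 A b z' w = rhs A b w"
  shows "AE x in lebesgue. z' x = z x"
proof -
  have sub: "v \<in> P \<Longrightarrow> v \<in> H1_per0" for v using P by (auto simp: closed_subspace_H1_per0_def)
  interpret semi_hilbert P "\<lambda>v w. l2ip cellM (weak_jacobian v) (weak_jacobian w)"
    by (rule closed_subspace_semi_hilbert[OF P])
  let ?e = "\<lambda>x. z' x - z x"
  have e: "?e \<in> P" by (intro diff z z')
  have "B2 A b ?e ?e = 0" using z(2)[OF e] z'(2)[OF e] by (simp add: B2_linear(1) e sub z z')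
  then have "(1 - q) * (l2n cellM (weak_jacobian ?e))\<^sup>2 \<le> 0" using B2_coercive[OF sub[OF e]] by simp
  then have "(l2n cellM (weak_jacobian ?e))\<^sup>2 \<le> 0" using q_bounds by (simp add: mult_le_0_iff)
  then have "l2n cellM ?e = 0" using Poincare_H1_per0_le[OF sub[OF e]] l2n_nonneg[of cellM ?e] by simp
  from l2n_eq_0_AE[OF L2_per_sqint[OF H1_per0D(1)[OF sub[OF e]]] this]
  have "AE x in cellM. z' x = z x" by simp
  then show ?thesis
    using H1_per0D(1)[OF sub] z z' by (intro periodic_AE_cell_eq) (auto simp: L2_per_iff)
qed

end

theorem theorem2p4:
  fixes lam Lam \<delta> :: real
  shows "\<exists>C>0. \<forall>(A :: real ^ 'n \<Rightarrow> real ^ 'n ^ 'n) b \<rho> r P.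
    setting_B lam Lam \<delta> A b \<longrightarrow>
    \<rho> \<in> H1_per0 \<longrightarrow> (\<forall>w\<in>H1_per0. B2 A b \<rho> w = rhs A b w) \<longrightarrow>
    normalized_very_weak_solution A b r \<longrightarrow>
    closed_subspace_H1_per0 P \<longrightarrow>
    (\<exists>\<rho>h\<in>P.
       (\<forall>w\<in>P. B2 A b \<rho>h w = rhs A b w) \<and>
       (\<forall>\<rho>'\<in>P. (\<forall>w\<in>P. B2 A b \<rho>' w = rhs A b w) \<longrightarrow> (AE x in lebesgue. \<rho>' x = \<rho>h x)) \<and>
       (\<lambda>x. 1 - weak_div \<rho>h x) \<in> L2_per \<and>
       L2_norm (\<lambda>x. r x - (1 - weak_div \<rho>h x))
         \<le> C * (INF w\<in>P. L2_norm (weak_jacobian (\<lambda>x. \<rho> x - w x))))"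
proof -
  define q where "q = contraction_const \<delta>"
  \<comment> \<open>The constant is fixed before the coefficients are given. Outside the admissible
    range of \<open>\<delta>\<close> no coefficients satisfy \<open>setting_B\<close>, and 1 is an
    arbitrary positive value.\<close>
  define C where "C = (if real CARD('n) / (real CARD('n) + pi\<^sup>2) < \<delta> \<and> \<delta> \<le> 1 then (1 + q) / (1 - q) else 1)"
  have C0: "C > 0" using contraction_const_less_1[where 'n='n, of \<delta>] by (auto simp: C_def q_def)
  show ?thesis
  proof (intro exI[of _ C] conjI C0 allI impI)
    fix A :: "real ^ 'n \<Rightarrow> real ^ 'n ^ 'n" and b \<rho> r and P :: "(real ^ 'n \<Rightarrow> real ^ 'n) set"
    assume setting: "setting_B lam Lam \<delta> A b" and \<rho>: "\<rho> \<in> H1_per0" "\<forall>w\<in>H1_per0. B2 A b \<rho> w = rhs A b w"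
      and r: "normalized_very_weak_solution A b r" and P: "closed_subspace_H1_per0 P"
    interpret cordes lam Lam \<delta> A b by unfold_locales (rule setting)
    have C: "C = (1 + q) / (1 - q)" using delta by (simp add: C_def q_def)
    have sub: "v \<in> P \<Longrightarrow> v \<in> H1_per0" for v using P by (auto simp: closed_subspace_H1_per0_def)
    obtain z where z: "z \<in> P" "\<And>w. w \<in> P \<Longrightarrow> B2 A b z w = rhs A b w" using discrete_solution[OF P] by blast
    let ?e = "\<lambda>x. \<rho> x - z x"
    have e: "?e \<in> H1_per0" by (intro H1_per0_diff \<rho> sub z)
    have zd: "(\<lambda>x. 1 - weak_div z x) \<in> L2_per" by (intro L2_per_diff L2_per_const weak_div_sqint sub z)
    have rL: "r \<in> L2_per" using r by (simp add: normalized_very_weak_solution_def)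
    have "AE x in cellM. r x = 1 - weak_div \<rho> x" using very_weak_solution_eq \<rho> r by blast
    \<comment> \<open>Inserting \<open>r = 1 - weak_div \<rho>\<close> leaves minus the divergence
      of the field error, which its Jacobian bounds with constant 1.\<close>
    then have "AE x in cellM. r x - (1 - weak_div z x) = - weak_div ?e x"
      using residual_linear(5)[OF \<rho>(1) sub[OF z(1)]] by eventually_elim simp
    then have "L2_norm (\<lambda>x. r x - (1 - weak_div z x)) = l2n cellM (\<lambda>x. - weak_div ?e x)"
      unfolding L2_norm_eq
      by (intro l2n_cong_AE sqint_meas sqint_diff sqint_uminus L2_per_sqint rL zd weak_div_sqint e)
    also have "\<dots> \<le> l2n cellM (weak_jacobian ?e)" using weak_div_le[OF e] by (simp add: l2n_uminus)
    finally have bound: "L2_norm (\<lambda>x. r x - (1 - weak_div z x)) \<le> l2n cellM (weak_jacobian ?e)" .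
    \<comment> \<open>With \<open>C\<close> moved to the left, the bound for each single
      \<open>w\<close> says that the left side is a lower bound of the set, hence at most its
      infimum.\<close>
    have "L2_norm (\<lambda>x. r x - (1 - weak_div z x)) / C \<le> (INF w\<in>P. L2_norm (weak_jacobian (\<lambda>x. \<rho> x - w x)))"
    proof (rule cINF_greatest)
      show "P \<noteq> {}" using z by blast
      fix w assume w: "w \<in> P"
      have "L2_norm (\<lambda>x. r x - (1 - weak_div z x)) \<le> C * l2n cellM (weak_jacobian (\<lambda>x. \<rho> x - w x))"
        using bound quasi_optimality[OF P \<rho>(1) _ z w] \<rho>(2) unfolding C q_def by fastforce
      then show "L2_norm (\<lambda>x. r x - (1 - weak_div z x)) / C \<le> L2_norm (weak_jacobian (\<lambda>x. \<rho> x - w x))"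
        using C0 by (simp add: L2_norm_eq field_simps)
    qed
    then have "L2_norm (\<lambda>x. r x - (1 - weak_div z x)) \<le> C * (INF w\<in>P. L2_norm (weak_jacobian (\<lambda>x. \<rho> x - w x)))"
      using C0 by (simp add: field_simps)
    moreover have "\<forall>\<rho>'\<in>P. (\<forall>w\<in>P. B2 A b \<rho>' w = rhs A b w) \<longrightarrow> (AE x in lebesgue. \<rho>' x = z x)"
      using discrete_unique[OF P z] by blast
    ultimately show "\<exists>\<rho>h\<in>P.
       (\<forall>w\<in>P. B2 A b \<rho>h w = rhs A b w) \<and>
       (\<forall>\<rho>'\<in>P. (\<forall>w\<in>P. B2 A b \<rho>' w = rhs A b w) \<longrightarrow> (AE x in lebesgue. \<rho>' x = \<rho>h x)) \<and>
       (\<lambda>x. 1 - weak_div \<rho>h x) \<in> L2_per \<and>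
       L2_norm (\<lambda>x. r x - (1 - weak_div \<rho>h x))
         \<le> C * (INF w\<in>P. L2_norm (weak_jacobian (\<lambda>x. \<rho> x - w x)))"
      using z zd by blast
  qed
qed

end
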